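(* Let $\mathcal{T}_h$ be a simplicial triangulation of $\Omega$. Suppose $\sigma\in H^1(\mathcal{T}_h,\mathbb{R}^{d\times d})$, that $\sigma_{nn}|_{\partial T}\in H^{1/2}(\partial T)$ for every $T\in\mathcal{T}_h$, and that the normal-tangential trace $\sigma_{nt}$ is continuous across element interfaces. Then $\sigma\in H(\operatorname{curl}\operatorname{div},\Omega)$, and $$\langle \operatorname{div}(\sigma), v\rangle_{H_0(\operatorname{div},\Omega)}=\sum_{T\in\mathcal{T}_h}\Big[(\operatorname{div}(\sigma),v)_T-\langle v_n,\sigma_{nn}\rangle_{H^{1/2}(\partial T)}\Big]\quad\text{for all } v\in H_0(\operatorname{div},\Omega).$$
   Context: $d\in\{2,3\}$, $\tilde d=d(d-1)/2$, $\Omega\subset\mathbb{R}^d$ a bounded Lipschitz (polyhedral) domain. $H^1(\mathcal{T}_h,\mathbb{R}^{d\times d})$ denotes matrix fields whose restriction to each element is in $H^1$. For a matrix field $\sigma$, $\operatorname{div}\sigma$ is the row-wise divergence; on $\partial T$ with outward unit normal $n$, $\sigma_{nn}=n^T\sigma n$ and $\sigma_{nt}=\sigma n-\sigma_{nn}n$; for a vector field $v$, $v_n=v\cdot n$. $\langle v_n,\sigma_{nn}\rangle_{H^{1/2}(\partial T)}$ is the $H^{-1/2}(\partial T)\times H^{1/2}(\partial T)$ duality. $H_0(\operatorname{div},\Omega)=\{v\in L^2(\Omega,\mathbb{R}^d):\operatorname{div}v\in L^2,\ v\cdot n=0\text{ on }\partial\Omega\}$. $H(\operatorname{curl}\operatorname{div},\Omega)=\{\sigma\in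 L^2(\Omega,\mathbb{R}^{d\times d}):\operatorname{curl}(\operatorname{div}\sigma)\in H^{-1}(\Omega,\mathbb{R}^{\tilde d})\}$ (distributional derivatives; curl is the scalar 2D curl $-\partial_2\phi_1+\partial_1\phi_2$ when $d=2$ and the usual curl when $d=3$). The left side means that the distribution $\operatorname{div}\sigma$ extends to a continuous linear functional on $H_0(\operatorname{div},\Omega)$. *)

theory Defs
  imports "HOL-Analysis.Analysis"
begin

fun pd :: "'n::finite list \<Rightarrow> (real^'n \<Rightarrow> real) \<Rightarrow> real^'n \<Rightarrow> real" where
  "pd [] f = f"
| "pd (i # is) f = (\<lambda>x. deriv (\<lambda>t. pd is f (x + t *\<^sub>R axis i 1)) 0)"

definition smooth_fun :: "(real^'n::finite \<Rightarrow> real) \<Rightarrow> bool" where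
  "smooth_fun f \<longleftrightarrow>
     (\<forall>is i x. (\<lambda>t. pd is f (x + t *\<^sub>R axis i 1)) differentiable (at 0)) \<and>
     (\<forall>is. continuous_on UNIV (pd is f))"

definition tsupp :: "('a::topological_space \<Rightarrow> 'b::zero) \<Rightarrow> 'a set" where
  "tsupp f = closure {x. f x \<noteq> 0}"

definition test_fun :: "(real^'n::finite) set \<Rightarrow> (real^'n \<Rightarrow> real) \<Rightarrow> bool" where
  "test_fun U \<phi> \<longleftrightarrow> smooth_fun \<phi> \<and> compact (tsupp \<phi>) \<and> tsupp \<phi> \<subseteq> U"

definition smooth_cfield :: "(real^'n::finite \<Rightarrow> real^'n) \<Rightarrow> bool" where
  "smooth_cfield \<psi> \<longleftrightarrow> (\<forall>k. smooth_fun (\<lambda>x. \<psi> x $ k)) \<and> compact (tsupp \<psi>)"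

definition cdiv :: "(real^'n::finite \<Rightarrow> real^'n) \<Rightarrow> real^'n \<Rightarrow> real" where
  "cdiv \<psi> x = (\<Sum>k\<in>UNIV. pd [k] (\<lambda>y. \<psi> y $ k) x)"

definition cgrad :: "(real^'n::finite \<Rightarrow> real) \<Rightarrow> real^'n \<Rightarrow> real^'n" where
  "cgrad \<phi> x = (\<chi> k. pd [k] \<phi> x)"

definition L2 :: "(real^'n::finite) set \<Rightarrow> (real^'n \<Rightarrow> real) \<Rightarrow> bool" where
  "L2 U f \<longleftrightarrow> f \<in> borel_measurable (lebesgue_on U) \<and>
              integrable (lebesgue_on U) (\<lambda>x. (f x)\<^sup>2)"

definition intg :: "(real^'n::finite) set \<Rightarrow> (real^'n \<Rightarrow> real) \<Rightarrow> real" where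
  "intg U f = integral\<^sup>L (lebesgue_on U) f"

definition weak_deriv :: "(real^'n::finite) set \<Rightarrow> (real^'n \<Rightarrow> real) \<Rightarrow> 'n \<Rightarrow> (real^'n \<Rightarrow> real) \<Rightarrow> bool" where
  "weak_deriv U f i g \<longleftrightarrow>
     (\<forall>\<phi>. test_fun U \<phi> \<longrightarrow> intg U (\<lambda>x. f x * pd [i] \<phi> x) = - intg U (\<lambda>x. g x * \<phi> x))"

definition H1 :: "(real^'n::finite) set \<Rightarrow> (real^'n \<Rightarrow> real) \<Rightarrow> bool" where
  "H1 U f \<longleftrightarrow> L2 U f \<and> (\<forall>i. \<exists>g. L2 U g \<and> weak_deriv U f i g)"

definition wd :: "(real^'n::finite) set \<Rightarrow> (real^'n \<Rightarrow> real) \<Rightarrow> 'n \<Rightarrow> real^'n \<Rightarrow> real" where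
  "wd U f i = (SOME g. L2 U g \<and> weak_deriv U f i g)"

definition weak_div :: "(real^'n::finite) set \<Rightarrow> (real^'n \<Rightarrow> real^'n) \<Rightarrow> (real^'n \<Rightarrow> real) \<Rightarrow> bool" where
  "weak_div U v g \<longleftrightarrow>
     (\<forall>\<phi>. test_fun U \<phi> \<longrightarrow> intg U (\<lambda>x. v x \<bullet> cgrad \<phi> x) = - intg U (\<lambda>x. g x * \<phi> x))"

definition Hdiv :: "(real^'n::finite) set \<Rightarrow> (real^'n \<Rightarrow> real^'n) \<Rightarrow> bool" where
  "Hdiv U v \<longleftrightarrow> (\<forall>k. L2 U (\<lambda>x. v x $ k)) \<and> (\<exists>g. L2 U g \<and> weak_div U v g)"

definition wdiv :: "(real^'n::finite) set \<Rightarrow> (real^'n \<Rightarrow> real^'n) \<Rightarrow> real^'n \<Rightarrow> real" where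
  "wdiv U v = (SOME g. L2 U g \<and> weak_div U v g)"

text \<open>H_0(div, Omega): H(div) fields with vanishing normal trace on the boundary
  (Green's formula against all functions smooth up to the boundary).\<close>
definition H0div :: "(real^'n::finite) set \<Rightarrow> (real^'n \<Rightarrow> real^'n) \<Rightarrow> bool" where
  "H0div \<Omega> v \<longleftrightarrow> Hdiv \<Omega> v \<and>
     (\<forall>\<phi>. smooth_fun \<phi> \<and> compact (tsupp \<phi>) \<longrightarrow>
        intg \<Omega> (\<lambda>x. v x \<bullet> cgrad \<phi> x + wdiv \<Omega> v x * \<phi> x) = 0)"

definition Hdiv_norm :: "(real^'n::finite) set \<Rightarrow> (real^'n \<Rightarrow> real^'n) \<Rightarrow> real" where
  "Hdiv_norm U v = sqrt (intg U (\<lambda>x. (norm (v x))\<^sup>2) + intg U (\<lambda>x. (wdiv U v x)\<^sup>2))"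

definition H1_norm :: "(real^'n::finite) set \<Rightarrow> (real^'n \<Rightarrow> real) \<Rightarrow> real" where
  "H1_norm U f = sqrt (intg U (\<lambda>x. (f x)\<^sup>2) + (\<Sum>i\<in>UNIV. intg U (\<lambda>x. (wd U f i x)\<^sup>2)))"

definition lipschitz_domain :: "(real^'n::finite) set \<Rightarrow> bool" where
  "lipschitz_domain \<Omega> \<longleftrightarrow> open \<Omega> \<and> bounded \<Omega> \<and> connected \<Omega> \<and> \<Omega> \<noteq> {} \<and>
     (\<forall>x\<in>frontier \<Omega>. \<exists>Q k g C r.
        orthogonal_transformation Q \<and> r > 0 \<and> C-lipschitz_on UNIV g \<and>
        (\<forall>y::real^'n. g y = g (y - (y $ k) *\<^sub>R axis k 1)) \<and>
        (\<forall>y::real^'n. norm y < r \<longrightarrow> (x + Q y \<in> \<Omega> \<longleftrightarrow> y $ k < g y)))"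

definition simplicial_triangulation :: "(real^'n::finite) set set \<Rightarrow> (real^'n) set \<Rightarrow> bool" where
  "simplicial_triangulation \<T> \<Omega> \<longleftrightarrow> finite \<T> \<and>
     (\<forall>T\<in>\<T>. (int CARD('n)) simplex T) \<and>
     \<Union>\<T> = closure \<Omega> \<and>
     (\<forall>T1\<in>\<T>. \<forall>T2\<in>\<T>. T1 \<inter> T2 face_of T1 \<and> T1 \<inter> T2 face_of T2)"

definition outer_normal :: "(real^'n::finite) set \<Rightarrow> (real^'n) set \<Rightarrow> real^'n" where
  "outer_normal T F = (SOME n. norm n = 1 \<and> (\<forall>x\<in>F. \<forall>y\<in>T. n \<bullet> (y - x) \<le> 0))"

section \<open>Traces (defined weakly through Green's formula)\<close>

definition trace_zero_on :: "(real^'n::finite) set \<Rightarrow> (real^'n) set \<Rightarrow> (real^'n \<Rightarrow> real) \<Rightarrow> bool" where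
  "trace_zero_on T F u \<longleftrightarrow>
     (\<forall>\<psi>. smooth_cfield \<psi> \<and> tsupp \<psi> \<inter> frontier T \<subseteq> rel_interior F \<longrightarrow>
        intg (interior T) (\<lambda>x. u x * cdiv \<psi> x + (\<Sum>k\<in>UNIV. wd (interior T) u k x * \<psi> x $ k)) = 0)"

definition trace_eq_across ::
  "(real^'n::finite) set \<Rightarrow> (real^'n) set \<Rightarrow> (real^'n) set \<Rightarrow> (real^'n \<Rightarrow> real) \<Rightarrow> (real^'n \<Rightarrow> real) \<Rightarrow> bool" where
  "trace_eq_across T1 T2 F u1 u2 \<longleftrightarrow>
     (\<forall>\<psi>. smooth_cfield \<psi> \<and> tsupp \<psi> \<inter> (frontier T1 \<union> frontier T2) \<subseteq> rel_interior F \<longrightarrow>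
        intg (interior T1) (\<lambda>x. u1 x * cdiv \<psi> x + (\<Sum>k\<in>UNIV. wd (interior T1) u1 k x * \<psi> x $ k))
      + intg (interior T2) (\<lambda>x. u2 x * cdiv \<psi> x + (\<Sum>k\<in>UNIV. wd (interior T2) u2 k x * \<psi> x $ k)) = 0)"

definition snn :: "(real^'n::finite) \<Rightarrow> (real^'n^'n) \<Rightarrow> real" where
  "snn n S = n \<bullet> (S *v n)"

definition snt :: "(real^'n::finite) \<Rightarrow> (real^'n^'n) \<Rightarrow> real^'n" where
  "snt n S = S *v n - snn n S *\<^sub>R n"

text \<open>H^{1/2}(dT) is the trace space of H^1(int T): sigma_nn|dT is in H^{1/2}(dT) iff
  some w in H^1(int T) has trace equal to sigma_nn on every facet.\<close>
definition nn_H12_ext :: "(real^'n::finite) set \<Rightarrow> (real^'n \<Rightarrow> real^'n^'n) \<Rightarrow> (real^'n \<Rightarrow> real) \<Rightarrow> bool" where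
  "nn_H12_ext T \<sigma> w \<longleftrightarrow> H1 (interior T) w \<and>
     (\<forall>F. F facet_of T \<longrightarrow>
        trace_zero_on T F (\<lambda>x. w x - snn (outer_normal T F) (\<sigma> x)))"

definition nn_in_H12 :: "(real^'n::finite) set \<Rightarrow> (real^'n \<Rightarrow> real^'n^'n) \<Rightarrow> bool" where
  "nn_in_H12 T \<sigma> \<longleftrightarrow> (\<exists>w. nn_H12_ext T \<sigma> w)"

text \<open>Duality <v_n, sigma_nn>_{H^{1/2}(dT)} for v in H(div, T), via Green's formula
  with an H^1(T) extension w of sigma_nn.\<close>
definition normal_pairing :: "(real^'n::finite) set \<Rightarrow> (real^'n \<Rightarrow> real^'n) \<Rightarrow> (real^'n \<Rightarrow> real^'n^'n) \<Rightarrow> real" where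
  "normal_pairing T v \<sigma> =
     (let w = (SOME w. nn_H12_ext T \<sigma> w) in
      intg (interior T) (\<lambda>x. wdiv (interior T) v x * w x + (\<Sum>k\<in>UNIV. v x $ k * wd (interior T) w k x)))"

definition broken_H1 :: "(real^'n::finite) set set \<Rightarrow> (real^'n \<Rightarrow> real^'n^'n) \<Rightarrow> bool" where
  "broken_H1 \<T> \<sigma> \<longleftrightarrow> (\<forall>T\<in>\<T>. \<forall>i j. H1 (interior T) (\<lambda>x. \<sigma> x $ i $ j))"

text \<open>sigma_nt is continuous across every interior facet (fixed orientation of the normal).\<close>
definition nt_continuous :: "(real^'n::finite) set set \<Rightarrow> (real^'n \<Rightarrow> real^'n^'n) \<Rightarrow> bool" where
  "nt_continuous \<T> \<sigma> \<longleftrightarrow>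
     (\<forall>T1\<in>\<T>. \<forall>T2\<in>\<T>. T1 \<noteq> T2 \<and> (T1 \<inter> T2) facet_of T1 \<and> (T1 \<inter> T2) facet_of T2 \<longrightarrow>
        (\<forall>k. trace_eq_across T1 T2 (T1 \<inter> T2)
               (\<lambda>x. snt (outer_normal T1 (T1 \<inter> T2)) (\<sigma> x) $ k)
               (\<lambda>x. snt (outer_normal T1 (T1 \<inter> T2)) (\<sigma> x) $ k)))"

definition elem_div_pairing :: "(real^'n::finite) set \<Rightarrow> (real^'n \<Rightarrow> real^'n^'n) \<Rightarrow> (real^'n \<Rightarrow> real^'n) \<Rightarrow> real" where
  "elem_div_pairing T \<sigma> v =
     intg (interior T) (\<lambda>x. \<Sum>i\<in>UNIV. (\<Sum>j\<in>UNIV. wd (interior T) (\<lambda>y. \<sigma> y $ i $ j) j x) * v x $ i)"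

text \<open>The components of curl(div sigma) (for d = 2 the scalar curl is the pair (1,2); for d = 3
  the three components are the pairs (2,3),(3,1),(1,2)) as distributions:
  <d_i (div sigma)_j - d_j (div sigma)_i, psi>
    = int sum_k sigma_jk d_k d_i psi - sigma_ik d_k d_j psi.
  Membership in H^{-1} = boundedness w.r.t. the H^1 norm on test functions.\<close>
definition Hcurldiv :: "(real^'n::finite) set \<Rightarrow> (real^'n \<Rightarrow> real^'n^'n) \<Rightarrow> bool" where
  "Hcurldiv \<Omega> \<sigma> \<longleftrightarrow> (\<forall>i j. L2 \<Omega> (\<lambda>x. \<sigma> x $ i $ j)) \<and>
     (\<forall>i j. \<exists>C. \<forall>\<psi>. test_fun \<Omega> \<psi> \<longrightarrow>
        \<bar>intg \<Omega> (\<lambda>x. \<Sum>k\<in>UNIV. \<sigma> x $ j $ k * pd [k, i] \<psi> x - \<sigma> x $ i $ k * pd [k, j] \<psi> x)\<bar>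
          \<le> C * H1_norm \<Omega> \<psi>)"

definition div_extension :: "(real^'n::finite) set \<Rightarrow> (real^'n \<Rightarrow> real^'n^'n) \<Rightarrow> ((real^'n \<Rightarrow> real^'n) \<Rightarrow> real) \<Rightarrow> bool" where
  "div_extension \<Omega> \<sigma> L \<longleftrightarrow>
     (\<forall>v w a b. H0div \<Omega> v \<and> H0div \<Omega> w \<longrightarrow> L (\<lambda>x. a *\<^sub>R v x + b *\<^sub>R w x) = a * L v + b * L w) \<and>
     (\<exists>C. \<forall>v. H0div \<Omega> v \<longrightarrow> \<bar>L v\<bar> \<le> C * Hdiv_norm \<Omega> v) \<and>
     (\<forall>\<phi>. (\<forall>i. test_fun \<Omega> (\<lambda>x. \<phi> x $ i)) \<longrightarrow>
        L \<phi> = - intg \<Omega> (\<lambda>x. \<Sum>i\<in>UNIV. \<Sum>j\<in>UNIV. \<sigma> x $ i $ j * pd [j] (\<lambda>y. \<phi> y $ i) x))"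

end

theory Submission
  imports Defs
begin

text \<open>Let \<open>w\<^sub>T\<close> be an \<open>H\<^sup>1\<close> extension of \<open>\<sigma>\<^sub>n\<^sub>n\<close> on each element. The right-hand side of the formula is bounded in the
  H(div) norm, so it only has to agree with the distribution \<open>div \<sigma>\<close> on test fields \<open>\<phi>\<close>. Componentwise, the
  defect is the sum over the elements of the integral of \<open>div (\<eta> (\<sigma>\<^sub>i - w\<^sub>T e\<^sub>i))\<close>, where \<open>\<eta> = \<phi>\<^sub>i\<close> and \<open>\<sigma>\<^sub>i\<close> is
  the i-th row of \<open>\<sigma>\<close>. Since the traces are only known on the relative interiors of facets, \<open>\<eta>\<close> is first cut
  off near the faces of codimension two, which have zero \<open>H\<^sup>1\<close> capacity, and then localised to small balls.
  A ball meeting the skeleton meets exactly two elements and their common facet; there the tangential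
  derivatives integrate to zero, so the defect reduces to the fluxes of \<open>(\<sigma>\<^sub>n\<^sub>t)\<^sub>i\<close> from the two sides,
  which cancel.\<close>

section \<open>Smooth functions\<close>

text \<open>All boundary terms are volume integrals, since the trace conditions are stated through
  Green's formula, with scalar traces tested against vector fields; \<open>flux\<close> isolates one
  direction of that formula. Scalar conditions suffice because near a flat piece of boundary the
  whole vector of fluxes is a multiple of the normal: \<open>flux\<close> in direction j is n_j N(u)
  for one number N(u). Hence the defect of row i on an element is the sum over j of n_j
  N(\<sigma>_ij), minus n_i N(w), and N(w) = N(\<sigma>_nn) by the choice of w, which leaves N of
  the i-th component of \<sigma>_nt. This quantity tested with the normal is even in n, so one
  normal serves both elements at a facet and the continuity hypothesis applies as stated. The
  capacity step needs no bound on \<sigma>: square integrable coefficients are enough. The graph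
  condition in \<open>lipschitz_domain\<close> is what places the open elements inside \<Omega>. The
  claim on curl div \<sigma> comes from the same bound in the H(div) norm.\<close>

definition has_pd :: "(real^'n::finite \<Rightarrow> real) \<Rightarrow> 'n \<Rightarrow> (real^'n \<Rightarrow> real) \<Rightarrow> bool" where
  "has_pd f i g \<longleftrightarrow> (\<forall>x. ((\<lambda>t. f (x + t *\<^sub>R axis i 1)) has_real_derivative g x) (at 0))"

lemma pd_append: "pd (is @ js) f = pd is (pd js f)"
  by (induction "is") auto

declare pd.simps(2) [simp del]

lemma pd_Cons: "pd (i # is) f = pd [i] (pd is f)"
  by (simp add: pd.simps)

lemma has_pd_imp_pd: "has_pd f i g \<Longrightarrow> pd [i] f = g"
  by (auto simp: has_pd_def pd.simps intro!: ext DERIV_imp_deriv)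

lemma differentiable_imp_has_pd:
  assumes "\<And>x. (\<lambda>t. f (x + t *\<^sub>R axis i 1)) differentiable (at 0)"
  shows "has_pd f i (pd [i] f)"
  using assms by (auto simp: has_pd_def pd.simps DERIV_deriv_iff_real_differentiable)

lemma has_pd_imp_differentiable:
  "has_pd f i g \<Longrightarrow> (\<lambda>t. f (x + t *\<^sub>R axis i 1)) differentiable (at 0)"
  by (auto simp: has_pd_def real_differentiable_def)

lemma has_pd_at:
  assumes "has_pd f i g"
  shows "((\<lambda>t. f (x + t *\<^sub>R axis i 1)) has_real_derivative g (x + t0 *\<^sub>R axis i 1)) (at t0)"
proof -
  have "((\<lambda>t. f ((x + t0 *\<^sub>R axis i 1) + t *\<^sub>R axis i 1)) has_real_derivative g (x + t0 *\<^sub>R axis i 1)) (at 0)"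
    using assms by (auto simp: has_pd_def)
  then have "((\<lambda>t. f (x + (t + t0) *\<^sub>R axis i 1)) has_real_derivative g (x + t0 *\<^sub>R axis i 1)) (at 0)"
    by (simp add: algebra_simps)
  then show ?thesis
    using DERIV_shift[of "\<lambda>t. f (x + t *\<^sub>R axis i 1)" _ 0 t0] by simp
qed

lemma has_pd_const: "has_pd (\<lambda>x. c) i (\<lambda>x. 0)"
  by (simp add: has_pd_def)

lemma has_pd_inner: "has_pd (\<lambda>x. a \<bullet> x) i (\<lambda>x. a $ i)"
  unfolding has_pd_def
  by (auto intro!: derivative_eq_intros simp: inner_add_right inner_axis)

lemma has_pd_add:
  assumes "has_pd f i f'" "has_pd g i g'"
  shows "has_pd (\<lambda>x. f x + g x) i (\<lambda>x. f' x + g' x)"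
  using assms unfolding has_pd_def by (auto intro!: derivative_intros)

lemma has_pd_mult:
  assumes "has_pd f i f'" "has_pd g i g'"
  shows "has_pd (\<lambda>x. f x * g x) i (\<lambda>x. f' x * g x + f x * g' x)"
  unfolding has_pd_def
proof
  fix x
  show "((\<lambda>t. f (x + t *\<^sub>R axis i 1) * g (x + t *\<^sub>R axis i 1)) has_real_derivative f' x * g x + f x * g' x) (at 0)"
    using assms[unfolded has_pd_def, THEN spec, of x]
    by (auto intro!: derivative_eq_intros)
qed

text \<open>The derivative is written as products of a constant, \<open>f'\<close> and copies of
  \<open>inverse (f x)\<close>, so that the closure rules for constants and products apply to it
  verbatim in the induction of \<open>ndiff_inverse\<close>.\<close>

lemma has_pd_inverse:
  assumes "has_pd f i f'" "\<And>x. f x \<noteq> 0"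
  shows "has_pd (\<lambda>x. inverse (f x)) i (\<lambda>x. - 1 * (f' x * (inverse (f x) * inverse (f x))))"
  unfolding has_pd_def
proof
  fix x
  show "((\<lambda>t. inverse (f (x + t *\<^sub>R axis i 1))) has_real_derivative - 1 * (f' x * (inverse (f x) * inverse (f x)))) (at 0)"
    using assms(1)[unfolded has_pd_def, THEN spec, of x] assms(2)
    by (auto intro!: derivative_eq_intros)
qed

lemma has_pd_chain:
  assumes "has_pd f i f'" "\<And>t. (h has_real_derivative h' t) (at t)"
  shows "has_pd (\<lambda>x. h (f x)) i (\<lambda>x. h' (f x) * f' x)"
  unfolding has_pd_def
proof
  fix x
  show "((\<lambda>t. h (f (x + t *\<^sub>R axis i 1))) has_real_derivative h' (f x) * f' x) (at 0)"
    using DERIV_chain2[of h _ "\<lambda>t. f (x + t *\<^sub>R axis i 1)" 0] assms(2)[of "f x"]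
      assms(1)[unfolded has_pd_def, THEN spec, of x]
    by simp
qed

text \<open>\<open>smooth_fun\<close> quantifies over all words of derivatives at once, which gives
  no induction for products, inverses or compositions. Here the derivative taken first is peeled
  off, so each closure property becomes an induction on the order.\<close>

fun ndiff :: "nat \<Rightarrow> (real^'n::finite \<Rightarrow> real) \<Rightarrow> bool" where
  "ndiff 0 f \<longleftrightarrow> continuous_on UNIV f"
| "ndiff (Suc n) f \<longleftrightarrow> continuous_on UNIV f \<and> (\<forall>i. has_pd f i (pd [i] f) \<and> ndiff n (pd [i] f))"

lemma ndiff_SucI:
  assumes "continuous_on UNIV f" "\<And>i. \<exists>g. has_pd f i g \<and> ndiff n g"
  shows "ndiff (Suc n) f"
proof -
  have "has_pd f i (pd [i] f) \<and> ndiff n (pd [i] f)" for i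
    using assms(2)[of i] has_pd_imp_pd by auto
  with assms(1) show ?thesis by simp
qed

lemma ndiff_Suc_imp: "ndiff (Suc n) f \<Longrightarrow> ndiff n f"
  by (induction n arbitrary: f) auto

lemma ndiff_imp_pd:
  assumes "ndiff (Suc n) f" "length is \<le> n"
  shows "continuous_on UNIV (pd is f) \<and> has_pd (pd is f) i (pd [i] (pd is f))"
  using assms
proof (induction n arbitrary: f "is")
  case 0 then show ?case by auto
next
  case (Suc n)
  show ?case
  \<comment> \<open>\<open>pd\<close> applies the last index of the word first, while
    \<open>ndiff\<close> recurses into the first derivative; hence the split at the right
    end.\<close>
  proof (cases "is" rule: rev_cases)
    case Nil
    then show ?thesis using Suc by auto
  next
    case (snoc js j)
    then have "pd is f = pd js (pd [j] f)" by (simp only: pd_append)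
    moreover have "ndiff (Suc n) (pd [j] f)" using Suc.prems(1) by auto
    ultimately show ?thesis using Suc.IH[of "pd [j] f" js] Suc.prems(2) snoc by auto
  qed
qed

lemma smooth_fun_pd: "smooth_fun f \<Longrightarrow> smooth_fun (pd is f)"
  unfolding smooth_fun_def by (simp add: pd_append[symmetric])

lemma smooth_fun_has_pd: "smooth_fun f \<Longrightarrow> has_pd f i (pd [i] f)"
  by (rule differentiable_imp_has_pd) (auto simp: smooth_fun_def dest: spec[where x="[]"])

lemma smooth_fun_continuous: "smooth_fun f \<Longrightarrow> continuous_on UNIV f"
  by (auto simp: smooth_fun_def dest: spec[where x="[]"])

lemma smooth_fun_iff_ndiff: "smooth_fun f \<longleftrightarrow> (\<forall>n. ndiff n f)"
proof
  assume f: "smooth_fun f"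
  have "smooth_fun f \<Longrightarrow> ndiff n f" for n
  proof (induction n arbitrary: f)
    case 0 then show ?case by (simp add: smooth_fun_continuous)
  next
    case (Suc n) then show ?case
      by (simp add: smooth_fun_continuous smooth_fun_has_pd smooth_fun_pd)
  qed
  with f show "\<forall>n. ndiff n f" by blast
next
  assume "\<forall>n. ndiff n f"
  then have *: "continuous_on UNIV (pd is f) \<and> has_pd (pd is f) i (pd [i] (pd is f))" for "is" i
    by (metis ndiff_imp_pd order_refl)
  show "smooth_fun f"
    unfolding smooth_fun_def
    using has_pd_imp_differentiable[OF conjunct2[OF *]] conjunct1[OF *] by simp
qed

lemma ndiff_const: "ndiff n (\<lambda>x. c)"
proof (induction n arbitrary: c)
  case (Suc n)
  show ?case
  proof (rule ndiff_SucI)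
    show "\<exists>g. has_pd (\<lambda>x::real^'a. c) i g \<and> ndiff n g" for i
      by (rule exI[of _ "\<lambda>x. 0"]) (simp add: Suc has_pd_const)
  qed simp
qed auto

lemma ndiff_inner: "ndiff n (\<lambda>x. a \<bullet> x)"
proof (cases n)
  case 0 then show ?thesis by (auto intro!: continuous_intros)
next
  case (Suc m)
  show ?thesis unfolding Suc
  proof (rule ndiff_SucI)
    show "\<exists>g. has_pd (\<lambda>x. a \<bullet> x) i g \<and> ndiff m g" for i
      by (intro exI conjI) (rule has_pd_inner, rule ndiff_const)
  qed (intro continuous_intros)
qed

lemma ndiff_add: "ndiff n f \<Longrightarrow> ndiff n g \<Longrightarrow> ndiff n (\<lambda>x. f x + g x)"
proof (induction n arbitrary: f g)
  case 0 then show ?case by (auto intro!: continuous_intros)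
next
  case (Suc n)
  show ?case
  proof (rule ndiff_SucI)
    show "continuous_on UNIV (\<lambda>x. f x + g x)" using Suc.prems by (auto intro!: continuous_intros)
    fix i
    show "\<exists>h. has_pd (\<lambda>x. f x + g x) i h \<and> ndiff n h"
      using Suc.prems by (intro exI conjI) (rule has_pd_add, auto intro: Suc.IH)
  qed
qed

lemma ndiff_mult: "ndiff n f \<Longrightarrow> ndiff n g \<Longrightarrow> ndiff n (\<lambda>x. f x * g x)"
proof (induction n arbitrary: f g)
  case 0 then show ?case by (auto intro!: continuous_intros)
next
  case (Suc n)
  show ?case
  proof (rule ndiff_SucI)
    show "continuous_on UNIV (\<lambda>x. f x * g x)" using Suc.prems by (auto intro!: continuous_intros)
    fix i
    have fg: "has_pd f i (pd [i] f)" "has_pd g i (pd [i] g)" "ndiff n (pd [i] f)" "ndiff n (pd [i] g)"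
      using Suc.prems by auto
    have "ndiff n (\<lambda>x. pd [i] f x * g x + f x * pd [i] g x)"
      by (intro ndiff_add Suc.IH fg Suc.prems[THEN ndiff_Suc_imp])
    then show "\<exists>h. has_pd (\<lambda>x. f x * g x) i h \<and> ndiff n h"
      by (intro exI conjI) (rule has_pd_mult[OF fg(1,2)])
  qed
qed

lemma ndiff_inverse:
  assumes "\<And>x. f x \<noteq> 0"
  shows "ndiff n f \<Longrightarrow> ndiff n (\<lambda>x. inverse (f x))"
proof (induction n)
  case 0 then show ?case using assms by (auto intro!: continuous_intros)
next
  case (Suc n)
  show ?case
  proof (rule ndiff_SucI)
    show "continuous_on UNIV (\<lambda>x. inverse (f x))" using Suc.prems assms by (auto intro!: continuous_intros)
    fix i
    have f: "has_pd f i (pd [i] f)" "ndiff n (pd [i] f)" "ndiff n (\<lambda>x. inverse (f x))"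
      using Suc.prems Suc.IH[OF ndiff_Suc_imp[OF Suc.prems]] by auto
    show "\<exists>h. has_pd (\<lambda>x. inverse (f x)) i h \<and> ndiff n h"
      by (intro exI conjI) (rule has_pd_inverse[OF f(1) assms], intro ndiff_mult ndiff_const f)
  qed
qed

text \<open>The derivative of \<open>h\<close> has to be composed with \<open>f\<close> again, so
  the induction runs over a class \<open>H\<close> closed under differentiation instead of a single
  function. It is used with \<open>H = range flat\<close>.\<close>

lemma ndiff_chain:
  assumes H: "\<And>h. h \<in> H \<Longrightarrow> \<exists>h'\<in>H. \<forall>t. (h has_real_derivative h' t) (at t)"
  shows "h \<in> H \<Longrightarrow> ndiff n f \<Longrightarrow> ndiff n (\<lambda>x. h (f x))"
proof (induction n arbitrary: h)
  case 0
  then have "continuous_on UNIV h" using H by (meson DERIV_continuous_on has_field_derivative_at_within)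
  with 0 show ?case by (auto intro: continuous_on_compose2)
next
  case (Suc n)
  obtain h' where h': "h' \<in> H" "\<And>t. (h has_real_derivative h' t) (at t)" using H Suc.prems by blast
  then have "continuous_on UNIV h" by (meson DERIV_continuous_on has_field_derivative_at_within)
  show ?case
  proof (rule ndiff_SucI)
    show "continuous_on UNIV (\<lambda>x. h (f x))"
      using \<open>continuous_on UNIV h\<close> Suc.prems by (auto intro: continuous_on_compose2)
    fix i
    have f: "has_pd f i (pd [i] f)" "ndiff n (pd [i] f)" "ndiff n f"
      using Suc.prems(2) ndiff_Suc_imp[OF Suc.prems(2)] by auto
    show "\<exists>g. has_pd (\<lambda>x. h (f x)) i g \<and> ndiff n g"
      by (intro exI conjI) (rule has_pd_chain[OF f(1) h'(2)], intro ndiff_mult f Suc.IH h')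
  qed
qed

lemma smooth_fun_const [simp]: "smooth_fun (\<lambda>x. c)"
  by (simp add: smooth_fun_iff_ndiff ndiff_const)

lemma smooth_fun_inner: "smooth_fun (\<lambda>x. a \<bullet> x)"
  by (simp add: smooth_fun_iff_ndiff ndiff_inner)

lemma smooth_fun_add: "smooth_fun f \<Longrightarrow> smooth_fun g \<Longrightarrow> smooth_fun (\<lambda>x. f x + g x)"
  by (simp add: smooth_fun_iff_ndiff ndiff_add)

lemma smooth_fun_mult: "smooth_fun f \<Longrightarrow> smooth_fun g \<Longrightarrow> smooth_fun (\<lambda>x. f x * g x)"
  by (simp add: smooth_fun_iff_ndiff ndiff_mult)

lemma smooth_fun_uminus: "smooth_fun f \<Longrightarrow> smooth_fun (\<lambda>x. - f x)"
  using smooth_fun_mult[OF smooth_fun_const[of "-1"], of f] by simp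

lemma smooth_fun_diff: "smooth_fun f \<Longrightarrow> smooth_fun g \<Longrightarrow> smooth_fun (\<lambda>x. f x - g x)"
  using smooth_fun_add[OF _ smooth_fun_uminus, of f g] by simp

lemma smooth_fun_sum:
  "(\<And>i. i \<in> I \<Longrightarrow> smooth_fun (f i)) \<Longrightarrow> smooth_fun (\<lambda>x. \<Sum>i\<in>I. f i x)"
  by (induction I rule: infinite_finite_induct) (auto intro: smooth_fun_add)

lemma smooth_fun_norm_sq: "smooth_fun (\<lambda>x. (norm (x - c))\<^sup>2)"
proof -
  have "(\<lambda>x::real^'a. (norm (x - c))\<^sup>2)
      = (\<lambda>x. \<Sum>k\<in>UNIV. (axis k 1 \<bullet> x - c $ k) * (axis k 1 \<bullet> x - c $ k))"
    unfolding power2_norm_eq_inner inner_vec_def[of "x - c" for x] by (simp add: inner_axis')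
  then show ?thesis
    by (simp only:) (intro smooth_fun_sum smooth_fun_mult smooth_fun_diff smooth_fun_inner smooth_fun_const)
qed

lemma pd_const [simp]: "pd [i] (\<lambda>x. c) = (\<lambda>x. 0)"
  by (rule has_pd_imp_pd[OF has_pd_const])

lemma pd_add:
  "smooth_fun f \<Longrightarrow> smooth_fun g \<Longrightarrow> pd [i] (\<lambda>x. f x + g x) = (\<lambda>x. pd [i] f x + pd [i] g x)"
  by (intro has_pd_imp_pd has_pd_add smooth_fun_has_pd)

lemma pd_mult:
  "smooth_fun f \<Longrightarrow> smooth_fun g \<Longrightarrow> pd [i] (\<lambda>x. f x * g x) = (\<lambda>x. pd [i] f x * g x + f x * pd [i] g x)"
  by (intro has_pd_imp_pd has_pd_mult smooth_fun_has_pd)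

lemma pd_zero_on_open:
  assumes "open U" "\<And>x. x \<in> U \<Longrightarrow> f x = 0" "x \<in> U"
  shows "pd [i] f x = 0"
proof -
  have "((\<lambda>t. x + t *\<^sub>R axis i 1) \<longlongrightarrow> x + 0 *\<^sub>R axis i 1) (nhds (0::real))"
    by (intro tendsto_intros filterlim_ident)
  then have "\<forall>\<^sub>F t in nhds (0::real). x + t *\<^sub>R axis i 1 \<in> U"
    by (rule topological_tendstoD) (use assms in auto)
  then have "\<forall>\<^sub>F t in nhds (0::real). f (x + t *\<^sub>R axis i 1) = 0"
    by eventually_elim (rule assms(2))
  then have "deriv (\<lambda>t. f (x + t *\<^sub>R axis i 1)) 0 = deriv (\<lambda>t. 0) 0"
    by (intro deriv_cong_ev) auto
  then show ?thesis by (simp add: pd.simps)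
qed

section \<open>Supports and test functions\<close>

lemma not_tsupp: "x \<notin> tsupp f \<Longrightarrow> f x = 0"
  using subsetD[OF closure_subset, of x "{x. f x \<noteq> 0}"] by (auto simp: tsupp_def)

lemma tsupp_subset: "closed C \<Longrightarrow> (\<And>x. x \<notin> C \<Longrightarrow> f x = 0) \<Longrightarrow> tsupp f \<subseteq> C"
  unfolding tsupp_def by (rule closure_minimal) auto

lemma closed_tsupp [simp]: "closed (tsupp f)"
  by (simp add: tsupp_def)

lemma pd_not_tsupp: "x \<notin> tsupp f \<Longrightarrow> pd [i] f x = 0"
  by (rule pd_zero_on_open[of "- tsupp f"]) (simp_all add: not_tsupp open_Compl)

lemma tsupp_pd: "tsupp (pd [i] f) \<subseteq> tsupp f"
  by (rule tsupp_subset) (auto simp: pd_not_tsupp)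

lemma tsupp_mult_subset:
  fixes f g :: "'a::topological_space \<Rightarrow> real"
  shows "tsupp (\<lambda>x. f x * g x) \<subseteq> tsupp f \<inter> tsupp g"
  by (rule tsupp_subset) (auto simp: not_tsupp closed_Int)

lemma tsupp_mult1:
  fixes f g :: "'a::topological_space \<Rightarrow> real"
  shows "tsupp (\<lambda>x. f x * g x) \<subseteq> tsupp f"
  using tsupp_mult_subset by blast

lemma test_fun_smooth: "test_fun U f \<Longrightarrow> smooth_fun f"
  by (simp add: test_fun_def)

lemma test_fun_mono: "test_fun U f \<Longrightarrow> U \<subseteq> V \<Longrightarrow> test_fun V f"
  by (auto simp: test_fun_def)

lemma test_fun_tsupp_subset:
  assumes "test_fun U f" "smooth_fun g" "tsupp g \<subseteq> tsupp f"
  shows "test_fun U g"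
proof -
  have "compact (tsupp f \<inter> tsupp g)" using assms by (intro compact_Int_closed) (auto simp: test_fun_def)
  moreover have "tsupp f \<inter> tsupp g = tsupp g" using assms by auto
  ultimately show ?thesis using assms by (auto simp: test_fun_def)
qed

lemma test_fun_mult: "test_fun U f \<Longrightarrow> smooth_fun g \<Longrightarrow> test_fun U (\<lambda>x. f x * g x)"
  by (rule test_fun_tsupp_subset[OF _ _ tsupp_mult1]) (auto simp: test_fun_def intro: smooth_fun_mult)

lemma test_fun_pd: "test_fun U f \<Longrightarrow> test_fun U (pd [i] f)"
  by (rule test_fun_tsupp_subset[OF _ _ tsupp_pd]) (auto simp: test_fun_def intro: smooth_fun_pd)

lemma test_fun_zero: "test_fun U (\<lambda>x. 0)"
  by (simp add: test_fun_def tsupp_def)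

lemma test_fun_add:
  assumes "test_fun U f" "test_fun U g"
  shows "test_fun U (\<lambda>x. f x + g x)"
proof -
  have "tsupp (\<lambda>x. f x + g x) \<subseteq> tsupp f \<union> tsupp g"
    by (rule tsupp_subset) (auto simp: not_tsupp closed_Un)
  moreover have "compact (tsupp f \<union> tsupp g)" using assms by (auto simp: test_fun_def)
  ultimately have "compact (tsupp (\<lambda>x. f x + g x))"
    by (metis compact_Int_closed closed_tsupp inf.absorb2)
  then show ?thesis using \<open>tsupp (\<lambda>x. f x + g x) \<subseteq> _\<close> assms
    by (auto simp: test_fun_def intro: smooth_fun_add)
qed

text \<open>The mean value theorem is used twice: for the increment along j as a function of the
  step along i, then for \<open>pd [i] f\<close> along j. The second difference on the left is
  symmetric in i and j, whereas the form of the right side is not.\<close>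

lemma second_difference_mvt:
  fixes f :: "real^'n::finite \<Rightarrow> real" and x :: "real^'n" and h :: real
  assumes f: "smooth_fun f" and h: "h > 0"
  shows "\<exists>s t::real. 0 < s \<and> s < h \<and> 0 < t \<and> t < h \<and>
    f (x + h *\<^sub>R axis i 1 + h *\<^sub>R axis j 1) - f (x + h *\<^sub>R axis i 1) - f (x + h *\<^sub>R axis j 1) + f x
     = h * (h * pd [j, i] f (x + s *\<^sub>R axis i 1 + t *\<^sub>R axis j 1))"
proof -
  define g where "g s = f (x + h *\<^sub>R axis j 1 + s *\<^sub>R axis i 1) - f (x + s *\<^sub>R axis i 1)" for s :: real
  define g' where "g' s = pd [i] f (x + h *\<^sub>R axis j 1 + s *\<^sub>R axis i 1) - pd [i] f (x + s *\<^sub>R axis i 1)" for s :: real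
  have "DERIV g s :> g' s" for s :: real
    unfolding g_def[abs_def] g'_def
    using DERIV_diff[OF has_pd_at[OF smooth_fun_has_pd[OF f], of "x + h *\<^sub>R axis j 1" i s]
        has_pd_at[OF smooth_fun_has_pd[OF f], of x i s]] by simp
  then have "\<exists>s>0. s < h \<and> g h - g 0 = (h - 0) * g' s" by (intro MVT2 h)
  then obtain s where s: "0 < s" "s < h" "g h - g 0 = (h - 0) * g' s" by blast
  define k where "k t = pd [i] f (x + s *\<^sub>R axis i 1 + t *\<^sub>R axis j 1)" for t :: real
  define k' where "k' t = pd [j, i] f (x + s *\<^sub>R axis i 1 + t *\<^sub>R axis j 1)" for t :: real
  have "DERIV k t :> k' t" for t :: real
    unfolding k_def[abs_def] k'_def pd_Cons[of j "[i]"]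
    using has_pd_at[OF smooth_fun_has_pd[OF smooth_fun_pd[OF f, of "[i]"]], of "x + s *\<^sub>R axis i 1" j t] by simp
  then have "\<exists>t>0. t < h \<and> k h - k 0 = (h - 0) * k' t" by (intro MVT2 h)
  then obtain t where t: "0 < t" "t < h" "k h - k 0 = (h - 0) * k' t" by blast
  have "g' s = k h - k 0" by (simp add: g'_def k_def add_ac)
  then have "g h - g 0 = h * (h * k' t)" using s t by simp
  then show ?thesis using s t unfolding g_def k'_def
    by (intro exI[of _ s] exI[of _ t]) (simp add: algebra_simps)
qed

text \<open>The symmetric second difference equals h^2 times \<open>pd [j, i] f\<close> at one point
  and h^2 times \<open>pd [i, j] f\<close> at another, both within 2 h of x; continuity closes the
  gap as h tends to 0. The result makes rotated gradients divergence free.\<close>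

lemma mixed_partials_commute:
  fixes f :: "real^'n::finite \<Rightarrow> real"
  assumes f: "smooth_fun f"
  shows "pd [i, j] f = pd [j, i] f"
proof
  fix x :: "real^'n"
  have ex: "\<exists>y z::real^'n. norm (y - x) \<le> 2 * h \<and> norm (z - x) \<le> 2 * h \<and> pd [j, i] f y = pd [i, j] f z"
    if h: "h > 0" for h :: real
  proof -
    have near: "norm (x + s *\<^sub>R axis i' 1 + t *\<^sub>R axis j' 1 - x) \<le> 2 * h"
      if "0 < s" "s < h" "0 < t" "t < h" for s t :: real and i' j' :: 'n
    proof -
      have "norm (s *\<^sub>R axis i' 1 + t *\<^sub>R axis j' 1 :: real^'n) \<le> s + t"
        using norm_triangle_ineq[of "s *\<^sub>R axis i' 1" "t *\<^sub>R axis j' 1 :: real^'n"] that by simp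
      then show ?thesis using that by (simp add: algebra_simps)
    qed
    obtain s t where 1: "0 < s" "s < h" "0 < t" "t < h"
      "f (x + h *\<^sub>R axis i 1 + h *\<^sub>R axis j 1) - f (x + h *\<^sub>R axis i 1) - f (x + h *\<^sub>R axis j 1) + f x
     = h * (h * pd [j, i] f (x + s *\<^sub>R axis i 1 + t *\<^sub>R axis j 1))"
      using second_difference_mvt[OF f h, of x i j] by blast
    obtain t' s' where 2: "0 < t'" "t' < h" "0 < s'" "s' < h"
      "f (x + h *\<^sub>R axis j 1 + h *\<^sub>R axis i 1) - f (x + h *\<^sub>R axis j 1) - f (x + h *\<^sub>R axis i 1) + f x
     = h * (h * pd [i, j] f (x + t' *\<^sub>R axis j 1 + s' *\<^sub>R axis i 1))"
      using second_difference_mvt[OF f h, of x j i] by blast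
    have "f (x + h *\<^sub>R axis j 1 + h *\<^sub>R axis i 1) = f (x + h *\<^sub>R axis i 1 + h *\<^sub>R axis j 1)"
      by (simp add: add_ac)
    then have "h * (h * pd [j, i] f (x + s *\<^sub>R axis i 1 + t *\<^sub>R axis j 1))
        = h * (h * pd [i, j] f (x + t' *\<^sub>R axis j 1 + s' *\<^sub>R axis i 1))"
      using 1(5) 2(5) by linarith
    then have "pd [j, i] f (x + s *\<^sub>R axis i 1 + t *\<^sub>R axis j 1)
        = pd [i, j] f (x + t' *\<^sub>R axis j 1 + s' *\<^sub>R axis i 1)" using h by simp
    then show ?thesis using near[OF 1(1-4)] near[OF 2(1-4)] by blast
  qed
  have "\<exists>y z::real^'n. norm (y - x) \<le> 2 * inverse (real (Suc n)) \<and> norm (z - x) \<le> 2 * inverse (real (Suc n)) \<and>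
      pd [j, i] f y = pd [i, j] f z" for n
    by (rule ex) simp
  then obtain y z where yz: "\<And>n. norm (y n - x) \<le> 2 * inverse (real (Suc n))"
     "\<And>n. norm (z n - x) \<le> 2 * inverse (real (Suc n))" "\<And>n. pd [j, i] f (y n) = pd [i, j] f (z n)"
    using choice[of "\<lambda>n y. \<exists>z. norm (y - x) \<le> 2 * inverse (real (Suc n)) \<and> norm (z - x) \<le> 2 * inverse (real (Suc n)) \<and>
      pd [j, i] f y = pd [i, j] f z"] by metis
  have l0: "(\<lambda>n. 2 * inverse (real (Suc n))) \<longlonglongrightarrow> 0"
    using tendsto_mult_right_zero[OF LIMSEQ_inverse_real_of_nat] by blast
  have "(\<lambda>n. y n - x) \<longlonglongrightarrow> 0" "(\<lambda>n. z n - x) \<longlonglongrightarrow> 0"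
    using yz by (auto intro!: Lim_null_comparison[OF _ l0] always_eventually)
  then have lims: "y \<longlonglongrightarrow> x" "z \<longlonglongrightarrow> x"
    using LIM_zero_cancel by blast+
  have c: "isCont (pd is f) x" for "is"
    using smooth_fun_continuous[OF smooth_fun_pd[OF f]] by (simp add: continuous_on_eq_continuous_at)
  have "(\<lambda>n. pd [j, i] f (y n)) \<longlonglongrightarrow> pd [j, i] f x" "(\<lambda>n. pd [i, j] f (z n)) \<longlonglongrightarrow> pd [i, j] f x"
    using isCont_tendsto_compose[OF c] lims by blast+
  then show "pd [i, j] f x = pd [j, i] f x"
    using LIMSEQ_unique[of "\<lambda>n. pd [i, j] f (z n)"] yz(3) by simp
qed

section \<open>Cutoff functions\<close>

text \<open>The functions p(1/t) exp(-1/t), extended by zero to t \<le> 0, form a class closed under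
  differentiation; the polynomial is carried as a parameter because each derivative changes
  it.\<close>

definition flat :: "real poly \<Rightarrow> real \<Rightarrow> real" where
  "flat p t = (if t > 0 then poly p (1 / t) * exp (- 1 / t) else 0)"

lemma poly_exp_tendsto_0: "((\<lambda>u. poly p u * exp (- u)) \<longlongrightarrow> (0::real)) at_top"
proof -
  have "((\<lambda>u. \<Sum>i\<le>degree p. coeff p i * (u ^ i / exp u)) \<longlongrightarrow> (\<Sum>i\<le>degree p. coeff p i * 0)) at_top"
    by (intro tendsto_sum tendsto_mult tendsto_const tendsto_power_div_exp_0)
  moreover have "(\<Sum>i\<le>degree p. coeff p i * (u ^ i / exp u)) = poly p u * exp (- u)" for u
    by (simp add: poly_altdef sum_distrib_right exp_minus divide_inverse mult.assoc)
  ultimately show ?thesis by simp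
qed

lemma flat_tendsto_0: "(flat p \<longlongrightarrow> 0) (at 0)"
proof -
  have "((\<lambda>t::real. poly p (inverse t) * exp (- inverse t)) \<longlongrightarrow> 0) (at_right 0)"
    by (rule filterlim_compose[OF poly_exp_tendsto_0 filterlim_inverse_at_top_right])
  moreover have "\<forall>\<^sub>F t in at_right 0. poly p (inverse t) * exp (- inverse t) = flat p t"
    unfolding eventually_at_right_field by (intro exI[of _ 1]) (auto simp: flat_def divide_inverse)
  ultimately have "(flat p \<longlongrightarrow> 0) (at_right 0)"
    by (rule Lim_transform_eventually)
  moreover have "\<forall>\<^sub>F t in at_left 0. 0 = flat p t"
    unfolding eventually_at_left_field by (intro exI[of _ "-1"]) (auto simp: flat_def)
  then have "(flat p \<longlongrightarrow> 0) (at_left 0)"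
    by (rule Lim_transform_eventually[OF tendsto_const])
  ultimately show ?thesis by (simp add: filterlim_split_at)
qed

text \<open>With u = 1/t the derivative of p(u) exp(-u) is u^2 (p(u) - p'(u)) exp(-u), and
  \<open>[:0, 0, 1:]\<close> is u^2. At t = 0 the difference quotient of \<open>flat p\<close> is
  \<open>flat\<close> of the polynomial u p(u), which tends to 0.\<close>

lemma flat_deriv: "(flat p has_real_derivative flat ([:0, 0, 1:] * (p - pderiv p)) t) (at t)"
proof -
  consider "t > 0" | "t < 0" | "t = 0" by linarith
  then show ?thesis
  proof cases
    case 1
    have "((\<lambda>t. poly p (1 / t) * exp (- 1 / t)) has_real_derivative
       poly (pderiv p) (1 / t) * (- 1 / t\<^sup>2) * exp (- 1 / t) + exp (- 1 / t) * (1 / t\<^sup>2) * poly p (1 / t)) (at t)"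
      using 1 by (auto intro!: derivative_eq_intros DERIV_chain2[OF poly_DERIV] simp: power2_eq_square)
    moreover have "poly (pderiv p) (1 / t) * (- 1 / t\<^sup>2) * exp (- 1 / t) + exp (- 1 / t) * (1 / t\<^sup>2) * poly p (1 / t)
        = flat ([:0, 0, 1:] * (p - pderiv p)) t"
      using 1 by (simp add: flat_def power2_eq_square field_simps)
    ultimately have "((\<lambda>t. poly p (1 / t) * exp (- 1 / t)) has_real_derivative flat ([:0, 0, 1:] * (p - pderiv p)) t) (at t)"
      by simp
    then show ?thesis
      by (rule DERIV_cong_ev[OF refl _ refl, THEN iffD1, rotated])
         (use 1 in \<open>auto simp: flat_def eventually_nhds_metric dist_real_def intro!: exI[of _ t]\<close>)
  next
    case 2
    have "((\<lambda>t::real. 0) has_real_derivative flat ([:0, 0, 1:] * (p - pderiv p)) t) (at t)"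
      using 2 by (simp add: flat_def)
    then show ?thesis
      by (rule DERIV_cong_ev[OF refl _ refl, THEN iffD1, rotated])
         (use 2 in \<open>auto simp: flat_def eventually_nhds_metric dist_real_def intro!: exI[of _ "-t"]\<close>)
  next
    case 3
    have "flat p h / h = flat ([:0, 1:] * p) h" for h by (simp add: flat_def)
    then have "((\<lambda>h. (flat p (0 + h) - flat p 0) / h) \<longlongrightarrow> 0) (at 0)"
      using flat_tendsto_0[of "[:0, 1:] * p"] by (simp add: flat_def[of p 0])
    then show ?thesis using 3 by (simp add: DERIV_def flat_def[of _ 0])
  qed
qed

lemma smooth_fun_flat: "smooth_fun f \<Longrightarrow> smooth_fun (\<lambda>x. flat p (f x))"
  unfolding smooth_fun_iff_ndiff
  using ndiff_chain[of "range flat" "flat p" _ f] flat_deriv by blast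

text \<open>A smooth transition from 0 on t \<le> 0 to 1 on t \<ge> 1. The denominator never
  vanishes, because t and 1 - t are not both nonpositive.\<close>

definition step :: "real \<Rightarrow> real" where
  "step t = flat 1 t * inverse (flat 1 t + flat 1 (1 - t))"

lemma flat_1_nonneg: "flat 1 t \<ge> 0" and flat_1_pos: "t > 0 \<Longrightarrow> flat 1 t > 0"
  by (auto simp: flat_def)

lemma step_denom_pos: "flat 1 t + flat 1 (1 - t) > 0"
proof (cases "t > 0")
  case True then show ?thesis using flat_1_pos[of t] flat_1_nonneg[of "1 - t"] by linarith
next
  case False then show ?thesis using flat_1_pos[of "1 - t"] flat_1_nonneg[of t] by linarith
qed

lemma step_nonneg: "0 \<le> step t"
  using flat_1_nonneg[of t] step_denom_pos[of t] by (simp add: step_def)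

lemma step_le_1: "step t \<le> 1"
  using flat_1_nonneg[of "1 - t"] step_denom_pos[of t] by (simp add: step_def field_simps)

lemma step_eq_0: "t \<le> 0 \<Longrightarrow> step t = 0"
  by (simp add: step_def flat_def)

lemma step_eq_1: "t \<ge> 1 \<Longrightarrow> step t = 1"
  using step_denom_pos[of t] by (simp add: step_def flat_def[of _ "1 - t"] split: if_splits)

lemma smooth_fun_step: "smooth_fun f \<Longrightarrow> smooth_fun (\<lambda>x. step (f x))"
proof -
  assume f: "smooth_fun f"
  have "smooth_fun (\<lambda>x. flat 1 (f x) + flat 1 (1 - f x))"
    by (intro smooth_fun_add smooth_fun_flat smooth_fun_diff f smooth_fun_const)
  then have "smooth_fun (\<lambda>x. inverse (flat 1 (f x) + flat 1 (1 - f x)))"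
    using step_denom_pos unfolding smooth_fun_iff_ndiff
    by (intro allI ndiff_inverse) (auto simp: less_imp_neq[symmetric])
  then show ?thesis unfolding step_def by (intro smooth_fun_mult smooth_fun_flat f)
qed

text \<open>The derivative of \<open>step\<close> by the quotient rule; \<open>[:0, 0, 1:]\<close>
  is the polynomial that \<open>flat_deriv\<close> produces from \<open>flat 1\<close>. The closed
  form serves to show continuity, hence the bound on the unit interval.\<close>

definition step' :: "real \<Rightarrow> real" where
  "step' t = (let D = flat 1 t + flat 1 (1 - t); q = [:0, 0, 1:] in
     flat q t * inverse D - flat 1 t * (flat q t - flat q (1 - t)) * inverse (D\<^sup>2))"

lemma step_deriv: "(step has_real_derivative step' t) (at t)"
proof -
  define q where "q = [:0, 0, 1::real:]"
  have d: "(flat 1 has_real_derivative flat q t) (at t)" for t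
    using flat_deriv[of 1 t] by (simp add: q_def pderiv_1)
  have D0: "flat 1 t + flat 1 (1 - t) \<noteq> 0" using step_denom_pos[of t] by simp
  have d2: "((\<lambda>t. flat 1 (1 - t)) has_real_derivative - flat q (1 - t)) (at t)"
  proof -
    have "((\<lambda>t. 1 - t) has_real_derivative - 1) (at t)" by (auto intro!: derivative_eq_intros)
    from DERIV_chain2[OF d this] show ?thesis by simp
  qed
  have "((\<lambda>t. flat 1 t * inverse (flat 1 t + flat 1 (1 - t))) has_real_derivative step' t) (at t)"
    by (rule derivative_eq_intros d d2 D0 refl)+
       (simp add: step'_def Let_def q_def power2_eq_square algebra_simps)
  then show ?thesis unfolding step_def[abs_def] .
qed

text \<open>Outside the unit interval \<open>step\<close> is locally constant, so uniqueness of the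
  derivative replaces a computation with the closed form.\<close>

lemma step'_eq_0:
  assumes "t < 0 \<or> t > 1"
  shows "step' t = 0"
  using assms
proof
  assume "t < 0"
  then have "((\<lambda>t. 0) has_real_derivative step' t) (at t)"
    by (intro DERIV_cong_ev[OF refl _ refl, THEN iffD1, OF _ step_deriv])
       (auto simp: step_eq_0 eventually_nhds_metric dist_real_def intro!: exI[of _ "-t"])
  then show ?thesis using DERIV_unique DERIV_const by blast
next
  assume "t > 1"
  then have "((\<lambda>t. 1) has_real_derivative step' t) (at t)"
    by (intro DERIV_cong_ev[OF refl _ refl, THEN iffD1, OF _ step_deriv])
       (auto simp: step_eq_1 eventually_nhds_metric dist_real_def intro!: exI[of _ "t - 1"])
  then show ?thesis using DERIV_unique DERIV_const by blast
qed

text \<open>After rescaling, a bound uniform in t makes the derivative of a cutoff of width 1/m of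
  order m.\<close>

lemma step'_bounded: "\<exists>M. \<forall>t. \<bar>step' t\<bar> \<le> M"
proof -
  have c: "continuous_on UNIV (flat p)" for p
    using flat_deriv by (meson DERIV_continuous_on has_field_derivative_at_within)
  have c1: "continuous_on S (\<lambda>t. flat p (1 - t))" for p S
    by (rule continuous_on_compose2[OF c]) (auto intro!: continuous_intros)
  have c0: "continuous_on S (flat p)" for p S
    using c continuous_on_subset by blast
  have "flat 1 t + flat 1 (1 - t) \<noteq> 0" for t using step_denom_pos[of t] by simp
  then have "continuous_on {0..1} step'"
    unfolding step'_def[abs_def] Let_def by (intro continuous_intros c0 c1) auto
  then have "bounded (step' ` {0..1})"
    by (intro compact_imp_bounded compact_continuous_image) auto
  then obtain M where M: "\<And>t. t \<in> {0..1} \<Longrightarrow> \<bar>step' t\<bar> \<le> M"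
    unfolding bounded_iff by (metis image_eqI real_norm_def)
  have "\<bar>step' t\<bar> \<le> max M 0" for t
  proof (cases "t \<in> {0..1}")
    case True then show ?thesis using M[of t] by simp
  next
    case False
    then have "step' t = 0" by (intro step'_eq_0) auto
    then show ?thesis by simp
  qed
  then show ?thesis by blast
qed

text \<open>For r > 0 the argument of \<open>step\<close> is at least 1 exactly when |x - c| \<le>
  r/2 and at most 0 exactly when |x - c| \<ge> r / sqrt 2. The squared distance keeps the function
  smooth at the centre.\<close>

definition ball_bump :: "real^'n::finite \<Rightarrow> real \<Rightarrow> real^'n \<Rightarrow> real" where
  "ball_bump c r x = step (2 - 4 / r\<^sup>2 * (norm (x - c))\<^sup>2)"

lemma smooth_ball_bump: "smooth_fun (ball_bump c r)"
  unfolding ball_bump_def[abs_def]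
  by (intro smooth_fun_step smooth_fun_diff smooth_fun_mult smooth_fun_const smooth_fun_norm_sq)

lemma ball_bump_range: "0 \<le> ball_bump c r x" "ball_bump c r x \<le> 1"
  by (auto simp: ball_bump_def step_nonneg step_le_1)

lemma ball_bump_eq_1:
  assumes "r > 0" "norm (x - c) \<le> r / 2"
  shows "ball_bump c r x = 1"
proof -
  have "(norm (x - c))\<^sup>2 \<le> (r / 2)\<^sup>2" using assms by (intro power_mono) auto
  then have "4 / r\<^sup>2 * (norm (x - c))\<^sup>2 \<le> 1" using assms by (simp add: field_simps)
  then show ?thesis by (simp add: ball_bump_def step_eq_1)
qed

lemma tsupp_ball_bump:
  assumes "r > 0" shows "tsupp (ball_bump c r) \<subseteq> ball c r"
proof -
  \<comment> \<open>3/4 is a rational number between 1 / sqrt 2 and 1, so the closed ball with this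
    fraction of the radius contains the support and lies inside the open ball.\<close>
  have "ball_bump c r x = 0" if "x \<notin> cball c (3 / 4 * r)" for x
  proof -
    have "3 / 4 * r \<le> norm (x - c)" using that by (simp add: dist_norm norm_minus_commute)
    then have "(3 / 4 * r)\<^sup>2 \<le> (norm (x - c))\<^sup>2" using assms by (intro power_mono) auto
    then have "9 / 16 * r\<^sup>2 \<le> (norm (x - c))\<^sup>2" by (simp add: power2_eq_square)
    then have "9 / 4 \<le> 4 / r\<^sup>2 * (norm (x - c))\<^sup>2" using assms by (simp add: field_simps)
    then show ?thesis by (simp add: ball_bump_def step_eq_0)
  qed
  then have "tsupp (ball_bump c r) \<subseteq> cball c (3 / 4 * r)"
    by (intro tsupp_subset) auto
  then show ?thesis using assms by (auto simp: subset_iff)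
qed

text \<open>Peeling off one bump at a time replaces a partition of unity and needs no division.\<close>
lemma test_fun_vanish_local_to_global:
  fixes B :: "(real^'n::finite \<Rightarrow> real) \<Rightarrow> real"
  assumes add: "\<And>f g. test_fun U f \<Longrightarrow> test_fun U g \<Longrightarrow> B (\<lambda>x. f x + g x) = B f + B g"
    and loc: "\<And>x. x \<in> U \<Longrightarrow> \<exists>r>0. \<forall>f. test_fun U f \<and> tsupp f \<subseteq> ball x r \<longrightarrow> B f = 0"
    and f: "test_fun U f"
  shows "B f = 0"
proof -
  obtain r where r: "\<And>x. x \<in> U \<Longrightarrow> r x > 0" "\<And>x g. x \<in> U \<Longrightarrow> test_fun U g \<Longrightarrow> tsupp g \<subseteq> ball x (r x) \<Longrightarrow> B g = 0"
    using loc by metis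
  have fin: "B g = 0" if "finite C" "C \<subseteq> U" "test_fun U g" "tsupp g \<subseteq> (\<Union>c\<in>C. ball c (r c / 2))" for C g
    using that
  proof (induction C arbitrary: g rule: finite_induct)
    case empty
    then have "g x = 0" for x using not_tsupp[of x g] by auto
    then have "g = (\<lambda>x. 0)" by auto
    moreover have "B (\<lambda>x. 0) = 0" using add[OF test_fun_zero test_fun_zero] by simp
    ultimately show ?case by simp
  next
    case (insert c C)
    then have c: "c \<in> U" "r c > 0" using r by auto
    define b where "b = ball_bump c (r c)"
    have b: "smooth_fun b" "smooth_fun (\<lambda>x. 1 - b x)"
      by (auto simp: b_def smooth_ball_bump intro: smooth_fun_diff)
    have t: "test_fun U (\<lambda>x. g x * b x)" "test_fun U (\<lambda>x. g x * (1 - b x))"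
      using insert.prems b by (auto intro: test_fun_mult)
    have "tsupp (\<lambda>x. g x * b x) \<subseteq> ball c (r c)"
      using tsupp_mult_subset[of g b] tsupp_ball_bump[OF c(2), of c] by (auto simp: b_def)
    then have 1: "B (\<lambda>x. g x * b x) = 0" using r(2) c t by blast
    have "tsupp (\<lambda>x. g x * (1 - b x)) \<subseteq> tsupp g - ball c (r c / 2)"
    proof (rule tsupp_subset)
      show "closed (tsupp g - ball c (r c / 2))" by (intro closed_Diff) auto
      fix x assume "x \<notin> tsupp g - ball c (r c / 2)"
      then have "g x = 0 \<or> b x = 1"
        using not_tsupp[of x g] ball_bump_eq_1[OF c(2), of x c]
        by (auto simp: b_def dist_norm norm_minus_commute)
      then show "g x * (1 - b x) = 0" by auto
    qed
    then have "tsupp (\<lambda>x. g x * (1 - b x)) \<subseteq> (\<Union>c\<in>C. ball c (r c / 2))"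
      using insert.prems(3) by auto
    then have 2: "B (\<lambda>x. g x * (1 - b x)) = 0" using insert.IH t insert.prems by auto
    have "g = (\<lambda>x. g x * b x + g x * (1 - b x))" by (auto simp: algebra_simps)
    then show ?case using add[OF t] 1 2 by simp
  qed
  have "compact (tsupp f)" "tsupp f \<subseteq> U" using f by (auto simp: test_fun_def)
  moreover have "tsupp f \<subseteq> (\<Union>c\<in>tsupp f. ball c (r c / 2))"
    using r(1) \<open>tsupp f \<subseteq> U\<close> by force
  ultimately obtain C where "C \<subseteq> tsupp f" "finite C" "tsupp f \<subseteq> (\<Union>c\<in>C. ball c (r c / 2))"
    by (metis (no_types, lifting) compactE_image open_ball)
  then show ?thesis using fin[of C f] f \<open>tsupp f \<subseteq> U\<close> by auto
qed

text \<open>Bumps of a finite subcover are combined by f + b (1 - f), which amounts to 1 minus the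
  product of the factors 1 - b. This stays in the unit interval and equals 1 wherever a single bump
  does.\<close>

lemma exists_cutoff:
  assumes "compact K" "open U" "K \<subseteq> U"
  shows "\<exists>f. test_fun U f \<and> (\<forall>x. 0 \<le> f x \<and> f x \<le> 1) \<and> (\<forall>x\<in>K. f x = 1)"
proof -
  have "\<forall>x\<in>K. \<exists>r>0. ball x r \<subseteq> U" using assms by (meson openE subsetD)
  then obtain r where r: "\<And>x. x \<in> K \<Longrightarrow> r x > 0 \<and> ball x (r x) \<subseteq> U" by metis
  have "K \<subseteq> (\<Union>x\<in>K. ball x (r x / 2))" using r by force
  then obtain C where C: "C \<subseteq> K" "finite C" "K \<subseteq> (\<Union>c\<in>C. ball c (r c / 2))"
    using assms(1) by (metis (no_types, lifting) compactE_image open_ball)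
  have "\<exists>f. test_fun U f \<and> (\<forall>x. 0 \<le> f x \<and> f x \<le> 1) \<and> (\<forall>x\<in>(\<Union>c\<in>C. ball c (r c / 2)). f x = 1)"
    using C(2,1)
  proof (induction rule: finite_induct)
    case empty
    then show ?case by (intro exI[of _ "\<lambda>x. 0"]) (auto simp: test_fun_zero)
  next
    case (insert c C)
    then obtain f where f: "test_fun U f" "\<And>x. 0 \<le> f x \<and> f x \<le> 1" "\<And>x. x \<in> (\<Union>c\<in>C. ball c (r c / 2)) \<Longrightarrow> f x = 1"
      by (metis insert_subset)
    define b where "b = ball_bump c (r c)"
    have rc: "r c > 0" "ball c (r c) \<subseteq> U" using r insert.prems by auto
    have "tsupp b \<subseteq> ball c (r c)" using tsupp_ball_bump rc b_def by blast
    then have "bounded (tsupp b)" using bounded_ball bounded_subset by blast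
    then have b: "test_fun U b" using \<open>tsupp b \<subseteq> ball c (r c)\<close> rc
      by (auto simp: test_fun_def compact_eq_bounded_closed b_def smooth_ball_bump)
    define g where "g x = f x + b x * (1 - f x)" for x
    have "test_fun U g" unfolding g_def[abs_def]
      using f b by (intro test_fun_add test_fun_mult smooth_fun_diff smooth_fun_const test_fun_smooth)
    moreover have "0 \<le> g x \<and> g x \<le> 1" for x
    proof -
      have "0 \<le> b x" "b x \<le> 1" by (auto simp: b_def ball_bump_range)
      moreover have "b x * (1 - f x) \<le> 1 * (1 - f x)" using f(2)[of x] \<open>b x \<le> 1\<close> by (intro mult_right_mono) auto
      ultimately show ?thesis using f(2)[of x] by (auto simp: g_def)
    qed
    moreover have "g x = 1" if "x \<in> (\<Union>c\<in>insert c C. ball c (r c / 2))" for x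
    proof -
      from that obtain c' where c': "c' \<in> insert c C" "x \<in> ball c' (r c' / 2)" by (rule UN_E)
      have "f x = 1 \<or> b x = 1"
      proof (cases "c' = c")
        case True
        then show ?thesis using c' ball_bump_eq_1[OF rc(1), of x c] by (simp add: b_def dist_norm norm_minus_commute)
      next
        case False
        with c' have "x \<in> (\<Union>c\<in>C. ball c (r c / 2))" by (intro UN_I) auto
        then show ?thesis using f(3) by simp
      qed
      then show ?thesis by (auto simp: g_def)
    qed
    ultimately show ?case by blast
  qed
  then show ?thesis using C(3) by blast
qed

section \<open>Square integrable functions and weak derivatives\<close>

lemma L2D: "L2 U f \<Longrightarrow> f \<in> borel_measurable (lebesgue_on U)"
  "L2 U f \<Longrightarrow> integrable (lebesgue_on U) (\<lambda>x. (f x)\<^sup>2)"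
  by (auto simp: L2_def)

lemma L2_mult_integrable:
  assumes "L2 U f" "L2 U g"
  shows "integrable (lebesgue_on U) (\<lambda>x. f x * g x)"
proof (rule Bochner_Integration.integrable_bound)
  show "integrable (lebesgue_on U) (\<lambda>x. (f x)\<^sup>2 + (g x)\<^sup>2)"
    using assms by (intro Bochner_Integration.integrable_add L2D)
  show "(\<lambda>x. f x * g x) \<in> borel_measurable (lebesgue_on U)"
    using assms by (intro borel_measurable_times L2D)
  have "\<bar>a * b\<bar> \<le> a\<^sup>2 + b\<^sup>2" for a b :: real
  proof -
    have "2 * (\<bar>a\<bar> * \<bar>b\<bar>) \<le> a\<^sup>2 + b\<^sup>2"
      using zero_le_power2[of "\<bar>a\<bar> - \<bar>b\<bar>"] unfolding power2_diff by simp
    moreover have "0 \<le> \<bar>a\<bar> * \<bar>b\<bar>" by simp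
    ultimately show ?thesis unfolding abs_mult by linarith
  qed
  then show "AE x in lebesgue_on U. norm (f x * g x) \<le> norm ((f x)\<^sup>2 + (g x)\<^sup>2)"
    by simp
qed

lemma L2_bound:
  assumes "f \<in> borel_measurable (lebesgue_on U)" "integrable (lebesgue_on U) h" "\<And>x. x \<in> U \<Longrightarrow> (f x)\<^sup>2 \<le> h x"
  shows "L2 U f"
  unfolding L2_def
proof
  show "integrable (lebesgue_on U) (\<lambda>x. (f x)\<^sup>2)"
  proof (rule Bochner_Integration.integrable_bound[OF assms(2)])
    show "AE x in lebesgue_on U. norm ((f x)\<^sup>2) \<le> norm (h x)"
    proof (rule AE_I2)
      fix x assume "x \<in> space (lebesgue_on U)"
      then have "(f x)\<^sup>2 \<le> h x" using assms(3)[of x] by simp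
      then show "norm ((f x)\<^sup>2) \<le> norm (h x)" by simp
    qed
  qed (use assms(1) in measurable)
qed fact

lemma L2_zero: "L2 U (\<lambda>x. 0)"
  by (simp add: L2_def)

lemma L2_add:
  assumes "L2 U f" "L2 U g"
  shows "L2 U (\<lambda>x. f x + g x)"
proof (rule L2_bound)
  show "(\<lambda>x. f x + g x) \<in> borel_measurable (lebesgue_on U)"
    using assms by (intro borel_measurable_add L2D)
  show "integrable (lebesgue_on U) (\<lambda>x. (f x)\<^sup>2 + (g x)\<^sup>2 + 2 * (f x * g x))"
    using assms by (intro Bochner_Integration.integrable_add integrable_mult_right L2D L2_mult_integrable)
  show "(f x + g x)\<^sup>2 \<le> (f x)\<^sup>2 + (g x)\<^sup>2 + 2 * (f x * g x)" for x
    by (simp add: power2_sum)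
qed

lemma L2_cmult: "L2 U f \<Longrightarrow> L2 U (\<lambda>x. c * f x)"
  unfolding L2_def by (auto simp: power_mult_distrib)

lemma L2_diff: "L2 U f \<Longrightarrow> L2 U g \<Longrightarrow> L2 U (\<lambda>x. f x - g x)"
  using L2_add[OF _ L2_cmult[of U g "-1"], of f] by simp

lemma L2_sum: "(\<And>i. i \<in> I \<Longrightarrow> L2 U (f i)) \<Longrightarrow> L2 U (\<lambda>x. \<Sum>i\<in>I. f i x)"
  by (induction I rule: infinite_finite_induct) (auto intro: L2_add simp: L2_zero)

lemma integrable_lebesgue_on_subset:
  fixes f :: "'a::euclidean_space \<Rightarrow> real"
  assumes "integrable (lebesgue_on U) f" "V \<subseteq> U" "V \<in> sets lebesgue" "U \<in> sets lebesgue"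
  shows "integrable (lebesgue_on V) f"
proof -
  have "integrable lebesgue (\<lambda>x. indicator U x *\<^sub>R f x)"
    using assms by (simp add: integrable_restrict_space)
  then have "integrable lebesgue (\<lambda>x. indicator V x *\<^sub>R (indicator U x *\<^sub>R f x))"
    by (rule integrable_mult_indicator[OF assms(3)])
  moreover have "(\<lambda>x. indicator V x *\<^sub>R (indicator U x *\<^sub>R f x)) = (\<lambda>x. indicator V x *\<^sub>R f x)"
    using assms(2) by (auto simp: indicator_def fun_eq_iff)
  ultimately show ?thesis using assms(3) by (simp add: integrable_restrict_space)
qed

lemma L2_mono:
  assumes "L2 U f" "V \<subseteq> U" "V \<in> sets lebesgue" "U \<in> sets lebesgue"
  shows "L2 V f"
  using assms integrable_lebesgue_on_subset measurable_restrict_mono[OF L2D(1)[OF assms(1)] assms(2)]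
  unfolding L2_def by blast

lemma cont_measurable_lebesgue_on:
  fixes f :: "'a::euclidean_space \<Rightarrow> real"
  assumes "continuous_on UNIV f"
  shows "f \<in> borel_measurable (lebesgue_on U)"
proof -
  have "f \<in> borel_measurable lebesgue"
    using borel_measurable_continuous_onI[OF assms] by (auto intro: measurable_completion)
  then show ?thesis by (rule measurable_restrict_space1)
qed

lemma cont_bounded_on_bounded:
  fixes f :: "'a::euclidean_space \<Rightarrow> real"
  assumes "continuous_on UNIV f" "bounded U"
  shows "\<exists>M\<ge>0. \<forall>x\<in>U. \<bar>f x\<bar> \<le> M"
proof -
  have "compact (closure U)" using assms(2) by (simp add: compact_closure)
  then have "bounded (f ` closure U)"
    using assms(1) by (intro compact_imp_bounded compact_continuous_image) (auto intro: continuous_on_subset)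
  then obtain M where M: "\<And>y. y \<in> f ` closure U \<Longrightarrow> norm y \<le> M" unfolding bounded_iff by blast
  have "\<bar>f x\<bar> \<le> max M 0" if "x \<in> U" for x
    using M[of "f x"] closure_subset[of U] that by (auto simp: max_def)
  then show ?thesis by (intro exI[of _ "max M 0"]) auto
qed

lemma L2_mult_cont:
  assumes f: "L2 U f" and g: "continuous_on UNIV g" and "bounded U"
  shows "L2 U (\<lambda>x. f x * g x)"
proof -
  obtain M where M: "M \<ge> 0" "\<forall>x\<in>U. \<bar>g x\<bar> \<le> M" using cont_bounded_on_bounded[OF g \<open>bounded U\<close>] by blast
  show ?thesis
  proof (rule L2_bound)
    show "(\<lambda>x. f x * g x) \<in> borel_measurable (lebesgue_on U)"
      by (intro borel_measurable_times L2D f cont_measurable_lebesgue_on g)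
    show "integrable (lebesgue_on U) (\<lambda>x. (f x)\<^sup>2 * M\<^sup>2)"
      by (intro integrable_mult_left L2D f)
    show "(f x * g x)\<^sup>2 \<le> (f x)\<^sup>2 * M\<^sup>2" if "x \<in> U" for x
      unfolding power_mult_distrib using M that
      by (intro mult_left_mono) (auto simp: abs_le_square_iff[symmetric])
  qed
qed

lemma L2_const:
  assumes "bounded U" "U \<in> sets lebesgue"
  shows "L2 U (\<lambda>x. c)"
proof -
  have "U \<in> lmeasurable" using assms by (simp add: bounded_set_imp_lmeasurable)
  then interpret finite_measure "lebesgue_on U" by (rule finite_measure_lebesgue_on)
  show ?thesis by (simp add: L2_def)
qed

lemma L2_cont:
  assumes "continuous_on UNIV g" "bounded U" "U \<in> sets lebesgue"
  shows "L2 U g"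
  using L2_mult_cont[OF L2_const[OF assms(2,3), of 1] assms(1,2)] by simp

lemma L2_integrable:
  assumes "L2 U f" "bounded U" "U \<in> sets lebesgue"
  shows "integrable (lebesgue_on U) f"
  using L2_mult_integrable[OF assms(1) L2_const[OF assms(2,3), of 1]] by simp

lemma L2_mult_cont_integrable:
  assumes "L2 U f" "continuous_on UNIV g" "bounded U" "U \<in> sets lebesgue"
  shows "integrable (lebesgue_on U) (\<lambda>x. f x * g x)"
  using assms L2_mult_integrable L2_cont by blast

text \<open>For every t the integral of (t f + g)^2 is nonnegative, and its coefficients as a
  polynomial in t are A, 2 C and B.\<close>

lemma L2_Cauchy_Schwarz:
  assumes "L2 U f" "L2 U g"
  shows "\<bar>intg U (\<lambda>x. f x * g x)\<bar> \<le> sqrt (intg U (\<lambda>x. (f x)\<^sup>2)) * sqrt (intg U (\<lambda>x. (g x)\<^sup>2))"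
proof -
  define A where "A = intg U (\<lambda>x. (f x)\<^sup>2)"
  define B where "B = intg U (\<lambda>x. (g x)\<^sup>2)"
  define C where "C = intg U (\<lambda>x. f x * g x)"
  have AB: "A \<ge> 0" "B \<ge> 0" by (auto simp: A_def B_def intg_def)
  have q: "0 \<le> t\<^sup>2 * A + 2 * t * C + B" for t
  proof -
    have "0 \<le> intg U (\<lambda>x. (t * f x + g x)\<^sup>2)" by (simp add: intg_def)
    also have "\<dots> = intg U (\<lambda>x. t\<^sup>2 * (f x)\<^sup>2 + 2 * t * (f x * g x) + (g x)\<^sup>2)"
      by (simp add: power2_eq_square algebra_simps)
    also have "\<dots> = t\<^sup>2 * A + 2 * t * C + B"
      using L2D[OF assms(1)] L2D[OF assms(2)] L2_mult_integrable[OF assms]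
      by (simp add: intg_def A_def B_def C_def)
    finally show ?thesis .
  qed
  have "C\<^sup>2 \<le> A * B"
  proof (cases "A = 0")
    case True
    have "C = 0"
    proof (rule ccontr)
      assume "C \<noteq> 0"
      \<comment> \<open>With A = 0 the polynomial is affine in t and takes the value -1 at this
        t.\<close>
      then show False using q[of "- (B + 1) / (2 * C)"] True by (simp add: field_simps)
    qed
    then show ?thesis using AB by simp
  next
    case False
    then have "A > 0" using AB by simp
    \<comment> \<open>t = - C / A is the minimiser of the quadratic.\<close>
    then have "(- C / A)\<^sup>2 * A + 2 * (- C / A) * C + B = B - C\<^sup>2 / A"
      by (simp add: power2_eq_square field_simps)
    then have "C\<^sup>2 / A \<le> B" using q[of "- C / A"] by simp
    then show ?thesis using \<open>A > 0\<close> by (simp add: field_simps)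
  qed
  then have "\<bar>C\<bar> \<le> sqrt (A * B)" by (simp add: real_le_rsqrt)
  then show ?thesis by (simp add: A_def B_def C_def real_sqrt_mult)
qed

section \<open>Integration by parts and the fundamental lemma of the calculus of variations\<close>

lemma intg_eq_lebesgue:
  assumes "U \<in> sets lebesgue" "\<And>x. x \<notin> U \<Longrightarrow> f x = 0"
  shows "intg U f = integral\<^sup>L lebesgue f"
proof -
  have "(\<lambda>x. indicator U x *\<^sub>R f x) = f" using assms(2) by (auto simp: indicator_def fun_eq_iff)
  then show ?thesis using assms(1) by (simp add: intg_def integral_restrict_space)
qed

lemma compact_support_integrable:
  fixes f :: "real^'n::finite \<Rightarrow> real"
  assumes "continuous_on UNIV f" "compact (tsupp f)"
  shows "integrable lborel f"
proof -
  have "integrable lborel (\<lambda>x. indicator (tsupp f) x *\<^sub>R f x)"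
    by (rule borel_integrable_compact[OF assms(2)]) (use assms(1) in \<open>auto intro: continuous_on_subset\<close>)
  moreover have "(\<lambda>x. indicator (tsupp f) x *\<^sub>R f x) = f" using not_tsupp[of _ f] by (auto simp: indicator_def fun_eq_iff)
  ultimately show ?thesis by simp
qed

text \<open>The difference quotients of f have integral zero by translation invariance.\<close>
lemma integral_pd_eq_0:
  fixes f :: "real^'n::finite \<Rightarrow> real"
  assumes f: "smooth_fun f" and K: "compact (tsupp f)"
  shows "integral\<^sup>L lborel (pd [i] f) = 0"
proof -
  define e :: "real^'n" where "e = axis i 1"
  define h :: "nat \<Rightarrow> real" where "h n = inverse (real (Suc n))" for n
  have h: "h n > 0" "h n \<le> 1" for n by (auto simp: h_def field_simps)
  define q where "q n x = (f (x + h n *\<^sub>R e) - f x) / h n" for n x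
  have cf: "continuous_on UNIV f" by (rule smooth_fun_continuous[OF f])
  have fi: "integrable lborel f" by (rule compact_support_integrable[OF cf K])
  have tr: "integrable lborel (\<lambda>x. f (x + c))" "integral\<^sup>L lborel (\<lambda>x. f (x + c)) = integral\<^sup>L lborel f" for c
  proof -
    have "integrable (distr lborel borel ((+) c)) f" using fi by (simp add: lborel_distr_plus)
    then have "integrable lborel (\<lambda>x. f (c + x))"
      using cf by (subst (asm) integrable_distr_eq) (auto intro: borel_measurable_continuous_onI)
    then show "integrable lborel (\<lambda>x. f (x + c))" by (simp add: add.commute)
    have "integral\<^sup>L lborel f = integral\<^sup>L (distr lborel borel ((+) c)) f" by (simp add: lborel_distr_plus)
    also have "\<dots> = integral\<^sup>L lborel (\<lambda>x. f (c + x))"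
      using cf by (intro integral_distr) (auto intro: borel_measurable_continuous_onI)
    finally show "integral\<^sup>L lborel (\<lambda>x. f (x + c)) = integral\<^sup>L lborel f" by (simp add: add.commute)
  qed
  have q0: "integral\<^sup>L lborel (q n) = 0" for n
    unfolding q_def[abs_def] using tr[of "h n *\<^sub>R e"] fi by simp
  obtain R where R: "R > 0" "tsupp f \<subseteq> ball 0 R"
    using compact_imp_bounded[OF K] bounded_subset_ballD by blast
  have cp: "continuous_on UNIV (pd [i] f)" by (rule smooth_fun_continuous[OF smooth_fun_pd[OF f]])
  \<comment> \<open>Difference quotients with step at most 1 vanish outside the ball of radius R +
    1; R + 2 leaves room. The bound on the derivative over this ball becomes the dominating
    constant.\<close>
  obtain M where M: "M \<ge> 0" "\<forall>x\<in>ball 0 (R + 2). \<bar>pd [i] f x\<bar> \<le> M"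
    using cont_bounded_on_bounded[OF cp, of "ball 0 (R + 2)"] by auto
  have Mall: "\<bar>pd [i] f x\<bar> \<le> M" for x
  proof (cases "x \<in> ball 0 (R + 2)")
    case False
    then have "x \<notin> tsupp f" using R by auto
    then show ?thesis using M(1) by (simp add: pd_not_tsupp)
  qed (use M in blast)
  have bnd: "norm (q n x) \<le> M * indicator (ball 0 (R + 2)) x" for n x
  proof (cases "x \<in> ball 0 (R + 2)")
    case True
    have d: "DERIV (\<lambda>t. f (x + t *\<^sub>R e)) t :> pd [i] f (x + t *\<^sub>R e)" for t :: real
      unfolding e_def using has_pd_at[OF smooth_fun_has_pd[OF f], of x i t] .
    have "\<exists>z>0. z < h n \<and> f (x + h n *\<^sub>R e) - f (x + 0 *\<^sub>R e) = (h n - 0) * pd [i] f (x + z *\<^sub>R e)"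
      using MVT2[OF h(1)[of n], of "\<lambda>t. f (x + t *\<^sub>R e)" "\<lambda>t. pd [i] f (x + t *\<^sub>R e)"] d by blast
    then obtain z where "f (x + h n *\<^sub>R e) - f x = h n * pd [i] f (x + z *\<^sub>R e)" by auto
    then have "q n x = pd [i] f (x + z *\<^sub>R e)" using h(1)[of n] by (simp add: q_def)
    then show ?thesis using Mall True by simp
  next
    case False
    have "norm x \<le> norm (x + h n *\<^sub>R e) + norm (h n *\<^sub>R e)"
      using norm_triangle_ineq4[of "x + h n *\<^sub>R e" "h n *\<^sub>R e"] by simp
    moreover have "norm (h n *\<^sub>R e) \<le> 1" using h[of n] by (simp add: e_def)
    ultimately have "x + h n *\<^sub>R e \<notin> ball 0 R" "x \<notin> ball 0 R" using False R by auto
    then have "f (x + h n *\<^sub>R e) = 0" "f x = 0" using R not_tsupp by blast+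
    then show ?thesis using False by (simp add: q_def)
  qed
  have "(\<lambda>n. integral\<^sup>L lborel (q n)) \<longlonglongrightarrow> integral\<^sup>L lborel (pd [i] f)"
  proof (rule integral_dominated_convergence[where w="\<lambda>x. M * indicator (ball 0 (R + 2)) x"])
    show "pd [i] f \<in> borel_measurable lborel" using borel_measurable_continuous_onI[OF cp] by simp
    have "continuous_on UNIV (q n)" for n unfolding q_def[abs_def]
      using h(1)[of n] by (intro continuous_intros continuous_on_compose2[OF cf]) auto
    then show "q n \<in> borel_measurable lborel" for n using borel_measurable_continuous_onI[of "q n"] by simp
    have "emeasure lborel (ball (0::real^'n) (R + 2)) < \<infinity>"
      using emeasure_bounded_finite[of "ball (0::real^'n) (R + 2)"] by simp
    then show "integrable lborel (\<lambda>x::real^'n. M * indicator (ball 0 (R + 2)) x)"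
      by (intro integrable_mult_right integrable_real_indicator) auto
    have "(\<lambda>n. q n x) \<longlonglongrightarrow> pd [i] f x" for x
    proof -
      have "DERIV (\<lambda>t. f (x + t *\<^sub>R e)) 0 :> pd [i] f x"
        unfolding e_def using smooth_fun_has_pd[OF f] by (simp add: has_pd_def)
      then have "((\<lambda>t. (f (x + t *\<^sub>R e) - f x) / t) \<longlongrightarrow> pd [i] f x) (at 0)"
        unfolding DERIV_def by simp
      moreover have "filterlim h (at 0) sequentially"
        unfolding filterlim_at using LIMSEQ_inverse_real_of_nat by (auto simp: h_def[abs_def])
      ultimately show ?thesis unfolding q_def by (rule filterlim_compose)
    qed
    then show "AE x in lborel. (\<lambda>n. q n x) \<longlonglongrightarrow> pd [i] f x" by simp
    show "AE x in lborel. norm (q n x) \<le> M * indicator (ball 0 (R + 2)) x" for n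
      using bnd by simp
  qed
  then show ?thesis using q0 LIMSEQ_unique[OF _ tendsto_const] by simp
qed

lemma intg_pd_eq_0:
  assumes "test_fun U f" "U \<in> sets lebesgue"
  shows "intg U (pd [i] f) = 0"
proof -
  have f: "smooth_fun f" "compact (tsupp f)" "tsupp f \<subseteq> U" using assms by (auto simp: test_fun_def)
  have "intg U (pd [i] f) = integral\<^sup>L lebesgue (pd [i] f)"
    using pd_not_tsupp f(3) by (intro intg_eq_lebesgue assms(2)) blast
  also have "\<dots> = integral\<^sup>L lborel (pd [i] f)"
    by (rule integral_completion)
       (simp add: borel_measurable_continuous_onI[OF smooth_fun_continuous[OF smooth_fun_pd[OF f(1)]]])
  finally show ?thesis using integral_pd_eq_0[OF f(1,2)] by simp
qed

lemma smooth_weak_deriv: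
  assumes f: "smooth_fun f" and U: "bounded U" "U \<in> sets lebesgue"
  shows "weak_deriv U f i (pd [i] f)"
  unfolding weak_deriv_def
proof (intro allI impI)
  fix \<phi> assume \<phi>: "test_fun U \<phi>"
  have s: "smooth_fun \<phi>" by (rule test_fun_smooth[OF \<phi>])
  note c = smooth_fun_continuous
  have "0 = intg U (pd [i] (\<lambda>x. \<phi> x * f x))"
    by (rule intg_pd_eq_0[symmetric, OF test_fun_mult[OF \<phi> f] U(2)])
  also have "\<dots> = intg U (\<lambda>x. pd [i] f x * \<phi> x + f x * pd [i] \<phi> x)"
    using pd_mult[OF s f] by (simp add: algebra_simps)
  also have "\<dots> = intg U (\<lambda>x. pd [i] f x * \<phi> x) + intg U (\<lambda>x. f x * pd [i] \<phi> x)"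
    unfolding intg_def
    by (intro Bochner_Integration.integral_add L2_mult_cont_integrable U L2_cont c smooth_fun_pd f s)
  finally show "intg U (\<lambda>x. f x * pd [i] \<phi> x) = - intg U (\<lambda>x. pd [i] f x * \<phi> x)" by simp
qed

text \<open>The indicator of K is the pointwise limit of cutoffs supported in neighbourhoods that
  shrink to K, and |g| dominates.\<close>

lemma intg_compact_eq_0:
  assumes U: "open U" and g: "integrable (lebesgue_on U) g"
    and test: "\<And>\<phi>. test_fun U \<phi> \<Longrightarrow> intg U (\<lambda>x. g x * \<phi> x) = 0"
    and K: "compact K" "K \<subseteq> U"
  shows "intg U (\<lambda>x. g x * indicator K x) = 0"
proof -
  define V where "V n = {x \<in> U. infdist x K < inverse (real (Suc n))}" for n
  show ?thesis
  proof (cases "K = {}")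
    case True then show ?thesis by (simp add: intg_def)
  next
    case False
    have "V n = U \<inter> (\<lambda>x. infdist x K) -` {..<inverse (real (Suc n))}" for n by (auto simp: V_def)
    moreover have "continuous_on UNIV (\<lambda>x. infdist x K)" by (intro continuous_intros)
    ultimately have oV: "open (V n)" for n
      using U continuous_on_open_vimage[of UNIV "\<lambda>x. infdist x K"] by auto
    have "K \<subseteq> V n" for n using K by (auto simp: V_def)
    then have "\<forall>n. \<exists>f. test_fun (V n) f \<and> (\<forall>x. 0 \<le> f x \<and> f x \<le> 1) \<and> (\<forall>x\<in>K. f x = 1)"
      using exists_cutoff[OF K(1) oV] by blast
    then obtain \<phi> where \<phi>: "\<And>n. test_fun (V n) (\<phi> n)" "\<And>n x. 0 \<le> \<phi> n x \<and> \<phi> n x \<le> 1" "\<And>n x. x \<in> K \<Longrightarrow> \<phi> n x = 1"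
      by metis
    have VU: "V n \<subseteq> U" for n by (auto simp: V_def)
    have lim: "(\<lambda>n. \<phi> n x) \<longlonglongrightarrow> indicator K x" for x
    proof (cases "x \<in> K")
      case True then show ?thesis using \<phi>(3) by simp
    next
      case x: False
      then have "infdist x K > 0"
        using K(1) False by (metis compact_imp_closed in_closed_iff_infdist_zero infdist_nonneg less_eq_real_def)
      then have "\<forall>\<^sub>F n in sequentially. inverse (real (Suc n)) < infdist x K"
        using order_tendstoD(2)[OF LIMSEQ_inverse_real_of_nat] by blast
      then have "\<forall>\<^sub>F n in sequentially. 0 = \<phi> n x"
      proof eventually_elim
        case (elim n)
        then have "x \<notin> V n" by (auto simp: V_def)
        then have "x \<notin> tsupp (\<phi> n)" using \<phi>(1)[of n] by (auto simp: test_fun_def)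
        then show ?case using not_tsupp by metis
      qed
      then have "(\<lambda>n. \<phi> n x) \<longlonglongrightarrow> 0" by (rule Lim_transform_eventually[OF tendsto_const])
      then show ?thesis using x by simp
    qed
    have gm: "g \<in> borel_measurable (lebesgue_on U)" using g by simp
    have "(\<lambda>n. integral\<^sup>L (lebesgue_on U) (\<lambda>x. g x * \<phi> n x)) \<longlonglongrightarrow> integral\<^sup>L (lebesgue_on U) (\<lambda>x. g x * indicator K x)"
    proof (rule integral_dominated_convergence[where w="\<lambda>x. \<bar>g x\<bar>"])
      have "indicator K \<in> borel_measurable (lebesgue_on U)"
        using K compact_imp_closed[OF K(1)] by (intro measurable_restrict_space1 borel_measurable_indicator) auto
      then show "(\<lambda>x. g x * indicator K x) \<in> borel_measurable (lebesgue_on U)"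
        by (intro borel_measurable_times gm)
      show "(\<lambda>x. g x * \<phi> n x) \<in> borel_measurable (lebesgue_on U)" for n
        by (intro borel_measurable_times gm cont_measurable_lebesgue_on smooth_fun_continuous test_fun_smooth[OF \<phi>(1)])
      show "integrable (lebesgue_on U) (\<lambda>x. \<bar>g x\<bar>)" using g by simp
      show "AE x in lebesgue_on U. (\<lambda>n. g x * \<phi> n x) \<longlonglongrightarrow> g x * indicator K x"
        using lim by (intro AE_I2 tendsto_mult tendsto_const)
      show "AE x in lebesgue_on U. norm (g x * \<phi> n x) \<le> \<bar>g x\<bar>" for n
        using \<phi>(2)[of n] by (intro AE_I2) (auto simp: abs_mult intro!: mult_left_le)
    qed
    moreover have "integral\<^sup>L (lebesgue_on U) (\<lambda>x. g x * \<phi> n x) = 0" for n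
      using test[OF test_fun_mono[OF \<phi>(1) VU]] by (simp add: intg_def)
    ultimately show ?thesis using LIMSEQ_unique[OF _ tendsto_const] by (simp add: intg_def)
  qed
qed

text \<open>By inner regularity the set where g is positive is, up to measure e, a closed set K.
  Being bounded, K is compact, so the integral of g over K vanishes; as g > 0 there, K is
  null.\<close>

lemma fundamental_lemma_le:
  assumes U: "open U" "bounded U" and g: "integrable (lebesgue_on U) g"
    and test: "\<And>\<phi>. test_fun U \<phi> \<Longrightarrow> intg U (\<lambda>x. g x * \<phi> x) = 0"
  shows "AE x in lebesgue_on U. g x \<le> 0"
proof -
  have Ul: "U \<in> sets lebesgue" using U by simp
  define P where "P = {x \<in> U. g x > 0}"
  have gm: "g \<in> borel_measurable (lebesgue_on U)" using g by simp
  have "{x \<in> space (lebesgue_on U). g x > 0} \<in> sets (lebesgue_on U)"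
    using gm by measurable
  then have P: "P \<in> sets lebesgue"
    using Ul by (simp add: P_def sets_restrict_space_iff)
  have "emeasure lebesgue P \<le> ennreal e" if "e > 0" for e
  proof -
    obtain K where K: "closed K" "K \<subseteq> P" "P - K \<in> lmeasurable" "emeasure lebesgue (P - K) < ennreal e"
      using sets_lebesgue_inner_closed[OF P \<open>e > 0\<close>] .
    have KU: "K \<subseteq> U" using K by (auto simp: P_def)
    then have cK: "compact K" using K U bounded_subset by (auto simp: compact_eq_bounded_closed)
    have Kl: "K \<in> sets lebesgue" using K by auto
    have im: "indicator K \<in> borel_measurable (lebesgue_on U)"
      using Kl by (intro measurable_restrict_space1 borel_measurable_indicator)
    have i: "integrable (lebesgue_on U) (\<lambda>x. g x * indicator K x)"
      by (rule Bochner_Integration.integrable_bound[OF g borel_measurable_times[OF gm im]])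
         (auto simp: indicator_def)
    have "integral\<^sup>L (lebesgue_on U) (\<lambda>x. g x * indicator K x) = 0"
      using intg_compact_eq_0[OF U(1) g test cK KU] by (simp add: intg_def)
    moreover have "AE x in lebesgue_on U. 0 \<le> g x * indicator K x"
      using K(2) by (intro AE_I2) (auto simp: indicator_def P_def)
    ultimately have "AE x in lebesgue_on U. g x * indicator K x = 0"
      using integral_nonneg_eq_0_iff_AE[OF i] by blast
    then have "AE x in lebesgue. x \<in> U \<longrightarrow> g x * indicator K x = 0"
      using Ul by (simp add: AE_restrict_space_iff)
    then have "AE x in lebesgue. x \<notin> K"
    proof eventually_elim
      case (elim x)
      then show ?case using K(2) by (auto simp: P_def indicator_def)
    qed
    then have K0: "emeasure lebesgue K = 0" using Kl by (simp add: AE_iff_measurable[where N=K])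
    have "P = K \<union> (P - K)" using K by auto
    then have "emeasure lebesgue P \<le> emeasure lebesgue K + emeasure lebesgue (P - K)"
      using Kl P by (metis emeasure_subadditive sets.Diff)
    then show ?thesis using K0 K(4) by simp
  qed
  then have "emeasure lebesgue P = 0"
    using ennreal_le_epsilon[of 0 "emeasure lebesgue P"] by (simp add: le_zero_eq)
  then have "AE x in lebesgue. x \<notin> P" using P by (simp add: AE_iff_measurable[where N=P])
  then have "AE x in lebesgue. x \<in> U \<longrightarrow> g x \<le> 0"
    by eventually_elim (auto simp: P_def)
  then show ?thesis using Ul by (simp add: AE_restrict_space_iff)
qed

lemma fundamental_lemma:
  assumes U: "open U" "bounded U" and g: "integrable (lebesgue_on U) g"
    and test: "\<And>\<phi>. test_fun U \<phi> \<Longrightarrow> intg U (\<lambda>x. g x * \<phi> x) = 0"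
  shows "AE x in lebesgue_on U. g x = 0"
proof -
  have "AE x in lebesgue_on U. g x \<le> 0" by (rule fundamental_lemma_le[OF U g test])
  moreover have "AE x in lebesgue_on U. - g x \<le> 0"
    by (rule fundamental_lemma_le[OF U]) (use g test in \<open>auto simp: intg_def\<close>)
  ultimately show ?thesis by eventually_elim simp
qed

lemma L2_eq_AE_of_test:
  assumes U: "open U" "bounded U" and g: "L2 U g" "L2 U g'"
    and test: "\<And>\<phi>. test_fun U \<phi> \<Longrightarrow> intg U (\<lambda>x. g x * \<phi> x) = intg U (\<lambda>x. g' x * \<phi> x)"
  shows "AE x in lebesgue_on U. g x = g' x"
proof -
  have Ul: "U \<in> sets lebesgue" using U by simp
  have "AE x in lebesgue_on U. g x - g' x = 0"
  proof (rule fundamental_lemma[OF U])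
    show "integrable (lebesgue_on U) (\<lambda>x. g x - g' x)"
      by (intro L2_integrable L2_diff g U Ul)
    fix \<phi> assume \<phi>: "test_fun U \<phi>"
    have "integrable (lebesgue_on U) (\<lambda>x. g x * \<phi> x)" "integrable (lebesgue_on U) (\<lambda>x. g' x * \<phi> x)"
      by (intro L2_mult_cont_integrable g U Ul smooth_fun_continuous test_fun_smooth[OF \<phi>])+
    then show "intg U (\<lambda>x. (g x - g' x) * \<phi> x) = 0"
      using test[OF \<phi>] by (simp add: intg_def left_diff_distrib)
  qed
  then show ?thesis by eventually_elim simp
qed

section \<open>Uniqueness of weak derivatives and weak divergences\<close>

lemma wd_L2: "H1 U f \<Longrightarrow> L2 U (wd U f i)"
  and wd_weak_deriv: "H1 U f \<Longrightarrow> weak_deriv U f i (wd U f i)"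
  unfolding H1_def wd_def using someI_ex[of "\<lambda>g. L2 U g \<and> weak_deriv U f i g"] by auto

text \<open>\<open>wd\<close> is an arbitrary choice among weak derivatives. This uniqueness is how
  a computed derivative is exchanged for the chosen one; \<open>wdiv_AE_eq\<close> does the same for
  the divergence.\<close>

lemma wd_AE_eq:
  assumes U: "open U" "bounded U" and g: "L2 U g" "weak_deriv U f i g"
  shows "AE x in lebesgue_on U. wd U f i x = g x"
proof -
  have "L2 U (wd U f i) \<and> weak_deriv U f i (wd U f i)"
    unfolding wd_def using someI[of "\<lambda>g. L2 U g \<and> weak_deriv U f i g" g] g by simp
  then show ?thesis using g by (intro L2_eq_AE_of_test U) (auto simp: weak_deriv_def)
qed

lemma wdiv_L2: "Hdiv U v \<Longrightarrow> L2 U (wdiv U v)"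
  and wdiv_weak_div: "Hdiv U v \<Longrightarrow> weak_div U v (wdiv U v)"
  unfolding Hdiv_def wdiv_def using someI_ex[of "\<lambda>g. L2 U g \<and> weak_div U v g"] by auto

lemma wdiv_AE_eq:
  assumes U: "open U" "bounded U" and g: "L2 U g" "weak_div U v g"
  shows "AE x in lebesgue_on U. wdiv U v x = g x"
proof -
  have "L2 U (wdiv U v) \<and> weak_div U v (wdiv U v)"
    unfolding wdiv_def using someI[of "\<lambda>g. L2 U g \<and> weak_div U v g" g] g by simp
  then show ?thesis using g by (intro L2_eq_AE_of_test U) (auto simp: weak_div_def)
qed

lemma intg_cong_AE:
  assumes "AE x in lebesgue_on U. f x = g x" "f \<in> borel_measurable (lebesgue_on U)" "g \<in> borel_measurable (lebesgue_on U)"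
  shows "intg U f = intg U g"
  unfolding intg_def using assms by (intro integral_cong_AE)

lemma weak_deriv_lincomb:
  assumes "finite I" "\<And>k. k \<in> I \<Longrightarrow> L2 U (f k)" "\<And>k. k \<in> I \<Longrightarrow> L2 U (g k)"
    "\<And>k. k \<in> I \<Longrightarrow> weak_deriv U (f k) i (g k)" "bounded U" "U \<in> sets lebesgue"
  shows "weak_deriv U (\<lambda>x. \<Sum>k\<in>I. c k * f k x) i (\<lambda>x. \<Sum>k\<in>I. c k * g k x)"
  unfolding weak_deriv_def
proof (intro allI impI)
  fix \<phi> assume \<phi>: "test_fun U \<phi>"
  have s: "continuous_on UNIV \<phi>" "continuous_on UNIV (pd [i] \<phi>)"
    using \<phi> by (auto intro!: smooth_fun_continuous smooth_fun_pd simp: test_fun_def)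
  have lin: "intg U (\<lambda>x. (\<Sum>k\<in>I. c k * h k x) * \<psi> x) = (\<Sum>k\<in>I. c k * intg U (\<lambda>x. h k x * \<psi> x))"
    if h: "\<And>k. k \<in> I \<Longrightarrow> L2 U (h k)" and "continuous_on UNIV \<psi>" for h :: "'a \<Rightarrow> _" and \<psi>
  proof -
    have "intg U (\<lambda>x. (\<Sum>k\<in>I. c k * h k x) * \<psi> x) = intg U (\<lambda>x. \<Sum>k\<in>I. c k * (h k x * \<psi> x))"
      by (simp add: sum_distrib_right mult.assoc)
    also have "\<dots> = (\<Sum>k\<in>I. intg U (\<lambda>x. c k * (h k x * \<psi> x)))"
      unfolding intg_def
      by (intro Bochner_Integration.integral_sum integrable_mult_right L2_mult_cont_integrable h assms(5,6) that(2))
    also have "\<dots> = (\<Sum>k\<in>I. c k * intg U (\<lambda>x. h k x * \<psi> x))"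
      by (simp add: intg_def)
    finally show ?thesis .
  qed
  have "(\<Sum>k\<in>I. c k * intg U (\<lambda>x. f k x * pd [i] \<phi> x)) = - (\<Sum>k\<in>I. c k * intg U (\<lambda>x. g k x * \<phi> x))"
    unfolding sum_negf[symmetric] using assms(4) \<phi> by (intro sum.cong) (auto simp: weak_deriv_def)
  then show "intg U (\<lambda>x. (\<Sum>k\<in>I. c k * f k x) * pd [i] \<phi> x) = - intg U (\<lambda>x. (\<Sum>k\<in>I. c k * g k x) * \<phi> x)"
    using lin[of f "pd [i] \<phi>"] lin[of g \<phi>] s assms(2,3) by simp
qed

section \<open>Sets of codimension two are removable\<close>

text \<open>The neighbourhood is cut out by two separate inequalities, so that the two coordinates
  can be treated independently when translates are compared.\<close>

definition tube :: "real^'n::finite \<Rightarrow> real^'n \<Rightarrow> real \<Rightarrow> real \<Rightarrow> real \<Rightarrow> (real^'n) set" where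
  "tube a c \<alpha> \<beta> r = {x. \<bar>a \<bullet> x - \<alpha>\<bar> \<le> r \<and> \<bar>c \<bullet> x - \<beta>\<bar> \<le> r}"

lemma closed_tube: "closed (tube a c \<alpha> \<beta> r)"
proof -
  have "tube a c \<alpha> \<beta> r = {x. \<bar>a \<bullet> x - \<alpha>\<bar> \<le> r} \<inter> {x. \<bar>c \<bullet> x - \<beta>\<bar> \<le> r}" by (auto simp: tube_def)
  then show ?thesis by (auto intro!: closed_Int closed_Collect_le continuous_intros)
qed

lemma tube_sets [simp]: "tube a c \<alpha> \<beta> r \<in> sets lebesgue"
  by (intro sets_completionI_sets) (simp add: borel_closed closed_tube)

text \<open>Packing: the \<open>m\<^sup>2\<close> translates of the tube by \<open>(8 p / m) a + (8 q / m) c\<close> are disjoint and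
  stay in a fixed ball.\<close>
lemma tube_measure:
  fixes a c :: "real^'n::finite"
  assumes on: "norm a = 1" "norm c = 1" "a \<bullet> c = 0" and U: "bounded U" "U \<in> sets lebesgue"
  shows "\<exists>C\<ge>0. \<forall>m::nat. m > 0 \<longrightarrow>
    measure lebesgue (U \<inter> tube a c \<alpha> \<beta> (2 / real m)) \<le> C / (real m)\<^sup>2"
proof -
  obtain R where R: "U \<subseteq> ball 0 R" using U(1) bounded_subset_ballD by blast
  \<comment> \<open>The two components of a translation have length at most 8 each, so its norm is
    at most 16; this enlarges the ball containing U by 16.\<close>
  define C where "C = measure lebesgue (ball (0::real^'n) (R + 16))"
  have aa: "a \<bullet> a = 1" "c \<bullet> c = 1" "c \<bullet> a = 0" using on by (auto simp: norm_eq_1 inner_commute)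
  have "measure lebesgue (U \<inter> tube a c \<alpha> \<beta> (2 / real m)) \<le> C / (real m)\<^sup>2" if m: "m > 0" for m :: nat
  proof -
    define Z where "Z = U \<inter> tube a c \<alpha> \<beta> (2 / real m)"
    define \<tau> where "\<tau> p = (8 * real (fst p) / m) *\<^sub>R a + (8 * real (snd p) / m) *\<^sub>R c" for p :: "nat \<times> nat"
    define I where "I = {..<m} \<times> {..<m}"
    have Zm: "Z \<in> lmeasurable"
      unfolding Z_def using U by (intro bounded_set_imp_lmeasurable sets.Int) (auto intro: bounded_subset)
    have tm: "(+) (\<tau> p) ` Z \<in> lmeasurable" for p using Zm by (rule measurable_translation)
    have small: "norm (\<tau> p) \<le> 16" if "p \<in> I" for p
    proof -
      have "norm (\<tau> p) \<le> 8 * real (fst p) / m + 8 * real (snd p) / m"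
        unfolding \<tau>_def using on norm_triangle_ineq[of "(8 * real (fst p) / m) *\<^sub>R a" "(8 * real (snd p) / m) *\<^sub>R c"] by simp
      moreover have "8 * real (fst p) / m \<le> 8" "8 * real (snd p) / m \<le> 8" using that m by (auto simp: I_def field_simps)
      ultimately show ?thesis by linarith
    qed
    have sub: "(\<Union>p\<in>I. (+) (\<tau> p) ` Z) \<subseteq> ball 0 (R + 16)"
    proof
      fix y assume "y \<in> (\<Union>p\<in>I. (+) (\<tau> p) ` Z)"
      then obtain p x where p: "p \<in> I" and x: "x \<in> Z" and y: "y = \<tau> p + x" by blast
      have "norm x < R" using x R by (auto simp: Z_def)
      then have "norm y < R + 16" unfolding y using norm_triangle_ineq[of "\<tau> p" x] small[OF p] by linarith
      then show "y \<in> ball 0 (R + 16)" by simp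
    qed
    have dis: "disjoint_family_on (\<lambda>p. (+) (\<tau> p) ` Z) I"
      unfolding disjoint_family_on_def
    proof (intro ballI impI)
      fix p p' assume p: "p \<in> I" "p' \<in> I" "p \<noteq> p'"
      show "(+) (\<tau> p) ` Z \<inter> (+) (\<tau> p') ` Z = {}"
      proof (rule ccontr)
        assume "\<not> ?thesis"
        then obtain x x' where x: "x \<in> Z" "x' \<in> Z" "\<tau> p + x = \<tau> p' + x'" by auto
        \<comment> \<open>Coordinates of two points of the tube differ by at most 4/m, less than the
          spacing 8/m of the translates, so a coincidence forces equal indices.\<close>
        have eq: "k = k'" if "8 * real k / m + s = 8 * real k' / m + s'" "\<bar>s - \<gamma>\<bar> \<le> 2 / m" "\<bar>s' - \<gamma>\<bar> \<le> 2 / m"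
          for k k' :: nat and s s' \<gamma> :: real
        proof -
          have "\<bar>8 * real k / m - 8 * real k' / m\<bar> \<le> 4 / m" using that by linarith
          then have "\<bar>(8 * real k - 8 * real k') / m\<bar> \<le> 4 / m" by (simp add: diff_divide_distrib)
          then have "\<bar>8 * real k - 8 * real k'\<bar> \<le> 4" using m by (simp add: divide_le_cancel)
          then show ?thesis by linarith
        qed
        have "a \<bullet> (\<tau> p + x) = a \<bullet> (\<tau> p' + x')" "c \<bullet> (\<tau> p + x) = c \<bullet> (\<tau> p' + x')" using x by auto
        then have "8 * real (fst p) / m + a \<bullet> x = 8 * real (fst p') / m + a \<bullet> x'"
          "8 * real (snd p) / m + c \<bullet> x = 8 * real (snd p') / m + c \<bullet> x'"
          by (simp_all add: \<tau>_def inner_add_right aa on(3))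
        then have "fst p = fst p'" "snd p = snd p'"
          using x(1,2) by (auto simp: Z_def tube_def intro: eq)
        then show False using p by (simp add: prod_eq_iff)
      qed
    qed
    have "(\<Sum>p\<in>I. measure lebesgue ((+) (\<tau> p) ` Z)) = measure lebesgue (\<Union>p\<in>I. (+) (\<tau> p) ` Z)"
      using fmeasurableD[OF tm] fmeasurableD2[OF tm] dis
      by (intro measure_finite_Union[symmetric]) (auto simp: I_def image_subset_iff)
    also have "\<dots> \<le> C"
      unfolding C_def by (intro measure_mono_fmeasurable[OF sub])
        (use tm in \<open>auto simp: I_def intro!: sets.finite_UN fmeasurableD\<close>)
    finally have "real (card I) * measure lebesgue Z \<le> C" by (simp add: measure_translation)
    then have "(real m)\<^sup>2 * measure lebesgue Z \<le> C" by (simp add: I_def power2_eq_square)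
    then show ?thesis using m by (simp add: Z_def field_simps)
  qed
  then show ?thesis by (intro exI[of _ C]) (auto simp: C_def)
qed

definition plane2 :: "real^'n::finite \<Rightarrow> real^'n \<Rightarrow> real \<Rightarrow> real \<Rightarrow> (real^'n) set" where
  "plane2 a c \<alpha> \<beta> = {x. a \<bullet> x = \<alpha> \<and> c \<bullet> x = \<beta>}"

text \<open>For orthonormal a and c, with \<rho> the distance to the plane, this is
  \<open>step\<close> of m^2 \<rho>^2 - 1: for m > 0 it vanishes for \<rho> \<le> 1/m and equals 1
  for \<rho> \<ge> sqrt 2 / m.\<close>

definition plane_cutoff :: "real^'n::finite \<Rightarrow> real^'n \<Rightarrow> real \<Rightarrow> real \<Rightarrow> nat \<Rightarrow> real^'n \<Rightarrow> real" where
  "plane_cutoff a c \<alpha> \<beta> m x =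
     step ((real m)\<^sup>2 * ((a \<bullet> x - \<alpha>) * (a \<bullet> x - \<alpha>) + (c \<bullet> x - \<beta>) * (c \<bullet> x - \<beta>)) - 1)"

lemma smooth_plane_cutoff: "smooth_fun (plane_cutoff a c \<alpha> \<beta> m)"
  unfolding plane_cutoff_def[abs_def]
  by (intro smooth_fun_step smooth_fun_diff smooth_fun_add smooth_fun_mult smooth_fun_inner smooth_fun_const)

lemma plane_cutoff_range: "0 \<le> plane_cutoff a c \<alpha> \<beta> m x" "plane_cutoff a c \<alpha> \<beta> m x \<le> 1"
  by (auto simp: plane_cutoff_def step_nonneg step_le_1)

lemma tsupp_plane_cutoff: "tsupp (plane_cutoff a c \<alpha> \<beta> m) \<inter> plane2 a c \<alpha> \<beta> = {}"
proof -
  let ?q = "\<lambda>x. (real m)\<^sup>2 * ((a \<bullet> x - \<alpha>) * (a \<bullet> x - \<alpha>) + (c \<bullet> x - \<beta>) * (c \<bullet> x - \<beta>))"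
  have "tsupp (plane_cutoff a c \<alpha> \<beta> m) \<subseteq> {x. 1 \<le> ?q x}"
  proof (rule tsupp_subset)
    show "closed {x. 1 \<le> ?q x}" by (intro closed_Collect_le continuous_intros)
    show "plane_cutoff a c \<alpha> \<beta> m x = 0" if "x \<notin> {x. 1 \<le> ?q x}" for x
      using that unfolding plane_cutoff_def by (intro step_eq_0) auto
  qed
  then show ?thesis by (auto simp: plane2_def)
qed

lemma plane_cutoff_tendsto:
  assumes "x \<notin> plane2 a c \<alpha> \<beta>"
  shows "(\<lambda>m. plane_cutoff a c \<alpha> \<beta> m x) \<longlonglongrightarrow> 1"
proof -
  define q where "q = (a \<bullet> x - \<alpha>) * (a \<bullet> x - \<alpha>) + (c \<bullet> x - \<beta>) * (c \<bullet> x - \<beta>)"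
  have "q > 0" using assms unfolding q_def plane2_def sum_squares_gt_zero_iff by auto
  obtain k :: nat where k: "real k > 2 / q" using reals_Archimedean2 by blast
  have "\<forall>\<^sub>F m in sequentially. 1 = plane_cutoff a c \<alpha> \<beta> m x"
    \<comment> \<open>m \<ge> 2/q together with m \<ge> 1 gives m^2 q \<ge> 2, where the cutoff is
      already 1; hence \<open>max k 1\<close>.\<close>
    using eventually_ge_at_top[of "max k 1"]
  proof eventually_elim
    case (elim m)
    then have "2 / q \<le> real m" "1 \<le> real m" using k by auto
    then have "2 / q \<le> (real m)\<^sup>2"
      using mult_mono[of 1 "real m" "2 / q" "real m"] \<open>q > 0\<close> by (simp add: power2_eq_square)
    then have "2 \<le> (real m)\<^sup>2 * q" using \<open>q > 0\<close> by (simp add: field_simps)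
    then show ?case unfolding plane_cutoff_def q_def[symmetric] by (subst step_eq_1) auto
  qed
  then show ?thesis by (rule Lim_transform_eventually[OF tendsto_const])
qed

text \<open>The chain rule gives the factor 2 m^2 (A a_j + D c_j), and \<open>step'\<close> vanishes
  unless m^2 (A^2 + D^2) \<le> 2. There |A| and |D| are at most 2/m, which puts x in the tube and
  bounds the factor by 2 m^2 * 4/m = 8 m.\<close>

lemma pd_plane_cutoff_bound:
  assumes on: "norm a = 1" "norm c = 1" and M: "\<And>t. \<bar>step' t\<bar> \<le> M" and m: "m > 0"
  shows "\<bar>pd [j] (plane_cutoff a c \<alpha> \<beta> m) x\<bar> \<le> 8 * M * real m * indicator (tube a c \<alpha> \<beta> (2 / real m)) x"
proof -
  define A where "A = (\<lambda>x. a \<bullet> x - \<alpha>)"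
  define D where "D = (\<lambda>x. c \<bullet> x - \<beta>)"
  define q where "q = (\<lambda>x. A x * A x + D x * D x)"
  have M0: "M \<ge> 0" using M[of 0] by linarith
  have A: "smooth_fun A" "has_pd A j (\<lambda>x. a $ j)" unfolding A_def
  proof -
    have "has_pd (\<lambda>x. a \<bullet> x + - \<alpha>) j (\<lambda>x. a $ j + 0)" by (rule has_pd_add[OF has_pd_inner has_pd_const])
    then show "has_pd (\<lambda>x. a \<bullet> x - \<alpha>) j (\<lambda>x. a $ j)" by simp
  qed (intro smooth_fun_diff smooth_fun_inner smooth_fun_const)
  have D: "smooth_fun D" "has_pd D j (\<lambda>x. c $ j)" unfolding D_def
  proof -
    have "has_pd (\<lambda>x. c \<bullet> x + - \<beta>) j (\<lambda>x. c $ j + 0)" by (rule has_pd_add[OF has_pd_inner has_pd_const])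
    then show "has_pd (\<lambda>x. c \<bullet> x - \<beta>) j (\<lambda>x. c $ j)" by simp
  qed (intro smooth_fun_diff smooth_fun_inner smooth_fun_const)
  have q: "has_pd q j (\<lambda>x. (a $ j * A x + A x * a $ j) + (c $ j * D x + D x * c $ j))"
    unfolding q_def by (intro has_pd_add has_pd_mult A D)
  define u where "u = (\<lambda>x. (real m)\<^sup>2 * q x - 1)"
  have u: "has_pd u j (\<lambda>x. 2 * (real m)\<^sup>2 * (A x * a $ j + D x * c $ j))"
    unfolding u_def using has_pd_add[OF has_pd_mult[OF has_pd_const[of "(real m)\<^sup>2"] q] has_pd_const[of "-1"]]
    by (simp add: algebra_simps)
  have "plane_cutoff a c \<alpha> \<beta> m = (\<lambda>x. step (u x))"
    by (auto simp: plane_cutoff_def u_def q_def A_def D_def)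
  then have eq: "pd [j] (plane_cutoff a c \<alpha> \<beta> m) x = step' (u x) * (2 * (real m)\<^sup>2 * (A x * a $ j + D x * c $ j))"
    using has_pd_imp_pd[OF has_pd_chain[OF u step_deriv]] by simp
  show ?thesis
  proof (cases "u x > 1")
    case True
    then show ?thesis using eq M0 by (simp add: step'_eq_0 indicator_def)
  next
    case False
    then have "(real m)\<^sup>2 * q x \<le> 2" by (simp add: u_def)
    have le: "\<bar>t\<bar> \<le> 2 / real m" if "t * t \<le> q x" for t
    proof -
      have "(real m)\<^sup>2 * (t * t) \<le> (real m)\<^sup>2 * q x" using that by (intro mult_left_mono) auto
      then have "(real m * t)\<^sup>2 \<le> 2\<^sup>2" using \<open>(real m)\<^sup>2 * q x \<le> 2\<close> by (simp add: power2_eq_square algebra_simps)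
      then have "\<bar>real m * t\<bar> \<le> 2" using abs_le_square_iff[of "real m * t" 2] by simp
      then show ?thesis using m by (simp add: abs_mult field_simps)
    qed
    have "\<bar>A x\<bar> \<le> 2 / real m" "\<bar>D x\<bar> \<le> 2 / real m" by (auto intro!: le simp: q_def)
    then have x: "x \<in> tube a c \<alpha> \<beta> (2 / real m)" by (simp add: tube_def A_def D_def)
    have "\<bar>a $ j\<bar> \<le> 1" "\<bar>c $ j\<bar> \<le> 1" using on component_le_norm_cart by metis+
    then have "\<bar>A x * a $ j\<bar> \<le> 2 / real m * 1" "\<bar>D x * c $ j\<bar> \<le> 2 / real m * 1"
      unfolding abs_mult using \<open>\<bar>A x\<bar> \<le> 2 / real m\<close> \<open>\<bar>D x\<bar> \<le> 2 / real m\<close> by (intro mult_mono; simp)+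
    then have "\<bar>A x * a $ j + D x * c $ j\<bar> \<le> 4 / real m" by linarith
    then have "2 * (real m)\<^sup>2 * \<bar>A x * a $ j + D x * c $ j\<bar> \<le> 2 * (real m)\<^sup>2 * (4 / real m)"
      by (intro mult_left_mono) auto
    also have "\<dots> = 8 * real m" using m by (simp add: power2_eq_square)
    finally have "\<bar>2 * (real m)\<^sup>2 * (A x * a $ j + D x * c $ j)\<bar> \<le> 8 * real m" by (simp add: abs_mult)
    then have "\<bar>step' (u x)\<bar> * \<bar>2 * (real m)\<^sup>2 * (A x * a $ j + D x * c $ j)\<bar> \<le> M * (8 * real m)"
      using M by (intro mult_mono M0) auto
    then show ?thesis using x by (simp add: eq abs_mult)
  qed
qed

text \<open>The cutoff gradients have size m on tubes of measure \<open>O(m\<^sup>-\<^sup>2)\<close>, hence are bounded in \<open>L\<^sup>2\<close>,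
  while the \<open>L\<^sup>2\<close> mass of the coefficients on the tubes tends to zero.\<close>
lemma plane2_removable:
  fixes A :: "'n::finite \<Rightarrow> real^'n \<Rightarrow> real"
  defines "B \<equiv> \<lambda>U A b g. intg U (\<lambda>x. (\<Sum>j\<in>UNIV. A j x * pd [j] g x) + b x * g x)"
  assumes U: "open U" "bounded U" and A: "\<And>j. L2 U (A j)" and b: "L2 U b"
    and on: "norm a = 1" "norm c = 1" "a \<bullet> c = 0"
    and f: "test_fun U f"
    and van: "\<And>g. test_fun U g \<Longrightarrow> tsupp g \<subseteq> tsupp f - plane2 a c \<alpha> \<beta> \<Longrightarrow> B U A b g = 0"
  shows "B U A b f = 0"
proof -
  have Ul: "U \<in> sets lebesgue" using U by simp
  define \<rho> where "\<rho> = plane_cutoff a c \<alpha> \<beta>"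
  have s\<rho>: "smooth_fun (\<rho> m)" for m by (simp add: \<rho>_def smooth_plane_cutoff)
  have sf: "smooth_fun f" by (rule test_fun_smooth[OF f])
  define F where "F = (\<lambda>x. (\<Sum>j\<in>UNIV. A j x * pd [j] f x) + b x * f x)"
  have cont: "continuous_on UNIV f" "continuous_on UNIV (pd [j] f)" "continuous_on UNIV (\<rho> m)" "continuous_on UNIV (pd [j] (\<rho> m))" for j m
    by (intro smooth_fun_continuous smooth_fun_pd sf s\<rho>)+
  have LF: "L2 U F" unfolding F_def by (intro L2_add L2_sum L2_mult_cont A b U cont)
  define G where "G m j = intg U (\<lambda>x. A j x * (f x * pd [j] (\<rho> m) x))" for m j
  \<comment> \<open>The product of f and the cutoff is supported off the plane. By the product rule
    its form splits into the wanted integrand damped by the cutoff, and the terms \<open>G\<close>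
    in which the derivative falls on the cutoff.\<close>
  have split: "intg U (\<lambda>x. F x * \<rho> m x) + (\<Sum>j\<in>UNIV. G m j) = 0" for m
  proof -
    have t: "test_fun U (\<lambda>x. f x * \<rho> m x)" by (rule test_fun_mult[OF f s\<rho>])
    have "tsupp (\<lambda>x. f x * \<rho> m x) \<subseteq> tsupp f - plane2 a c \<alpha> \<beta>"
      using tsupp_mult_subset[of f "\<rho> m"] tsupp_plane_cutoff[of a c \<alpha> \<beta> m] by (auto simp: \<rho>_def)
    then have "0 = B U A b (\<lambda>x. f x * \<rho> m x)" using van[OF t] by simp
    also have "\<dots> = intg U (\<lambda>x. F x * \<rho> m x + (\<Sum>j\<in>UNIV. A j x * (f x * pd [j] (\<rho> m) x)))"
      unfolding B_def F_def pd_mult[OF sf s\<rho>]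
      by (simp add: algebra_simps sum.distrib sum_distrib_left sum_distrib_right)
    also have "\<dots> = intg U (\<lambda>x. F x * \<rho> m x) + intg U (\<lambda>x. \<Sum>j\<in>UNIV. A j x * (f x * pd [j] (\<rho> m) x))"
      unfolding intg_def
      by (intro Bochner_Integration.integral_add Bochner_Integration.integrable_sum L2_mult_cont_integrable
          LF A U Ul cont continuous_on_mult)
    also have "intg U (\<lambda>x. \<Sum>j\<in>UNIV. A j x * (f x * pd [j] (\<rho> m) x)) = (\<Sum>j\<in>UNIV. G m j)"
      unfolding intg_def G_def
      by (intro Bochner_Integration.integral_sum L2_mult_cont_integrable A U Ul cont continuous_on_mult)
    finally show ?thesis by simp
  qed
  have negl: "AE x in lebesgue_on U. x \<notin> plane2 a c \<alpha> \<beta>"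
  proof -
    have "negligible (plane2 a c \<alpha> \<beta>)"
      by (rule negligible_subset[OF negligible_hyperplane[of a \<alpha>]]) (use on in \<open>auto simp: plane2_def\<close>)
    then have "AE x in lebesgue. x \<notin> plane2 a c \<alpha> \<beta>"
      by (simp add: AE_not_in negligible_iff_null_sets)
    then have "AE x in lebesgue. x \<in> U \<longrightarrow> x \<notin> plane2 a c \<alpha> \<beta>" by eventually_elim simp
    then show ?thesis using Ul by (simp add: AE_restrict_space_iff)
  qed
  have lim1: "(\<lambda>m. intg U (\<lambda>x. F x * \<rho> m x)) \<longlonglongrightarrow> intg U F"
    unfolding intg_def
  proof (rule integral_dominated_convergence[where w="\<lambda>x. \<bar>F x\<bar>"])
    show "F \<in> borel_measurable (lebesgue_on U)" by (rule L2D(1)[OF LF])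
    show "(\<lambda>x. F x * \<rho> m x) \<in> borel_measurable (lebesgue_on U)" for m
      by (intro borel_measurable_times L2D[OF LF] cont_measurable_lebesgue_on cont)
    show "integrable (lebesgue_on U) (\<lambda>x. \<bar>F x\<bar>)"
      using L2_integrable[OF LF U(2) Ul] by simp
    show "AE x in lebesgue_on U. (\<lambda>m. F x * \<rho> m x) \<longlonglongrightarrow> F x"
      using negl
    proof eventually_elim
      case (elim x)
      then show ?case using tendsto_mult[OF tendsto_const plane_cutoff_tendsto, of x a c \<alpha> \<beta> "F x"] by (simp add: \<rho>_def)
    qed
    show "AE x in lebesgue_on U. norm (F x * \<rho> m x) \<le> \<bar>F x\<bar>" for m
      using plane_cutoff_range[of a c \<alpha> \<beta> m] by (intro AE_I2) (auto simp: \<rho>_def abs_mult intro!: mult_left_le)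
  qed
  have lim2: "(\<lambda>m. G m j) \<longlonglongrightarrow> 0" for j
  proof -
    obtain M where M: "\<And>t. \<bar>step' t\<bar> \<le> M" using step'_bounded by blast
    obtain Mf where Mf: "Mf \<ge> 0" "\<forall>x\<in>U. \<bar>f x\<bar> \<le> Mf" using cont_bounded_on_bounded[OF cont(1) U(2)] by blast
    obtain C where C: "C \<ge> 0" "\<And>m::nat. m > 0 \<Longrightarrow> measure lebesgue (U \<inter> tube a c \<alpha> \<beta> (2 / real m)) \<le> C / (real m)\<^sup>2"
      using tube_measure[OF on U(2) Ul] by blast
    define Z where "Z m = tube a c \<alpha> \<beta> (2 / real m)" for m :: nat
    define D where "D = Mf * (8 * M)"
    have Zs: "Z m \<in> sets lebesgue" for m by (simp add: Z_def)
    have Zi: "indicator (Z m) \<in> borel_measurable (lebesgue_on U)" for m :: nat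
      using Zs by (intro measurable_restrict_space1 borel_measurable_indicator)
    define S where "S m = intg U (\<lambda>x. (A j x * indicator (Z m) x)\<^sup>2)" for m
    have Aj: "L2 U (\<lambda>x. A j x * indicator (Z m) x)" for m
      by (rule L2_bound[OF borel_measurable_times[OF L2D(1)[OF A] Zi] L2D(2)[OF A[of j]]]) (auto simp: indicator_def)
    have M0: "M \<ge> 0" using M[of 0] by linarith
    have hb: "\<bar>f x * pd [j] (\<rho> m) x\<bar> \<le> D * real m * indicator (Z m) x" if "x \<in> U" "m > 0" for x m
    proof -
      have "\<bar>f x\<bar> * \<bar>pd [j] (\<rho> m) x\<bar> \<le> Mf * (8 * M * real m * indicator (Z m) x)"
        using Mf that pd_plane_cutoff_bound[OF on(1,2) M that(2), of j \<alpha> \<beta> x]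
        by (intro mult_mono) (auto simp: \<rho>_def Z_def)
      then show ?thesis by (simp add: abs_mult D_def algebra_simps)
    qed
    have G: "\<bar>G m j\<bar> \<le> sqrt (S m) * sqrt (D\<^sup>2 * C)" if m: "m > 0" for m
    proof -
      have Lh: "L2 U (\<lambda>x. f x * pd [j] (\<rho> m) x)" by (intro L2_cont continuous_on_mult cont U Ul)
      \<comment> \<open>Inserting the indicator costs nothing, because the derivative of the cutoff
        vanishes off the tube; it puts the smallness on the coefficient in Cauchy-Schwarz.\<close>
      have "A j x * (f x * pd [j] (\<rho> m) x) = (A j x * indicator (Z m) x) * (f x * pd [j] (\<rho> m) x)" if "x \<in> U" for x
        using hb[OF that m] by (cases "x \<in> Z m") auto
      then have "G m j = intg U (\<lambda>x. (A j x * indicator (Z m) x) * (f x * pd [j] (\<rho> m) x))"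
        unfolding G_def intg_def by (intro Bochner_Integration.integral_cong) auto
      then have 1: "\<bar>G m j\<bar> \<le> sqrt (S m) * sqrt (intg U (\<lambda>x. (f x * pd [j] (\<rho> m) x)\<^sup>2))"
        unfolding S_def using L2_Cauchy_Schwarz[OF Aj Lh] by simp
      have fin: "U \<inter> Z m \<in> lmeasurable"
        using U Zs Ul by (intro bounded_set_imp_lmeasurable sets.Int) (auto intro: bounded_subset)
      have ii: "integrable lebesgue (\<lambda>x. indicator (U \<inter> Z m) x :: real)" using fin by (auto simp: fmeasurable_def)
      have eqi: "(\<lambda>x. indicator U x *\<^sub>R (D\<^sup>2 * (real m)\<^sup>2 * indicator (Z m) x)) = (\<lambda>x. D\<^sup>2 * (real m)\<^sup>2 * indicator (U \<inter> Z m) x)"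
        by (auto simp: indicator_def)
      have i: "integrable (lebesgue_on U) (\<lambda>x. D\<^sup>2 * (real m)\<^sup>2 * indicator (Z m) x)"
      proof -
        have "integrable lebesgue (\<lambda>x. indicator U x *\<^sub>R (D\<^sup>2 * (real m)\<^sup>2 * indicator (Z m) x))"
          unfolding eqi using ii by (rule integrable_mult_right)
        then show ?thesis using Ul by (subst integrable_restrict_space) auto
      qed
      have "intg U (\<lambda>x. (f x * pd [j] (\<rho> m) x)\<^sup>2) \<le> intg U (\<lambda>x. D\<^sup>2 * (real m)\<^sup>2 * indicator (Z m) x)"
        unfolding intg_def
      proof (rule integral_mono[OF L2D(2)[OF Lh] i])
        fix x assume "x \<in> space (lebesgue_on U)"
        then have "\<bar>f x * pd [j] (\<rho> m) x\<bar>\<^sup>2 \<le> (D * real m * indicator (Z m) x)\<^sup>2"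
          using hb[OF _ m, of x] by (intro power_mono) auto
        then show "(f x * pd [j] (\<rho> m) x)\<^sup>2 \<le> D\<^sup>2 * (real m)\<^sup>2 * indicator (Z m) x"
          by (auto simp: power_mult_distrib indicator_def split: if_splits)
      qed
      also have "\<dots> = D\<^sup>2 * (real m)\<^sup>2 * measure lebesgue (U \<inter> Z m)"
      proof -
        have "intg U (\<lambda>x. D\<^sup>2 * (real m)\<^sup>2 * indicator (Z m) x)
            = integral\<^sup>L lebesgue (\<lambda>x. indicator U x *\<^sub>R (D\<^sup>2 * (real m)\<^sup>2 * indicator (Z m) x))"
          unfolding intg_def using Ul by (intro integral_restrict_space) auto
        then show ?thesis unfolding eqi by simp
      qed
      also have "\<dots> \<le> D\<^sup>2 * (real m)\<^sup>2 * (C / (real m)\<^sup>2)"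
        using C(2)[OF m] by (intro mult_left_mono) (auto simp: Z_def)
      also have "\<dots> = D\<^sup>2 * C" using m by simp
      finally have "sqrt (intg U (\<lambda>x. (f x * pd [j] (\<rho> m) x)\<^sup>2)) \<le> sqrt (D\<^sup>2 * C)" by simp
      moreover have "0 \<le> sqrt (S m)" by (simp add: S_def intg_def)
      ultimately show ?thesis using 1 by (meson mult_left_mono order_trans)
    qed
    have S0: "S \<longlonglongrightarrow> 0"
    proof -
      have "(\<lambda>m. integral\<^sup>L (lebesgue_on U) (\<lambda>x. (A j x * indicator (Z m) x)\<^sup>2)) \<longlonglongrightarrow> integral\<^sup>L (lebesgue_on U) (\<lambda>x. 0::real)"
      proof (rule integral_dominated_convergence[where w="\<lambda>x. (A j x)\<^sup>2"])
        show "(\<lambda>x. (A j x * indicator (Z m) x)\<^sup>2) \<in> borel_measurable (lebesgue_on U)" for m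
          using L2D(2)[OF Aj[of m]] by simp
        show "integrable (lebesgue_on U) (\<lambda>x. (A j x)\<^sup>2)" by (rule L2D(2)[OF A])
        show "AE x in lebesgue_on U. (\<lambda>m. (A j x * indicator (Z m) x)\<^sup>2) \<longlonglongrightarrow> 0"
          using negl
        proof eventually_elim
          case (elim x)
          define d where "d = max \<bar>a \<bullet> x - \<alpha>\<bar> \<bar>c \<bullet> x - \<beta>\<bar>"
          have "d > 0" using elim by (auto simp: d_def plane2_def max_def)
          have "(\<lambda>m. 2 * inverse (real m)) \<longlonglongrightarrow> 2 * 0"
            by (intro tendsto_mult tendsto_const lim_inverse_n)
          then have "\<forall>\<^sub>F m in sequentially. 2 * inverse (real m) < d"
            by (rule order_tendstoD(2)) (use \<open>d > 0\<close> in simp)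
          then have "\<forall>\<^sub>F m in sequentially. 0 = (A j x * indicator (Z m) x)\<^sup>2"
          proof eventually_elim
            case (elim m)
            then have "x \<notin> Z m" by (auto simp: Z_def tube_def d_def divide_inverse)
            then show ?case by simp
          qed
          then show ?case by (rule Lim_transform_eventually[OF tendsto_const])
        qed
        show "AE x in lebesgue_on U. norm ((A j x * indicator (Z m) x)\<^sup>2) \<le> (A j x)\<^sup>2" for m
          by (intro AE_I2) (auto simp: indicator_def)
      qed simp
      then show ?thesis by (simp add: S_def[abs_def] intg_def)
    qed
    have "(\<lambda>m. sqrt (S m) * sqrt (D\<^sup>2 * C)) \<longlonglongrightarrow> sqrt 0 * sqrt (D\<^sup>2 * C)"
      by (intro tendsto_mult tendsto_const tendsto_real_sqrt S0)
    then have l: "(\<lambda>m. sqrt (S m) * sqrt (D\<^sup>2 * C)) \<longlonglongrightarrow> 0" by simp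
    show ?thesis
      by (rule Lim_null_comparison[OF _ l])
         (use G in \<open>auto intro!: eventually_mono[OF eventually_gt_at_top[of 0]]\<close>)
  qed
  have "(\<lambda>m. intg U (\<lambda>x. F x * \<rho> m x) + (\<Sum>j\<in>UNIV. G m j)) \<longlonglongrightarrow> intg U F + (\<Sum>j\<in>(UNIV::'n set). 0)"
    by (intro tendsto_add tendsto_sum lim1 lim2)
  then have "intg U F = 0" using LIMSEQ_unique[OF _ tendsto_const] by (simp add: split)
  then show ?thesis by (simp add: B_def F_def)
qed

definition plane2_of :: "(real^'n::finite) \<times> (real^'n) \<times> real \<times> real \<Rightarrow> (real^'n) set" where
  "plane2_of = (\<lambda>(a, c, \<alpha>, \<beta>). plane2 a c \<alpha> \<beta>)"

text \<open>Planes are discarded one at a time. \<open>plane2_removable\<close> asks only for test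
  functions supported within \<open>tsupp f\<close>, so those avoiding the remaining planes keep
  avoiding them while the new plane is treated.\<close>

lemma planes_removable:
  fixes A :: "'n::finite \<Rightarrow> real^'n \<Rightarrow> real"
  assumes U: "open U" "bounded U" and A: "\<And>j. L2 U (A j)" and b: "L2 U b"
    and "finite P" and on: "\<And>a c \<alpha> \<beta>. (a, c, \<alpha>, \<beta>) \<in> P \<Longrightarrow> norm a = 1 \<and> norm c = 1 \<and> a \<bullet> c = 0"
    and van: "\<And>g. test_fun (U - (\<Union>p\<in>P. plane2_of p)) g \<Longrightarrow>
       intg U (\<lambda>x. (\<Sum>j\<in>UNIV. A j x * pd [j] g x) + b x * g x) = 0"
    and f: "test_fun U f"
  shows "intg U (\<lambda>x. (\<Sum>j\<in>UNIV. A j x * pd [j] f x) + b x * f x) = 0"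
  using \<open>finite P\<close> on van f
proof (induction P arbitrary: f rule: finite_induct)
  case empty
  then show ?case by simp
next
  case (insert p P)
  obtain a c \<alpha> \<beta> where p: "p = (a, c, \<alpha>, \<beta>)" by (cases p)
  have on: "norm a = 1" "norm c = 1" "a \<bullet> c = 0" using insert.prems(1) p by auto
  show ?case
  proof (rule insert.IH)
    show "norm a = 1 \<and> norm c = 1 \<and> a \<bullet> c = 0" if "(a, c, \<alpha>, \<beta>) \<in> P" for a c \<alpha> \<beta>
      using insert.prems(1) that by blast
    show "test_fun U f" by fact
    fix g assume g: "test_fun (U - (\<Union>p\<in>P. plane2_of p)) g"
    show "intg U (\<lambda>x. (\<Sum>j\<in>UNIV. A j x * pd [j] g x) + b x * g x) = 0"
    proof (rule plane2_removable[OF U A b on])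
      show "test_fun U g" using g test_fun_mono by blast
      fix h assume h: "test_fun U h" "tsupp h \<subseteq> tsupp g - plane2 a c \<alpha> \<beta>"
      have "test_fun (U - (\<Union>p\<in>insert p P. plane2_of p)) h"
        using h g by (auto simp: test_fun_def p plane2_of_def)
      then show "intg U (\<lambda>x. (\<Sum>j\<in>UNIV. A j x * pd [j] h x) + b x * h x) = 0"
        by (rule insert.prems(2))
    qed
  qed
qed

section \<open>Local geometry of the triangulation\<close>

lemma full_simplex:
  fixes T :: "(real^'n::finite) set"
  assumes "(int CARD('n)) simplex T"
  shows "convex T" "compact T" "closed T" "polytope T" "polyhedron T" "aff_dim T = int CARD('n)"
    "affine hull T = UNIV" "interior T \<noteq> {}" "rel_interior T = interior T" "rel_frontier T = frontier T"
    "closure (interior T) = T" "bounded T"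
proof -
  show c: "convex T" and "compact T" and cl: "closed T" and "polytope T" and "polyhedron T" and ad: "aff_dim T = int CARD('n)"
    using assms convex_simplex compact_simplex closed_simplex simplex_imp_polytope simplex_imp_polyhedron aff_dim_simplex
    by blast+
  then show b: "bounded T" using compact_imp_bounded by blast
  show a: "affine hull T = UNIV" using ad by (simp add: aff_dim_eq_full[symmetric])
  show r: "rel_interior T = interior T" "rel_frontier T = frontier T"
    using a rel_interior_interior rel_frontier_frontier by blast+
  have "T \<noteq> {}" using ad by auto
  then show i: "interior T \<noteq> {}" using r(1) rel_interior_eq_empty[OF c] by simp
  show "closure (interior T) = T" using convex_closure_interior[OF c i] cl by simp
qed

lemma triangulation_simplex:
  "simplicial_triangulation \<T> \<Omega> \<Longrightarrow> T \<in> \<T> \<Longrightarrow> (int CARD('n)) simplex (T :: (real^'n::finite) set)"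
  by (simp add: simplicial_triangulation_def)

text \<open>A face that meets the interior of T1 is all of T1. So T1 would be a proper face of T2,
  of the same dimension.\<close>

lemma interior_point_unique:
  fixes T1 :: "(real^'n::finite) set"
  assumes tri: "simplicial_triangulation \<T> \<Omega>" "T1 \<in> \<T>" "T2 \<in> \<T>" and x: "x \<in> interior T1" "x \<in> T2"
  shows "T1 = T2"
proof (rule ccontr)
  assume ne: "T1 \<noteq> T2"
  note f1 = full_simplex[OF triangulation_simplex[OF tri(1,2)]] and f2 = full_simplex[OF triangulation_simplex[OF tri(1,3)]]
  have face: "T1 \<inter> T2 face_of T1" "T1 \<inter> T2 face_of T2" using tri by (auto simp: simplicial_triangulation_def)
  have "T1 \<inter> T2 = T1"
    using face_of_disjoint_rel_interior[OF face(1)] x interior_subset f1(9) by blast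
  then have "T1 face_of T2" using face(2) by simp
  then have "aff_dim T1 < aff_dim T2" using face_of_aff_dim_lt f2(1) ne by blast
  then show False using f1(6) f2(6) by simp
qed

text \<open>Facets of a polyhedron are exposed, and the normalised vector of an exposing hyperplane
  is a witness for the choice. A zero vector would expose only T itself or the empty set.\<close>

lemma outer_normal_props:
  fixes T :: "(real^'n::finite) set"
  assumes T: "(int CARD('n)) simplex T" and F: "F facet_of T"
  shows "norm (outer_normal T F) = 1" "\<And>x y. x \<in> F \<Longrightarrow> y \<in> T \<Longrightarrow> outer_normal T F \<bullet> (y - x) \<le> 0"
proof -
  note f = full_simplex[OF T]
  have Fp: "F face_of T" "F \<noteq> {}" "F \<noteq> T" using F by (auto simp: facet_of_def)
  then have "F exposed_face_of T" using f exposed_face_of_polyhedron by blast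
  then obtain a b where ab: "T \<subseteq> {x. a \<bullet> x \<le> b}" "F = T \<inter> {x. a \<bullet> x = b}"
    unfolding exposed_face_of_def by blast
  have "a \<noteq> 0"
  proof
    assume "a = 0"
    then show False using ab(2) Fp by (cases "b = 0") auto
  qed
  then have "norm ((1 / norm a) *\<^sub>R a) = 1" by simp
  moreover have "((1 / norm a) *\<^sub>R a) \<bullet> (y - x) \<le> 0" if "x \<in> F" "y \<in> T" for x y
  proof -
    have "a \<bullet> (y - x) \<le> 0" using ab that by (auto simp: inner_diff_right)
    then have "(1 / norm a) * (a \<bullet> (y - x)) \<le> 0" by (intro mult_nonneg_nonpos) auto
    then show ?thesis by simp
  qed
  ultimately have "\<exists>n. norm n = 1 \<and> (\<forall>x\<in>F. \<forall>y\<in>T. n \<bullet> (y - x) \<le> 0)" by blast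
  then have "norm (outer_normal T F) = 1 \<and> (\<forall>x\<in>F. \<forall>y\<in>T. outer_normal T F \<bullet> (y - x) \<le> 0)"
    unfolding outer_normal_def by (rule someI_ex)
  then show "norm (outer_normal T F) = 1" "\<And>x y. x \<in> F \<Longrightarrow> y \<in> T \<Longrightarrow> outer_normal T F \<bullet> (y - x) \<le> 0" by auto
qed

text \<open>Applying the inequality for the normal to two points of F in both orders puts F in the
  hyperplane; equal dimensions turn the inclusion of affine spaces into an equality.\<close>

lemma facet_hyperplane:
  fixes T :: "(real^'n::finite) set"
  assumes T: "(int CARD('n)) simplex T" and F: "F facet_of T" and x: "x \<in> F"
  shows "affine hull F = {y. outer_normal T F \<bullet> (y - x) = 0}"
proof -
  define n where "n = outer_normal T F"
  note n = outer_normal_props[OF T F, folded n_def]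
  have FT: "F \<subseteq> T" using F by (rule facet_of_imp_subset)
  have "n \<bullet> (y - x) = 0" if "y \<in> F" for y
  proof -
    have "n \<bullet> (y - x) \<le> 0" "n \<bullet> (x - y) \<le> 0" using n(2) that x FT by blast+
    then show ?thesis by (simp add: inner_diff_right)
  qed
  then have "F \<subseteq> {y. n \<bullet> y = n \<bullet> x}" by (auto simp: inner_diff_right)
  then have sub: "affine hull F \<subseteq> {y. n \<bullet> y = n \<bullet> x}" by (intro hull_minimal affine_hyperplane)
  have "n \<noteq> 0" using n(1) by auto
  have "affine hull F = {y. n \<bullet> y = n \<bullet> x}"
  proof (rule affine_dim_equal[OF affine_affine_hull affine_hyperplane _ sub])
    show "affine hull F \<noteq> {}" using x by auto
    have "aff_dim F = int CARD('n) - 1" using F full_simplex(6)[OF T] by (simp add: facet_of_def)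
    then show "aff_dim (affine hull F) = aff_dim {y. n \<bullet> y = n \<bullet> x}"
      using \<open>n \<noteq> 0\<close> by (simp add: aff_dim_affine_hull)
  qed
  then show ?thesis by (auto simp: n_def inner_diff_right)
qed

text \<open>Inside the ball T looks like a half-ball: its boundary there belongs to a single open
  facet, and the inner side of the facet hyperplane lies in T. That the interior of T stays on the
  inner side follows from the outer normal and is not recorded.\<close>

definition flat_boundary :: "(real^'n::finite) set \<Rightarrow> (real^'n) set \<Rightarrow> real^'n \<Rightarrow> real \<Rightarrow> bool" where
  "flat_boundary T F x r \<longleftrightarrow> F facet_of T \<and> x \<in> rel_interior F \<and> ball x r \<inter> frontier T \<subseteq> rel_interior F \<and>
     (\<forall>y\<in>ball x r. outer_normal T F \<bullet> (y - x) < 0 \<longrightarrow> y \<in> interior T)"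

lemma flat_boundary_mono: "flat_boundary T F x r \<Longrightarrow> s \<le> r \<Longrightarrow> flat_boundary T F x s"
  using subset_ball[of s r x] unfolding flat_boundary_def by auto

text \<open>A boundary point outside all faces of codimension at least two is in the relative
  interior of exactly one facet, as two distinct facets meet in a face of smaller dimension.\<close>

lemma exists_flat_boundary:
  fixes T :: "(real^'n::finite) set"
  assumes T: "(int CARD('n)) simplex T" and x: "x \<in> frontier T"
    and low: "\<And>G. G face_of T \<Longrightarrow> aff_dim G \<le> int CARD('n) - 2 \<Longrightarrow> x \<notin> G"
  shows "\<exists>F. \<exists>r>0. flat_boundary T F x r"
proof -
  note f = full_simplex[OF T]
  have fr: "frontier T = \<Union> {F. F facet_of T}" using f rel_frontier_of_polyhedron by metis
  then obtain F where F: "F facet_of T" "x \<in> F" using x by auto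
  have Ff: "F face_of T" using F facet_of_imp_face_of by blast
  have adF: "aff_dim F = int CARD('n) - 1" using F f(6) by (simp add: facet_of_def)
  have Fpoly: "polyhedron F" using face_of_polyhedron_polyhedron f(5) Ff by blast
  have cF: "convex F" using face_of_imp_convex Ff by blast
  have xr: "x \<in> rel_interior F"
  proof (rule ccontr)
    assume "x \<notin> rel_interior F"
    then have "x \<in> rel_frontier F" using F(2) closure_subset by (auto simp: rel_frontier_def)
    then obtain G where G: "G facet_of F" "x \<in> G" using rel_frontier_of_polyhedron[OF Fpoly] by auto
    then have "G face_of T" using Ff face_of_trans facet_of_imp_face_of by blast
    moreover have "aff_dim G \<le> int CARD('n) - 2" using G(1) adF by (simp add: facet_of_def)
    ultimately show False using low G by blast
  qed
  have other: "x \<notin> F'" if F': "F' facet_of T" "F' \<noteq> F" for F'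
  proof
    assume "x \<in> F'"
    have F'f: "F' face_of T" "aff_dim F' = int CARD('n) - 1" using F'(1) f(6) by (auto simp: facet_of_def)
    have I: "F \<inter> F' face_of T" using Ff F'f face_of_Int by blast
    then have IF: "F \<inter> F' face_of F" by (rule face_of_subset) (use face_of_imp_subset[OF Ff] in auto)
    have "F \<inter> F' \<noteq> F"
    proof
      assume "F \<inter> F' = F"
      then have "F \<subseteq> F'" by auto
      then have "F face_of F'" using Ff face_of_subset face_of_imp_subset[OF F'f(1)] by blast
      then have "aff_dim F < aff_dim F'" using face_of_aff_dim_lt face_of_imp_convex[OF F'f(1)] F'(2) by blast
      then show False using adF F'f by simp
    qed
    then have "aff_dim (F \<inter> F') < aff_dim F" using face_of_aff_dim_lt[OF cF IF] by blast
    then show False using low[OF I] adF \<open>x \<in> F'\<close> F(2) by auto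
  qed
  define C where "C = \<Union> {F'. F' facet_of T \<and> F' \<noteq> F}"
  have "finite {F'. F' facet_of T \<and> F' \<noteq> F}" using finite_polytope_facets[OF f(4)] by (rule finite_subset[rotated]) auto
  moreover have "closed F'" if "F' facet_of T" for F'
    using that f face_of_polyhedron_polyhedron polyhedron_imp_closed facet_of_imp_face_of by blast
  ultimately have "closed C" unfolding C_def by (intro closed_Union) auto
  moreover have "x \<notin> C" using other by (auto simp: C_def)
  ultimately obtain r1 where r1: "r1 > 0" "ball x r1 \<inter> C = {}"
    by (metis Compl_iff disjoint_eq_subset_Compl open_Compl openE)
  obtain r2 where r2: "r2 > 0" "ball x r2 \<inter> affine hull F \<subseteq> F" using xr mem_rel_interior_ball by blast
  have r2': "ball x r2 \<inter> F \<subseteq> rel_interior F"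
    using r2 unfolding mem_rel_interior[symmetric] by (auto simp: mem_rel_interior intro!: exI[of _ "ball x r2"])
  define r where "r = min r1 r2"
  have r: "r > 0" using r1 r2 by (simp add: r_def)
  have ri: "ball x r \<inter> frontier T \<subseteq> rel_interior F"
  proof
    fix y assume y: "y \<in> ball x r \<inter> frontier T"
    then have "y \<notin> C" using r1 by (auto simp: r_def)
    then have "y \<in> F" using y fr by (auto simp: C_def)
    then show "y \<in> rel_interior F" using y r2' by (auto simp: r_def)
  qed
  define n where "n = outer_normal T F"
  note n = outer_normal_props[OF T F(1), folded n_def]
  \<comment> \<open>The open half-ball is connected, misses the frontier and contains interior
    points of T, since T is the closure of its interior; so it lies in T.\<close>
  define W where "W = ball x r \<inter> {y. n \<bullet> y < n \<bullet> x}"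
  have "convex W" unfolding W_def by (intro convex_Int convex_ball convex_halfspace_lt)
  then have "connected W" by (rule convex_connected)
  have Wf: "W \<inter> frontier T = {}"
  proof -
    have "n \<bullet> (y - x) = 0" if "y \<in> F" for y
      using facet_hyperplane[OF T F] hull_inc[OF that, of affine] by (simp add: n_def)
    then have "n \<bullet> y = n \<bullet> x" if "y \<in> F" for y using that by (simp add: inner_diff_right)
    then show ?thesis using ri rel_interior_subset[of F] by (force simp: W_def)
  qed
  have "W \<inter> interior T \<noteq> {}"
  proof -
    have "x \<in> closure (interior T)" using f(11) F facet_of_imp_subset by blast
    then obtain z where z: "z \<in> interior T" "z \<in> ball x r"
      using r closure_approachable[of x "interior T"] by (metis dist_commute mem_ball)
    have "T \<subseteq> {y. n \<bullet> y \<le> n \<bullet> x}" using n(2)[OF F(2)] by (auto simp: inner_diff_right)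
    then have "interior T \<subseteq> interior {y. n \<bullet> y \<le> n \<bullet> x}" by (rule interior_mono)
    moreover have "n \<noteq> 0" using n(1) by auto
    ultimately have "n \<bullet> z < n \<bullet> x" using z by auto
    then show ?thesis using z by (auto simp: W_def)
  qed
  then have "W \<inter> T \<noteq> {}" using interior_subset by blast
  then have "W \<subseteq> T" using connected_Int_frontier[OF \<open>connected W\<close>] Wf by blast
  then have "W \<subseteq> interior T" using Wf f(3) by (auto simp: frontier_def)
  then have "\<forall>y\<in>ball x r. outer_normal T F \<bullet> (y - x) < 0 \<longrightarrow> y \<in> interior T"
    by (auto simp: W_def n_def inner_diff_right)
  then have "flat_boundary T F x r" unfolding flat_boundary_def using F xr ri by blast
  then show ?thesis using r by blast
qed

text \<open>The property is required for all smaller radii as well, so that the minimum over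
  finitely many elements works.\<close>

lemma finite_common_radius:
  assumes "finite I" "\<And>i. i \<in> I \<Longrightarrow> \<exists>r>0. \<forall>s>0. s \<le> r \<longrightarrow> P i s"
  shows "\<exists>r>0::real. \<forall>i\<in>I. \<forall>s>0. s \<le> r \<longrightarrow> P i s"
  using assms
proof (induction I rule: finite_induct)
  case empty
  then show ?case by (intro exI[of _ 1]) auto
next
  case (insert i I)
  obtain r where "r > 0" "\<forall>i\<in>I. \<forall>s>0. s \<le> r \<longrightarrow> P i s" using insert by blast
  moreover obtain r' where "r' > 0" "\<forall>s>0. s \<le> r' \<longrightarrow> P i s" using insert by blast
  ultimately show ?case by (intro exI[of _ "min r r'"]) auto
qed

text \<open>One facet splits the ball between two elements. Opposite normals are recorded because
  \<open>outer_normal\<close> is chosen separately for each element.\<close>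

definition interface :: "(real^'n::finite) set set \<Rightarrow> real^'n \<Rightarrow> real \<Rightarrow> (real^'n) set \<Rightarrow> (real^'n) set \<Rightarrow> bool" where
  "interface \<T> x r T1 T2 \<longleftrightarrow> T1 \<in> \<T> \<and> T2 \<in> \<T> \<and> T1 \<noteq> T2 \<and>
     flat_boundary T1 (T1 \<inter> T2) x r \<and> flat_boundary T2 (T1 \<inter> T2) x r \<and>
     outer_normal T2 (T1 \<inter> T2) = - outer_normal T1 (T1 \<inter> T2) \<and>
     (\<forall>T\<in>\<T>. T \<noteq> T1 \<and> T \<noteq> T2 \<longrightarrow> ball x r \<inter> interior T = {})"

lemma local_structure:
  fixes \<Omega> :: "(real^'n::finite) set"
  assumes tri: "simplicial_triangulation \<T> \<Omega>" and \<Omega>: "open \<Omega>" "x \<in> \<Omega>"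
    and low: "\<And>T G. T \<in> \<T> \<Longrightarrow> G face_of T \<Longrightarrow> aff_dim G \<le> int CARD('n) - 2 \<Longrightarrow> x \<notin> G"
  shows "\<exists>r>0. (\<exists>T\<in>\<T>. ball x r \<subseteq> interior T) \<or> (\<exists>T1 T2. interface \<T> x r T1 T2)"
proof (cases "\<exists>T\<in>\<T>. x \<in> interior T")
  case True
  then show ?thesis by (meson open_contains_ball open_interior)
next
  case False
  note simp = triangulation_simplex[OF tri]
  note full = full_simplex[OF simp]
  have fin: "finite \<T>" and cover: "\<Union>\<T> = closure \<Omega>" using tri by (auto simp: simplicial_triangulation_def)
  have frT: "x \<in> frontier T" if "T \<in> \<T>" "x \<in> T" for T
    using False that closure_subset[of T] by (auto simp: frontier_def)
  define P where "P T r \<longleftrightarrow> (x \<notin> T \<longrightarrow> ball x r \<inter> T = {}) \<and> (x \<in> T \<longrightarrow> (\<exists>F. flat_boundary T F x r))" for T r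
  have Pr: "\<exists>r>0. \<forall>s>0. s \<le> r \<longrightarrow> P T s" if T: "T \<in> \<T>" for T
  proof (cases "x \<in> T")
    case True
    have "\<exists>F. \<exists>r>0. flat_boundary T F x r"
      by (rule exists_flat_boundary[OF simp[OF T] frT[OF T True] low[OF T]])
    then obtain F r where "r > 0" "flat_boundary T F x r" by blast
    then show ?thesis using True flat_boundary_mono unfolding P_def by blast
  next
    case F: False
    then have "x \<in> - T" "open (- T)" using full(3)[OF T] by auto
    then obtain r where "r > 0" "ball x r \<subseteq> - T" by (meson openE)
    then have "P T s" if "s \<le> r" for s using F that subset_ball[of s r x] unfolding P_def by blast
    then show ?thesis using \<open>r > 0\<close> by blast
  qed
  have "\<exists>r>0. \<forall>T\<in>\<T>. \<forall>s>0. s \<le> r \<longrightarrow> P T s" by (rule finite_common_radius[OF fin Pr])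
  then obtain r0 where r0: "r0 > 0" "\<And>T s. T \<in> \<T> \<Longrightarrow> s > 0 \<Longrightarrow> s \<le> r0 \<Longrightarrow> P T s" by blast
  obtain r1 where r1: "r1 > 0" "ball x r1 \<subseteq> \<Omega>" using \<Omega> by (meson openE)
  define r where "r = min r0 r1"
  have r: "r > 0" "ball x r \<subseteq> \<Omega>" "\<And>T. T \<in> \<T> \<Longrightarrow> P T r"
    using r0 r1 by (auto simp: r_def)
  have "x \<in> \<Union>\<T>" using cover \<Omega>(2) closure_subset[of \<Omega>] by auto
  then obtain T1 where T1: "T1 \<in> \<T>" "x \<in> T1" by blast
  then obtain F1 where F1: "flat_boundary T1 F1 x r" using r(3) by (auto simp: P_def)
  define n where "n = outer_normal T1 F1"
  have fac1: "F1 facet_of T1" "x \<in> rel_interior F1" "x \<in> F1"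
    using F1 rel_interior_subset by (auto simp: flat_boundary_def)
  note n = outer_normal_props[OF simp[OF T1(1)] fac1(1), folded n_def]
  have nn: "n \<bullet> n = 1" using n(1) by (simp add: norm_eq_1)
  \<comment> \<open>A point slightly outside T1 along the normal is still in \<Omega>, hence in some
    element. The radius is small enough that every element meeting the ball contains x.\<close>
  define z where "z = x + (r / 2) *\<^sub>R n"
  have zb: "z \<in> ball x r" using r n(1) by (simp add: z_def dist_norm)
  then have "z \<in> \<Union>\<T>" using r(2) cover closure_subset[of \<Omega>] by auto
  then obtain T2 where T2: "T2 \<in> \<T>" "z \<in> T2" by blast
  have "z \<notin> T1"
  proof
    assume "z \<in> T1"
    then have "n \<bullet> (z - x) \<le> 0" using n(2) fac1(3) by blast
    then show False using r nn by (simp add: z_def)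
  qed
  then have ne: "T1 \<noteq> T2" using T2 by auto
  have xT2: "x \<in> T2" using r(3)[OF T2(1)] zb T2(2) by (auto simp: P_def)
  then obtain F2 where F2: "flat_boundary T2 F2 x r" using r(3)[OF T2(1)] by (auto simp: P_def)
  have fac2: "F2 facet_of T2" "x \<in> rel_interior F2" "x \<in> F2"
    using F2 rel_interior_subset by (auto simp: flat_boundary_def)
  \<comment> \<open>A face containing a point of the relative interior of F contains F. The
    dimension of the common face is below that of S and at least that of F, so it coincides with
    F.\<close>
  have common: "S \<inter> S' = F" if S: "S \<in> \<T>" "S' \<in> \<T>" "S \<noteq> S'" "x \<in> S" "x \<in> S'" "F facet_of S" "x \<in> rel_interior F" for S S' F
  proof -
    have G: "S \<inter> S' face_of S" "S \<inter> S' face_of S'" using tri S by (auto simp: simplicial_triangulation_def)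
    have Ff: "F face_of S" "aff_dim F = int CARD('n) - 1" using S(6) full(6)[OF S(1)] by (auto simp: facet_of_def)
    have FG: "F \<subseteq> S \<inter> S'" using subset_of_face_of[OF G(1) face_of_imp_subset[OF Ff(1)]] S by blast
    have "S \<inter> S' \<noteq> S"
    proof
      assume "S \<inter> S' = S"
      then have "S face_of S'" using G(2) by simp
      then have "aff_dim S < aff_dim S'" using face_of_aff_dim_lt full(1)[OF S(2)] S(3) by blast
      then show False using full(6)[OF S(1)] full(6)[OF S(2)] by simp
    qed
    then have "aff_dim (S \<inter> S') < int CARD('n)"
      using face_of_aff_dim_lt[OF full(1)[OF S(1)] G(1)] full(6)[OF S(1)] by simp
    moreover have "F face_of S \<inter> S'" using face_of_subset[OF Ff(1) FG] by blast
    then have "F \<noteq> S \<inter> S' \<Longrightarrow> aff_dim F < aff_dim (S \<inter> S')"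
      using face_of_aff_dim_lt face_of_imp_convex[OF G(1)] by blast
    ultimately show ?thesis using Ff(2) by force
  qed
  have F1eq: "T1 \<inter> T2 = F1" using common T1 T2 ne xT2 fac1 by blast
  have F2eq: "T1 \<inter> T2 = F2" using common[of T2 T1 F2] T1 T2 ne xT2 fac2 by blast
  define n2 where "n2 = outer_normal T2 F2"
  note n2 = outer_normal_props[OF simp[OF T2(1)] fac2(1), folded n2_def]
  \<comment> \<open>Both normals are orthogonal to the same hyperplane, so they agree up to sign.
    Equal signs would place the point x - (r/2) n in the interiors of both elements.\<close>
  have n2n: "n2 = - n"
  proof -
    define c where "c = n2 \<bullet> n"
    define v where "v = n2 - c *\<^sub>R n"
    have nv: "n \<bullet> v = 0" using nn by (simp add: v_def c_def inner_diff_right inner_commute)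
    then have "x + v \<in> affine hull F1" using facet_hyperplane[OF simp[OF T1(1)] fac1(1,3)] by (simp add: n_def)
    then have "n2 \<bullet> v = 0"
      using facet_hyperplane[OF simp[OF T2(1)] fac2(1,3)] F1eq F2eq by (simp add: n2_def)
    then have "v \<bullet> v = 0" using nv by (simp add: v_def inner_diff_left)
    then have n2c: "n2 = c *\<^sub>R n" by (simp add: v_def)
    then have "\<bar>c\<bar> = 1" using n(1) n2(1) by simp
    moreover have "c \<noteq> 1"
    proof
      assume "c = 1"
      define y where "y = x - (r / 2) *\<^sub>R n"
      have "y \<in> ball x r" using r n(1) by (simp add: y_def dist_norm)
      moreover have "n \<bullet> (y - x) < 0" using nn r by (simp add: y_def)
      ultimately have "y \<in> interior T1" "y \<in> interior T2"
        using F1 F2 n2c \<open>c = 1\<close> by (auto simp: flat_boundary_def n_def n2_def)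
      then show False using interior_point_unique[OF tri T1(1) T2(1)] interior_subset ne by blast
    qed
    ultimately have "c = -1" by linarith
    then show ?thesis using n2c by simp
  qed
  have "ball x r \<inter> interior T = {}" if T: "T \<in> \<T>" "T \<noteq> T1" "T \<noteq> T2" for T
  proof (rule ccontr)
    assume "ball x r \<inter> interior T \<noteq> {}"
    then obtain y where y: "y \<in> ball x r \<inter> interior T" by blast
    \<comment> \<open>On either side of the hyperplane the ball is filled by T1 or T2, so a third
      interior could meet it only within the hyperplane, which contains no nonempty open
      set.\<close>
    have off: "n \<bullet> (y' - x) = 0" if "y' \<in> ball x r \<inter> interior T" for y'
    proof (rule ccontr)
      assume "n \<bullet> (y' - x) \<noteq> 0"
      then consider "n \<bullet> (y' - x) < 0" | "n2 \<bullet> (y' - x) < 0" using n2n by fastforce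
      then have "y' \<in> interior T1 \<or> y' \<in> interior T2"
        using that F1 F2 by cases (auto simp: flat_boundary_def n_def n2_def)
      then show False
        using interior_point_unique[OF tri T(1) T1(1)] interior_point_unique[OF tri T(1) T2(1)] that T interior_subset by blast
    qed
    have "open (ball x r \<inter> interior T)" by (intro open_Int open_ball open_interior)
    then obtain e where e: "e > 0" "ball y e \<subseteq> ball x r \<inter> interior T" using y by (meson openE)
    have "y + (e / 2) *\<^sub>R n \<in> ball y e" using e n(1) by (simp add: dist_norm)
    then have "n \<bullet> (y + (e / 2) *\<^sub>R n - x) = 0" "n \<bullet> (y - x) = 0" using e off y by blast+
    then show False using nn e by (simp add: inner_diff_right inner_add_right)
  qed
  then have "interface \<T> x r T1 T2"
    unfolding interface_def using T1 T2 ne F1 F2 n2n F1eq F2eq by (auto simp: n_def n2_def)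
  then show ?thesis using r(1) by blast
qed

text \<open>The directions of G span at most \<open>CARD('n) - 2\<close> dimensions. A first normal
  is orthogonal to them, and adding it to the spanning set still leaves room for a second one
  orthogonal to both.\<close>

lemma low_dim_subset_plane2:
  fixes G :: "(real^'n::finite) set"
  assumes "G \<noteq> {}" "aff_dim G \<le> int CARD('n) - 2"
  shows "\<exists>a c \<alpha> \<beta>. norm a = 1 \<and> norm c = 1 \<and> a \<bullet> c = 0 \<and> G \<subseteq> plane2 a c \<alpha> \<beta>"
proof -
  obtain x where x: "x \<in> G" using assms by blast
  define S where "S = (+) (- x) ` G"
  have dS: "int (dim S) \<le> int CARD('n) - 2"
    using aff_dim_eq_dim[of x G] x assms(2) by (simp add: S_def hull_inc)
  then have "dim S < DIM(real^'n)" by simp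
  then obtain a where a: "a \<noteq> 0" "\<And>y. y \<in> span S \<Longrightarrow> orthogonal a y" using orthogonal_to_subspace_exists by blast
  have "dim (insert a S) < DIM(real^'n)" using dS by (simp add: dim_insert)
  then obtain c where c: "c \<noteq> 0" "\<And>y. y \<in> span (insert a S) \<Longrightarrow> orthogonal c y" using orthogonal_to_subspace_exists by blast
  define a' where "a' = (1 / norm a) *\<^sub>R a"
  define c' where "c' = (1 / norm c) *\<^sub>R c"
  have "norm a' = 1" "norm c' = 1" using a c by (auto simp: a'_def c'_def)
  moreover have "a' \<bullet> c' = 0"
    using c(2)[of a] by (simp add: span_base orthogonal_def a'_def c'_def inner_commute)
  moreover have "G \<subseteq> plane2 a' c' (a' \<bullet> x) (c' \<bullet> x)"
  proof
    fix y assume "y \<in> G"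
    then have "y - x \<in> S" by (auto simp: S_def image_iff intro!: bexI[of _ y])
    then have "y - x \<in> span S" "y - x \<in> span (insert a S)" by (auto intro: span_base)
    then have "a \<bullet> (y - x) = 0" "c \<bullet> (y - x) = 0" using a(2) c(2) by (auto simp: orthogonal_def)
    then show "y \<in> plane2 a' c' (a' \<bullet> x) (c' \<bullet> x)"
      by (auto simp: plane2_def a'_def c'_def inner_diff_right)
  qed
  ultimately show ?thesis by blast
qed

text \<open>One plane is chosen for each nonempty low-dimensional face. The planes may cut through
  open elements, which is harmless: they are removed from all of \<Omega>, not only from the
  skeleton.\<close>

lemma exists_low_face_planes:
  fixes \<Omega> :: "(real^'n::finite) set"
  assumes tri: "simplicial_triangulation \<T> \<Omega>"
  shows "\<exists>P. finite P \<and> (\<forall>a c \<alpha> \<beta>. (a, c, \<alpha>, \<beta>) \<in> P \<longrightarrow> norm a = 1 \<and> norm c = 1 \<and> a \<bullet> c = 0) \<and>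
     (\<forall>T\<in>\<T>. \<forall>G. G face_of T \<and> aff_dim G \<le> int CARD('n) - 2 \<longrightarrow> G \<subseteq> (\<Union>p\<in>P. plane2_of p))"
proof -
  define \<G> where "\<G> = {G. G \<noteq> {} \<and> (\<exists>T\<in>\<T>. G face_of T) \<and> aff_dim G \<le> int CARD('n) - 2}"
  have "finite {G. G face_of T}" if "T \<in> \<T>" for T
    using finite_polytope_faces full_simplex(4)[OF triangulation_simplex[OF tri that]] by blast
  then have "finite (\<Union>T\<in>\<T>. {G. G face_of T})" using tri by (auto simp: simplicial_triangulation_def)
  then have fin: "finite \<G>" by (rule finite_subset[rotated]) (auto simp: \<G>_def)
  define Q where "Q p G \<longleftrightarrow> (\<forall>a c \<alpha> \<beta>. p = (a, c, \<alpha>, \<beta>) \<longrightarrow> norm a = 1 \<and> norm c = 1 \<and> a \<bullet> c = 0) \<and> G \<subseteq> plane2_of p"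
    for p :: "(real^'n) \<times> (real^'n) \<times> real \<times> real" and G
  have "\<exists>p. Q p G" if "G \<in> \<G>" for G
  proof -
    have "G \<noteq> {}" "aff_dim G \<le> int CARD('n) - 2" using that by (auto simp: \<G>_def)
    from low_dim_subset_plane2[OF this]
    obtain a c \<alpha> \<beta> where "norm a = 1 \<and> norm c = 1 \<and> a \<bullet> c = 0 \<and> G \<subseteq> plane2 a c \<alpha> \<beta>" by blast
    then show ?thesis by (intro exI[of _ "(a, c, \<alpha>, \<beta>)"]) (auto simp: Q_def plane2_of_def)
  qed
  then obtain p where p: "\<And>G. G \<in> \<G> \<Longrightarrow> Q (p G) G" by metis
  have 1: "finite (p ` \<G>)" using fin by blast
  have 2: "\<forall>a c \<alpha> \<beta>. (a, c, \<alpha>, \<beta>) \<in> p ` \<G> \<longrightarrow> norm a = 1 \<and> norm c = 1 \<and> a \<bullet> c = 0"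
  proof (intro allI impI)
    fix a c \<alpha> \<beta> assume "(a, c, \<alpha>, \<beta>) \<in> p ` \<G>"
    then obtain G where "G \<in> \<G>" "p G = (a, c, \<alpha>, \<beta>)" by auto
    then show "norm a = 1 \<and> norm c = 1 \<and> a \<bullet> c = 0" using p[of G] unfolding Q_def by simp
  qed
  have 3: "G \<subseteq> (\<Union>q\<in>p ` \<G>. plane2_of q)" if "T \<in> \<T>" "G face_of T" "aff_dim G \<le> int CARD('n) - 2" for T G
  proof (cases "G = {}")
    case False
    then have "G \<in> \<G>" using that by (auto simp: \<G>_def)
    then have "G \<subseteq> plane2_of (p G)" using p[of G] by (simp add: Q_def)
    then show ?thesis using \<open>G \<in> \<G>\<close> by blast
  qed simp
  have 4: "\<forall>T\<in>\<T>. \<forall>G. G face_of T \<and> aff_dim G \<le> int CARD('n) - 2 \<longrightarrow> G \<subseteq> (\<Union>q\<in>p ` \<G>. plane2_of q)"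
  proof (intro ballI allI impI)
    fix T G assume "T \<in> \<T>" "G face_of T \<and> aff_dim G \<le> int CARD('n) - 2"
    then show "G \<subseteq> (\<Union>q\<in>p ` \<G>. plane2_of q)" using 3[of T G] by simp
  qed
  show ?thesis by (rule exI[of _ "p ` \<G>"], intro conjI) (rule 1, rule 2, rule 4)
qed

text \<open>The triangulation covers the closure of \<Omega>; this places the open elements in
  \<Omega> itself. Near a boundary point the chart contains an open region above the graph that
  misses \<Omega>, so the point is not interior to the closure.\<close>

lemma lipschitz_domain_interior_closure:
  fixes \<Omega> :: "(real^'n::finite) set"
  assumes "lipschitz_domain \<Omega>"
  shows "interior (closure \<Omega>) \<subseteq> \<Omega>"
proof (rule ccontr)
  assume "\<not> ?thesis"
  then obtain x where x: "x \<in> interior (closure \<Omega>)" "x \<notin> \<Omega>" by blast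
  have op: "open \<Omega>" using assms by (simp add: lipschitz_domain_def)
  then have fx: "x \<in> frontier \<Omega>" using x interior_subset by (auto simp: frontier_def interior_open)
  then obtain Q k g C r where Q: "orthogonal_transformation Q" and r: "r > 0" and g: "C-lipschitz_on UNIV g"
    and gk: "\<And>y::real^'n. g y = g (y - (y $ k) *\<^sub>R axis k 1)"
    and loc: "\<And>y::real^'n. norm y < r \<Longrightarrow> x + Q y \<in> \<Omega> \<longleftrightarrow> y $ k < g y"
    using assms unfolding lipschitz_domain_def by metis
  have lin: "linear Q" and nQ: "\<And>y. norm (Q y) = norm y"
    using Q by (auto simp: orthogonal_transformation)
  have cg: "continuous_on UNIV g" using g by (rule lipschitz_on_continuous_on)
  have "bij Q" using Q orthogonal_transformation_bij by blast
  have g0: "g 0 \<le> 0" using loc[of 0] r x(2) lin by (simp add: linear_0)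
  obtain e where e: "e > 0" "ball x e \<subseteq> closure \<Omega>" using x(1) by (meson open_contains_ball open_interior interior_subset subset_trans)
  \<comment> \<open>The point moves up the chart axis, along which g is constant, from the origin,
    where g 0 \<le> 0 because x is outside \<Omega>. Half of the minimum keeps it in both
    balls.\<close>
  define t where "t = min r e / 2"
  define y where "y = t *\<^sub>R (axis k 1 :: real^'n)"
  have t: "t > 0" "t < r" "t < e" using r e by (auto simp: t_def)
  have "g y = g 0" using gk[of y] by (simp add: y_def)
  then have gy: "g y < y $ k" using g0 t by (simp add: y_def)
  have ny: "norm y < r" using t by (simp add: y_def)
  have "x + Q y \<in> ball x e" using t by (simp add: dist_norm nQ y_def)
  then have cl: "x + Q y \<in> closure \<Omega>" using e by blast
  define V where "V = ball 0 r \<inter> {y. g y < y $ k}"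
  have "open V" unfolding V_def
    by (intro open_Int open_ball open_Collect_less continuous_intros cg)
  then have "open (Q ` V)" by (intro open_surjective_linear_image lin bij_is_surj \<open>bij Q\<close>)
  then have "open ((+) x ` Q ` V)" by (rule open_translation)
  moreover have "x + Q y \<in> (+) x ` Q ` V" using gy ny by (auto simp: V_def)
  moreover have "(+) x ` Q ` V \<inter> \<Omega> = {}" using loc by (force simp: V_def)
  ultimately show False using cl open_Int_closure_eq_empty by blast
qed

section \<open>Boundary fluxes\<close>

lemma compact_tsupp_subset:
  assumes "compact K" "tsupp f \<subseteq> K"
  shows "compact (tsupp f)"
  using compact_Int_closed[OF assms(1) closed_tsupp[of f]] assms(2) by (simp add: inf.absorb2)

lemma H1_lincomb:
  assumes "finite I" "\<And>l. l \<in> I \<Longrightarrow> H1 U (f l)" "bounded U" "U \<in> sets lebesgue"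
  shows "H1 U (\<lambda>x. \<Sum>l\<in>I. c l * f l x)"
    "L2 U (\<lambda>x. \<Sum>l\<in>I. c l * wd U (f l) i x)"
    "weak_deriv U (\<lambda>x. \<Sum>l\<in>I. c l * f l x) i (\<lambda>x. \<Sum>l\<in>I. c l * wd U (f l) i x)"
proof -
  have L: "L2 U (f l)" if "l \<in> I" for l using assms(2)[OF that] by (simp add: H1_def)
  show 1: "L2 U (\<lambda>x. \<Sum>l\<in>I. c l * wd U (f l) i x)" for i
    using assms(2) by (intro L2_sum L2_cmult wd_L2)
  show 2: "weak_deriv U (\<lambda>x. \<Sum>l\<in>I. c l * f l x) i (\<lambda>x. \<Sum>l\<in>I. c l * wd U (f l) i x)" for i
    using assms L by (intro weak_deriv_lincomb wd_L2 wd_weak_deriv)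
  have "L2 U (\<lambda>x. \<Sum>l\<in>I. c l * f l x)" using L by (intro L2_sum L2_cmult)
  then show "H1 U (\<lambda>x. \<Sum>l\<in>I. c l * f l x)" unfolding H1_def using 1 2 by blast
qed

text \<open>Formally the boundary integral of \<open>u \<eta> n\<^sub>j\<close>.\<close>
definition flux :: "(real^'n::finite) set \<Rightarrow> 'n \<Rightarrow> (real^'n \<Rightarrow> real) \<Rightarrow> (real^'n \<Rightarrow> real) \<Rightarrow> real" where
  "flux U j u \<eta> = intg U (\<lambda>x. u x * pd [j] \<eta> x + wd U u j x * \<eta> x)"

lemma flux_integrable:
  assumes "H1 U u" "smooth_fun \<eta>" "open U" "bounded U"
  shows "L2 U (\<lambda>x. u x * pd [j] \<eta> x + wd U u j x * \<eta> x)"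
    "integrable (lebesgue_on U) (\<lambda>x. u x * pd [j] \<eta> x + wd U u j x * \<eta> x)"
proof -
  have "continuous_on UNIV \<eta>" "continuous_on UNIV (pd [j] \<eta>)"
    using assms by (auto intro: smooth_fun_continuous smooth_fun_pd)
  then show L: "L2 U (\<lambda>x. u x * pd [j] \<eta> x + wd U u j x * \<eta> x)"
    using assms by (intro L2_add L2_mult_cont wd_L2) (auto simp: H1_def)
  show "integrable (lebesgue_on U) (\<lambda>x. u x * pd [j] \<eta> x + wd U u j x * \<eta> x)"
    using assms by (intro L2_integrable[OF L]) auto
qed

lemma flux_test_fun:
  assumes "H1 U u" "test_fun U \<eta>" "open U" "bounded U"
  shows "flux U j u \<eta> = 0"
proof -
  have s: "smooth_fun \<eta>" using assms(2) by (rule test_fun_smooth)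
  then have c: "continuous_on UNIV \<eta>" "continuous_on UNIV (pd [j] \<eta>)"
    by (auto intro: smooth_fun_continuous smooth_fun_pd)
  have "flux U j u \<eta> = intg U (\<lambda>x. u x * pd [j] \<eta> x) + intg U (\<lambda>x. wd U u j x * \<eta> x)"
    unfolding flux_def intg_def
    using assms c by (intro Bochner_Integration.integral_add L2_mult_cont_integrable wd_L2) (auto simp: H1_def)
  then show ?thesis using wd_weak_deriv[OF assms(1), of j] assms(2) by (simp add: weak_deriv_def)
qed

text \<open>\<open>wd\<close> of a combination is a separate choice, so linearity passes under the
  integral only through equality almost everywhere.\<close>

lemma flux_lincomb:
  assumes "finite I" "\<And>l. l \<in> I \<Longrightarrow> H1 U (f l)" "open U" "bounded U" "smooth_fun \<eta>"
  shows "flux U j (\<lambda>x. \<Sum>l\<in>I. c l * f l x) \<eta> = (\<Sum>l\<in>I. c l * flux U j (f l) \<eta>)"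
proof -
  have Ul: "U \<in> sets lebesgue" using assms by simp
  note H = H1_lincomb[OF assms(1,2,4) Ul, where c=c]
  have fi: "integrable (lebesgue_on U) (\<lambda>x. c l * (f l x * pd [j] \<eta> x + wd U (f l) j x * \<eta> x))" if "l \<in> I" for l
    using flux_integrable(2) assms that by (intro integrable_mult_right) blast
  have "AE x in lebesgue_on U. wd U (\<lambda>x. \<Sum>l\<in>I. c l * f l x) j x = (\<Sum>l\<in>I. c l * wd U (f l) j x)"
    by (rule wd_AE_eq[OF assms(3,4)]) (use H assms in auto)
  then have "AE x in lebesgue_on U. (\<Sum>l\<in>I. c l * f l x) * pd [j] \<eta> x + wd U (\<lambda>x. \<Sum>l\<in>I. c l * f l x) j x * \<eta> x
     = (\<Sum>l\<in>I. c l * (f l x * pd [j] \<eta> x + wd U (f l) j x * \<eta> x))"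
    by eventually_elim (simp add: sum_distrib_right distrib_left sum.distrib mult.assoc)
  then have "flux U j (\<lambda>x. \<Sum>l\<in>I. c l * f l x) \<eta> = intg U (\<lambda>x. \<Sum>l\<in>I. c l * (f l x * pd [j] \<eta> x + wd U (f l) j x * \<eta> x))"
    unfolding flux_def
    by (rule intg_cong_AE)
       (use flux_integrable[OF H(1) assms(5,3,4)] fi in \<open>auto intro!: borel_measurable_integrable\<close>)
  also have "\<dots> = (\<Sum>l\<in>I. c l * flux U j (f l) \<eta>)"
    unfolding flux_def intg_def using fi by (subst Bochner_Integration.integral_sum) auto
  finally show ?thesis .
qed

lemma flux_diff:
  assumes "H1 U u" "H1 U v" "open U" "bounded U" "smooth_fun \<eta>"
  shows "flux U j (\<lambda>x. u x - v x) \<eta> = flux U j u \<eta> - flux U j v \<eta>" "H1 U (\<lambda>x. u x - v x)"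
proof -
  \<comment> \<open>The difference is a linear combination indexed by the booleans, which reduces it
    to the general rule.\<close>
  let ?c = "\<lambda>b. if b then 1 else (-1)::real" and ?f = "\<lambda>b. if b then u else v"
  have f: "\<And>l. l \<in> UNIV \<Longrightarrow> H1 U (?f l)" using assms by auto
  have eq: "(\<lambda>x. \<Sum>b\<in>UNIV. ?c b * ?f b x) = (\<lambda>x. u x - v x)" by (auto simp: UNIV_bool)
  show "flux U j (\<lambda>x. u x - v x) \<eta> = flux U j u \<eta> - flux U j v \<eta>"
    using flux_lincomb[where I=UNIV and c="?c" and f="?f", OF _ f assms(3-5), of j] unfolding eq by (simp add: UNIV_bool)
  show "H1 U (\<lambda>x. u x - v x)"
    using H1_lincomb(1)[where I=UNIV and c="?c" and f="?f", OF _ f assms(4)] assms(3) unfolding eq by simp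
qed

text \<open>The expression on the left is the one in \<open>trace_zero_on\<close> and
  \<open>trace_eq_across\<close>; tested with \<eta> n it is the normal component of the vector of
  fluxes.\<close>

lemma field_flux_eq:
  assumes "H1 U u" "smooth_fun \<eta>" "open U" "bounded U"
  shows "intg U (\<lambda>x. u x * cdiv (\<lambda>x. \<eta> x *\<^sub>R n) x + (\<Sum>k\<in>UNIV. wd U u k x * (\<eta> x *\<^sub>R n) $ k))
    = (\<Sum>k\<in>UNIV. n $ k * flux U k u \<eta>)"
proof -
  have p: "pd [k] (\<lambda>y. \<eta> y * n $ k) = (\<lambda>x. pd [k] \<eta> x * n $ k)" for k
    using pd_mult[OF assms(2) smooth_fun_const[of "n $ k"], of k] by simp
  have "(\<lambda>x. u x * cdiv (\<lambda>x. \<eta> x *\<^sub>R n) x + (\<Sum>k\<in>UNIV. wd U u k x * (\<eta> x *\<^sub>R n) $ k))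
    = (\<lambda>x. \<Sum>k\<in>UNIV. n $ k * (u x * pd [k] \<eta> x + wd U u k x * \<eta> x))"
    by (simp add: cdiv_def p sum_distrib_left distrib_left sum.distrib algebra_simps)
  then show ?thesis
    unfolding flux_def intg_def using flux_integrable(2)[OF assms]
    by (simp add: Bochner_Integration.integral_sum)
qed

text \<open>A cutoff depending only on the distance to the facet hyperplane has no tangential
  derivative, so it passes through the combination untouched. With it the test function is supported
  in the interior of T, where weak differentiability gives zero; then the cutoff tends to 1.\<close>

lemma flux_tangential:
  fixes T :: "(real^'n::finite) set"
  assumes T: "(int CARD('n)) simplex T" and fb: "flat_boundary T F x0 r"
    and u: "H1 (interior T) u" and \<eta>: "smooth_fun \<eta>" "compact (tsupp \<eta>)" "tsupp \<eta> \<subseteq> ball x0 r"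
    and \<tau>: "\<tau> \<bullet> outer_normal T F = 0"
  shows "(\<Sum>k\<in>UNIV. \<tau> $ k * flux (interior T) k u \<eta>) = 0"
proof -
  define U where "U = interior T"
  have U: "open U" "bounded U" "U \<in> sets lebesgue"
    using full_simplex[OF T] bounded_subset interior_subset by (auto simp: U_def)
  define n where "n = outer_normal T F"
  have F: "F facet_of T" "x0 \<in> F" using fb rel_interior_subset by (auto simp: flat_boundary_def)
  note n = outer_normal_props[OF T F(1), folded n_def]
  have neg: "n \<bullet> (y - x0) < 0" if "y \<in> U" for y
  proof -
    have "T \<subseteq> {y. n \<bullet> y \<le> n \<bullet> x0}" using n(2)[OF F(2)] by (auto simp: inner_diff_right)
    then have "interior T \<subseteq> interior {y. n \<bullet> y \<le> n \<bullet> x0}" by (rule interior_mono)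
    moreover have "n \<noteq> 0" using n(1) by auto
    ultimately show ?thesis using that by (auto simp: U_def inner_diff_right)
  qed
  \<comment> \<open>\<open>a m\<close> is m times the depth below the facet hyperplane, minus 1; for
    m > 0 the cutoff thus vanishes up to depth 1/m and is 1 from depth 2/m on.\<close>
  define a where "a m = (\<lambda>y. (- real m *\<^sub>R n) \<bullet> y + (real m * (n \<bullet> x0) - 1))" for m :: nat
  define \<zeta> where "\<zeta> m = (\<lambda>y. step (a m y))" for m
  have a: "a m y = - (real m * (n \<bullet> (y - x0))) - 1" for m y
    by (simp add: a_def inner_diff_right algebra_simps)
  have sa: "smooth_fun (a m)" for m unfolding a_def by (intro smooth_fun_add smooth_fun_inner smooth_fun_const)
  have s\<zeta>: "smooth_fun (\<zeta> m)" for m unfolding \<zeta>_def by (intro smooth_fun_step sa)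
  have pa: "has_pd (a m) k (\<lambda>x. (- real m *\<^sub>R n) $ k + 0)" for m k
    unfolding a_def by (rule has_pd_add[OF has_pd_inner has_pd_const])
  have p\<zeta>: "pd [k] (\<zeta> m) y = step' (a m y) * (- real m * n $ k)" for m k y
    unfolding \<zeta>_def using has_pd_imp_pd[OF has_pd_chain[OF pa[of m k] step_deriv]] by simp
  have tan: "(\<Sum>k\<in>UNIV. \<tau> $ k * pd [k] (\<zeta> m) y) = 0" for m y
  proof -
    have "(\<Sum>k\<in>UNIV. \<tau> $ k * pd [k] (\<zeta> m) y) = step' (a m y) * (- real m) * (\<Sum>k\<in>UNIV. \<tau> $ k * n $ k)"
      unfolding p\<zeta> sum_distrib_left by (simp add: algebra_simps)
    also have "(\<Sum>k\<in>UNIV. \<tau> $ k * n $ k) = 0" using \<tau> by (simp add: n_def inner_vec_def)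
    finally show ?thesis by simp
  qed
  have t: "test_fun U (\<lambda>y. \<eta> y * \<zeta> m y)" for m
  proof -
    have "tsupp (\<zeta> m) \<subseteq> {y. 0 \<le> a m y}"
    proof (rule tsupp_subset)
      show "closed {y. 0 \<le> a m y}"
        using smooth_fun_continuous[OF sa[of m]] by (intro closed_Collect_le continuous_intros)
      show "\<zeta> m y = 0" if "y \<notin> {y. 0 \<le> a m y}" for y using that by (simp add: \<zeta>_def step_eq_0)
    qed
    then have sub: "tsupp (\<lambda>y. \<eta> y * \<zeta> m y) \<subseteq> tsupp \<eta> \<inter> {y. 0 \<le> a m y}"
      using tsupp_mult_subset[of \<eta> "\<zeta> m"] by blast
    have "y \<in> U" if "y \<in> tsupp \<eta> \<inter> {y. 0 \<le> a m y}" for y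
    proof -
      have "real m * (n \<bullet> (y - x0)) < 0" using that by (simp add: a)
      then have "n \<bullet> (y - x0) < 0" by (metis mult_less_0_iff not_less of_nat_0_le_iff)
      then show ?thesis using that \<eta>(3) fb by (auto simp: flat_boundary_def n_def U_def)
    qed
    moreover have "compact (tsupp (\<lambda>y. \<eta> y * \<zeta> m y))"
      using sub by (intro compact_tsupp_subset[OF \<eta>(2)]) simp
    ultimately show ?thesis using sub \<eta>(1) s\<zeta> by (auto simp: test_fun_def intro: smooth_fun_mult)
  qed
  define H where "H = (\<lambda>y. \<Sum>k\<in>UNIV. \<tau> $ k * (u y * pd [k] \<eta> y + wd U u k y * \<eta> y))"
  have u': "H1 U u" using u by (simp add: U_def)
  have LH: "L2 U H" unfolding H_def by (intro L2_sum L2_cmult flux_integrable(1) u' \<eta> U)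
  have comb: "(\<Sum>k\<in>UNIV. \<tau> $ k * flux U k u \<psi>) = intg U (\<lambda>y. \<Sum>k\<in>UNIV. \<tau> $ k * (u y * pd [k] \<psi> y + wd U u k y * \<psi> y))"
    if "smooth_fun \<psi>" for \<psi>
    unfolding flux_def intg_def using flux_integrable(2)[OF u' that U(1,2)]
    by (simp add: Bochner_Integration.integral_sum)
  have H0: "intg U (\<lambda>y. H y * \<zeta> m y) = 0" for m
  proof -
    have "0 = (\<Sum>k\<in>UNIV. \<tau> $ k * flux U k u (\<lambda>y. \<eta> y * \<zeta> m y))"
      using flux_test_fun[OF u' t U(1,2)] by simp
    also have "\<dots> = intg U (\<lambda>y. \<Sum>k\<in>UNIV. \<tau> $ k * (u y * pd [k] (\<lambda>y. \<eta> y * \<zeta> m y) y + wd U u k y * (\<eta> y * \<zeta> m y)))"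
      by (intro comb smooth_fun_mult \<eta> s\<zeta>)
    also have "(\<lambda>y. \<Sum>k\<in>UNIV. \<tau> $ k * (u y * pd [k] (\<lambda>y. \<eta> y * \<zeta> m y) y + wd U u k y * (\<eta> y * \<zeta> m y)))
       = (\<lambda>y. H y * \<zeta> m y + u y * \<eta> y * (\<Sum>k\<in>UNIV. \<tau> $ k * pd [k] (\<zeta> m) y))"
      unfolding pd_mult[OF \<eta>(1) s\<zeta>] H_def
      by (rule ext) (simp add: sum_distrib_left sum_distrib_right sum.distrib[symmetric] algebra_simps)
    finally show ?thesis using tan by simp
  qed
  have lim: "(\<lambda>m. intg U (\<lambda>y. H y * \<zeta> m y)) \<longlonglongrightarrow> intg U H"
    unfolding intg_def
  proof (rule integral_dominated_convergence[where w="\<lambda>x. \<bar>H x\<bar>"])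
    show "H \<in> borel_measurable (lebesgue_on U)" by (rule L2D(1)[OF LH])
    show "(\<lambda>y. H y * \<zeta> m y) \<in> borel_measurable (lebesgue_on U)" for m
      by (intro borel_measurable_times L2D[OF LH] cont_measurable_lebesgue_on smooth_fun_continuous s\<zeta>)
    show "integrable (lebesgue_on U) (\<lambda>x. \<bar>H x\<bar>)" using L2_integrable[OF LH U(2,3)] by simp
    show "AE y in lebesgue_on U. (\<lambda>m. H y * \<zeta> m y) \<longlonglongrightarrow> H y"
    proof (rule AE_I2)
      fix y assume "y \<in> space (lebesgue_on U)"
      then have d: "- (n \<bullet> (y - x0)) > 0" using neg[of y] by simp
      obtain k :: nat where k: "2 / (- (n \<bullet> (y - x0))) < real k" using reals_Archimedean2 by blast
      have "\<forall>\<^sub>F m in sequentially. H y = H y * \<zeta> m y"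
        using eventually_ge_at_top[of k]
      proof eventually_elim
        case (elim m)
        then have "2 / (- (n \<bullet> (y - x0))) < real m" using k by linarith
        then have "2 < real m * (- (n \<bullet> (y - x0)))" using d by (subst (asm) pos_divide_less_eq) auto
        then have "a m y \<ge> 1" by (simp add: a)
        then show ?case by (simp add: \<zeta>_def step_eq_1)
      qed
      then show "(\<lambda>m. H y * \<zeta> m y) \<longlonglongrightarrow> H y" by (rule Lim_transform_eventually[OF tendsto_const])
    qed
    show "AE y in lebesgue_on U. norm (H y * \<zeta> m y) \<le> \<bar>H y\<bar>" for m
      by (intro AE_I2) (auto simp: \<zeta>_def abs_mult step_nonneg step_le_1 intro!: mult_left_le)
  qed
  then have "intg U H = 0" using LIMSEQ_unique[OF _ tendsto_const] by (simp add: H0)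
  then show ?thesis using comb[OF \<eta>(1)] by (simp add: H_def U_def)
qed

text \<open>The vector e_j - n_j n is tangential. The formula is quadratic in n, hence valid for
  either orientation.\<close>

lemma flux_normal:
  fixes T :: "(real^'n::finite) set"
  assumes T: "(int CARD('n)) simplex T" and fb: "flat_boundary T F x0 r"
    and u: "H1 (interior T) u" and \<eta>: "smooth_fun \<eta>" "compact (tsupp \<eta>)" "tsupp \<eta> \<subseteq> ball x0 r"
    and n: "n = outer_normal T F \<or> n = - outer_normal T F"
  shows "flux (interior T) j u \<eta> = n $ j * (\<Sum>k\<in>UNIV. n $ k * flux (interior T) k u \<eta>)"
proof -
  have F: "F facet_of T" using fb by (auto simp: flat_boundary_def)
  have nn: "n \<bullet> n = 1" using outer_normal_props(1)[OF T F] n by (auto simp: norm_eq_1)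
  define \<tau> where "\<tau> = axis j 1 - (n $ j) *\<^sub>R n"
  have "\<tau> \<bullet> n = 0" using nn by (simp add: \<tau>_def inner_diff_left inner_axis')
  then have "\<tau> \<bullet> outer_normal T F = 0" using n by auto
  then have "0 = (\<Sum>k\<in>UNIV. \<tau> $ k * flux (interior T) k u \<eta>)"
    by (rule flux_tangential[OF T fb u \<eta>, symmetric])
  also have "\<dots> = (\<Sum>k\<in>UNIV. (if k = j then flux (interior T) k u \<eta> else 0)) - n $ j * (\<Sum>k\<in>UNIV. n $ k * flux (interior T) k u \<eta>)"
    unfolding sum_distrib_left sum_subtractf[symmetric]
    by (rule sum.cong) (auto simp: \<tau>_def axis_def algebra_simps)
  finally show ?thesis by simp
qed

text \<open>The double sum is indexed by pairs so that \<open>H1_lincomb\<close> applies with one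
  index set.\<close>

lemma snn_eq_sum: "snn n S = (\<Sum>p\<in>UNIV. n $ fst p * n $ snd p * S $ fst p $ snd p)"
proof -
  have "snn n S = (\<Sum>a\<in>UNIV. \<Sum>b\<in>UNIV. n $ a * n $ b * S $ a $ b)"
    by (simp add: snn_def inner_vec_def matrix_vector_mult_def sum_distrib_left algebra_simps)
  also have "\<dots> = (\<Sum>p\<in>UNIV \<times> UNIV. n $ fst p * n $ snd p * S $ fst p $ snd p)"
    by (simp add: sum.cartesian_product case_prod_unfold)
  finally show ?thesis by simp
qed

text \<open>The second term is a sum over a one-element type, to give it the shape of a linear
  combination as well.\<close>

lemma snt_eq_diff: "snt n S $ i = (\<Sum>j\<in>UNIV. n $ j * S $ i $ j) - (\<Sum>b\<in>(UNIV::unit set). n $ i * snn n S)"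
  by (simp add: snt_def matrix_vector_mult_def algebra_simps)

lemma smooth_cfield_scaleR:
  assumes "smooth_fun \<eta>" "compact (tsupp \<eta>)"
  shows "smooth_cfield (\<lambda>x. \<eta> x *\<^sub>R n)" "tsupp (\<lambda>x. \<eta> x *\<^sub>R n) \<subseteq> tsupp \<eta>"
proof -
  show sub: "tsupp (\<lambda>x. \<eta> x *\<^sub>R n) \<subseteq> tsupp \<eta>" by (rule tsupp_subset) (auto simp: not_tsupp)
  then have "compact (tsupp (\<lambda>x. \<eta> x *\<^sub>R n))"
    by (rule compact_tsupp_subset[OF assms(2)])
  then show "smooth_cfield (\<lambda>x. \<eta> x *\<^sub>R n)"
    using assms(1) by (auto simp: smooth_cfield_def intro: smooth_fun_mult)
qed

lemma element_flux:
  fixes T :: "(real^'n::finite) set" and \<sigma> :: "real^'n \<Rightarrow> real^'n^'n" and i :: 'n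
  assumes T: "(int CARD('n)) simplex T" and fb: "flat_boundary T F x0 r"
    and \<sigma>: "\<And>i j. H1 (interior T) (\<lambda>x. \<sigma> x $ i $ j)" and w: "nn_H12_ext T \<sigma> w"
    and \<eta>: "smooth_fun \<eta>" "compact (tsupp \<eta>)" "tsupp \<eta> \<subseteq> ball x0 r"
    and n: "n = outer_normal T F \<or> n = - outer_normal T F"
  defines "U \<equiv> interior T" and "v \<equiv> \<lambda>x. snt n (\<sigma> x) $ i" and "\<psi> \<equiv> \<lambda>x. \<eta> x *\<^sub>R n"
  shows "(\<Sum>j\<in>UNIV. flux U j (\<lambda>x. \<sigma> x $ i $ j) \<eta>) - flux U i w \<eta>
    = intg U (\<lambda>x. v x * cdiv \<psi> x + (\<Sum>k\<in>UNIV. wd U v k x * \<psi> x $ k))"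
proof -
  have U: "open U" "bounded U" "U \<in> sets lebesgue"
    using full_simplex[OF T] bounded_subset interior_subset by (auto simp: U_def)
  have F: "F facet_of T" using fb by (auto simp: flat_boundary_def)
  have \<sigma>': "H1 U (\<lambda>x. \<sigma> x $ i $ j)" for i j using \<sigma> by (simp add: U_def)
  define N where "N u = (\<Sum>k\<in>UNIV. n $ k * flux U k u \<eta>)" for u
  have E: "flux U j u \<eta> = n $ j * N u" if "H1 U u" for u j
    using flux_normal[OF T fb _ \<eta> n] that by (simp add: N_def U_def)
  have N_lincomb: "N (\<lambda>x. \<Sum>l\<in>I. c l * f l x) = (\<Sum>l\<in>I. c l * N (f l))"
    if "finite I" "\<And>l. l \<in> I \<Longrightarrow> H1 U (f l)" for I and c :: "_ \<Rightarrow> real" and f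
  proof -
    have "flux U k (\<lambda>x. \<Sum>l\<in>I. c l * f l x) \<eta> = (\<Sum>l\<in>I. c l * flux U k (f l) \<eta>)" for k
      by (rule flux_lincomb[OF that U(1,2) \<eta>(1)])
    then show ?thesis unfolding N_def by (simp add: sum_distrib_left) (subst sum.swap, simp add: algebra_simps)
  qed
  have N_diff: "N (\<lambda>x. u x - u' x) = N u - N u'" if "H1 U u" "H1 U u'" for u u'
    unfolding N_def flux_diff[OF that U(1,2) \<eta>(1)] by (simp add: algebra_simps sum_subtractf)
  have Hw: "H1 U w" using w by (simp add: nn_H12_ext_def U_def)
  define s where "s = (\<lambda>x. snn n (\<sigma> x))"
  have Hs: "H1 U s"
    unfolding s_def snn_eq_sum using U \<sigma>' by (intro H1_lincomb) auto
  \<comment> \<open>The only use of the trace condition on \<open>w\<close>: tested with \<eta> n,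
    it identifies the normal fluxes of \<open>w\<close> and of \<sigma>_nn.\<close>
  have Nw: "N w = N s"
  proof -
    have "snn (outer_normal T F) = snn n"
      using n by (auto simp: snn_eq_sum fun_eq_iff)
    then have "trace_zero_on T F (\<lambda>x. w x - s x)"
      using w F by (auto simp: nn_H12_ext_def s_def)
    moreover have "tsupp \<psi> \<inter> frontier T \<subseteq> rel_interior F"
      using fb \<eta>(3) smooth_cfield_scaleR(2)[OF \<eta>(1,2), of n] unfolding \<psi>_def flat_boundary_def by blast
    moreover have "smooth_cfield \<psi>" unfolding \<psi>_def by (rule smooth_cfield_scaleR[OF \<eta>(1,2)])
    ultimately have "intg U (\<lambda>x. (w x - s x) * cdiv \<psi> x + (\<Sum>k\<in>UNIV. wd U (\<lambda>x. w x - s x) k x * \<psi> x $ k)) = 0"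
      by (auto simp: trace_zero_on_def U_def)
    then have "N (\<lambda>x. w x - s x) = 0"
      unfolding \<psi>_def N_def using field_flux_eq[OF flux_diff(2)[OF Hw Hs U(1,2) \<eta>(1)] \<eta>(1) U(1,2)] by simp
    then show ?thesis using N_diff[OF Hw Hs] by simp
  qed
  have v: "v = (\<lambda>x. (\<Sum>j\<in>UNIV. n $ j * \<sigma> x $ i $ j) - (\<Sum>b\<in>(UNIV::unit set). n $ i * s x))"
    unfolding v_def s_def by (rule ext) (rule snt_eq_diff)
  have H1: "H1 U (\<lambda>x. \<Sum>j\<in>UNIV. n $ j * \<sigma> x $ i $ j)" using U \<sigma>' by (intro H1_lincomb) auto
  have H2: "H1 U (\<lambda>x. \<Sum>b\<in>(UNIV::unit set). n $ i * s x)" using U Hs by (intro H1_lincomb) auto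
  have Hv: "H1 U v" unfolding v by (rule flux_diff(2)[OF H1 H2 U(1,2) \<eta>(1)])
  have "intg U (\<lambda>x. v x * cdiv \<psi> x + (\<Sum>k\<in>UNIV. wd U v k x * \<psi> x $ k)) = N v"
    unfolding \<psi>_def N_def by (rule field_flux_eq[OF Hv \<eta>(1) U(1,2)])
  also have "\<dots> = (\<Sum>j\<in>UNIV. n $ j * N (\<lambda>x. \<sigma> x $ i $ j)) - n $ i * N s"
  proof -
    have "N v = N (\<lambda>x. \<Sum>j\<in>UNIV. n $ j * \<sigma> x $ i $ j) - N (\<lambda>x. \<Sum>b\<in>(UNIV::unit set). n $ i * s x)"
      unfolding v by (rule N_diff[OF H1 H2])
    then show ?thesis using N_lincomb[of UNIV "\<lambda>j x. \<sigma> x $ i $ j" "\<lambda>j. n $ j"]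
        N_lincomb[of "UNIV::unit set" "\<lambda>_. s" "\<lambda>_. n $ i"] \<sigma>' Hs by simp
  qed
  also have "\<dots> = (\<Sum>j\<in>UNIV. flux U j (\<lambda>x. \<sigma> x $ i $ j) \<eta>) - flux U i w \<eta>"
    using E[OF \<sigma>'] E[OF Hw] Nw by simp
  finally show ?thesis by simp
qed

section \<open>Cancellation of the interface terms\<close>

lemma borel_measurable_indicator_extension:
  fixes f :: "'a::euclidean_space \<Rightarrow> real"
  assumes "f \<in> borel_measurable (lebesgue_on V)" "V \<in> sets lebesgue"
  shows "(\<lambda>x. indicator V x * f x) \<in> borel_measurable (lebesgue_on U)"
proof -
  have "(\<lambda>x. indicator V x *\<^sub>R f x) \<in> borel_measurable lebesgue"
    using assms borel_measurable_restrict_space_iff[of V lebesgue f] by simp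
  then show ?thesis by (intro measurable_restrict_space1) simp
qed

lemma integral_indicator_extension:
  fixes f :: "real^'n::finite \<Rightarrow> real"
  assumes "V \<subseteq> U" "V \<in> sets lebesgue" "U \<in> sets lebesgue"
  shows "intg U (\<lambda>x. indicator V x * f x) = intg V f"
    "integrable (lebesgue_on U) (\<lambda>x. indicator V x * f x) \<longleftrightarrow> integrable (lebesgue_on V) f"
proof -
  have eq: "(\<lambda>x. indicator U x *\<^sub>R (indicator V x * f x)) = (\<lambda>x. indicator V x *\<^sub>R f x)"
    using assms(1) by (auto simp: indicator_def fun_eq_iff)
  have "intg U (\<lambda>x. indicator V x * f x) = integral\<^sup>L lebesgue (\<lambda>x. indicator U x *\<^sub>R (indicator V x * f x))"
    unfolding intg_def using assms(3) by (intro integral_restrict_space) simp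
  moreover have "intg V f = integral\<^sup>L lebesgue (\<lambda>x. indicator V x *\<^sub>R f x)"
    unfolding intg_def using assms(2) by (intro integral_restrict_space) simp
  ultimately show "intg U (\<lambda>x. indicator V x * f x) = intg V f" unfolding eq by simp
  have "integrable (lebesgue_on U) (\<lambda>x. indicator V x * f x)
      \<longleftrightarrow> integrable lebesgue (\<lambda>x. indicator U x *\<^sub>R (indicator V x * f x))"
    using assms(3) by (intro integrable_restrict_space) simp
  moreover have "integrable (lebesgue_on V) f \<longleftrightarrow> integrable lebesgue (\<lambda>x. indicator V x *\<^sub>R f x)"
    using assms(2) by (intro integrable_restrict_space) simp
  ultimately show "integrable (lebesgue_on U) (\<lambda>x. indicator V x * f x) \<longleftrightarrow> integrable (lebesgue_on V) f"
    unfolding eq by simp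
qed

lemma L2_indicator_extension:
  assumes "L2 V f" "V \<subseteq> U" "V \<in> sets lebesgue" "U \<in> sets lebesgue"
  shows "L2 U (\<lambda>x. indicator V x * f x)"
proof -
  have "(\<lambda>x. (indicator V x * f x)\<^sup>2) = (\<lambda>x. indicator V x * (f x)\<^sup>2)" by (auto simp: indicator_def fun_eq_iff)
  then have "integrable (lebesgue_on U) (\<lambda>x. (indicator V x * f x)\<^sup>2)"
    using L2D(2)[OF assms(1)] integral_indicator_extension(2)[OF assms(2-4), of "\<lambda>x. (f x)\<^sup>2"] by simp
  then show ?thesis
    unfolding L2_def using borel_measurable_indicator_extension[OF L2D(1)[OF assms(1)] assms(3)] by blast
qed

lemma intg_subset:
  assumes "V \<subseteq> U" "V \<in> sets lebesgue" "U \<in> sets lebesgue" "\<And>x. x \<in> U - V \<Longrightarrow> f x = 0"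
  shows "intg U f = intg V f"
proof -
  have "intg U f = intg U (\<lambda>x. indicator V x * f x)"
    unfolding intg_def using assms(4) by (intro Bochner_Integration.integral_cong) (auto simp: indicator_def)
  then show ?thesis using integral_indicator_extension(1)[OF assms(1-3)] by simp
qed

section \<open>Functions glued from the elements\<close>

locale triangulated_domain =
  fixes \<Omega> :: "(real^'n::finite) set" and \<T> :: "(real^'n) set set"
  assumes lip: "lipschitz_domain \<Omega>" and tri: "simplicial_triangulation \<T> \<Omega>"
begin

lemma \<Omega>: "open \<Omega>" "bounded \<Omega>" "\<Omega> \<in> sets lebesgue"
  using lip by (auto simp: lipschitz_domain_def)

lemma finite_T: "finite \<T>" and cover: "\<Union>\<T> = closure \<Omega>"
  using tri by (auto simp: simplicial_triangulation_def)

lemma simplexT: "T \<in> \<T> \<Longrightarrow> (int CARD('n)) simplex T"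
  by (rule triangulation_simplex[OF tri])

lemma interior_subset_domain: "T \<in> \<T> \<Longrightarrow> interior T \<subseteq> \<Omega>"
  using lipschitz_domain_interior_closure[OF lip] interior_mono[of T "closure \<Omega>"] cover by blast

lemma interiorT:
  assumes "T \<in> \<T>"
  shows "open (interior T)" "bounded (interior T)" "interior T \<in> sets lebesgue" "interior T \<subseteq> \<Omega>"
  using bounded_subset[OF \<Omega>(2) interior_subset_domain[OF assms]] interior_subset_domain[OF assms] by auto

lemma negligible_skeleton: "negligible (\<Omega> - (\<Union>T\<in>\<T>. interior T))"
proof (rule negligible_subset)
  show "negligible (\<Union>T\<in>\<T>. frontier T)"
  proof (rule negligible_Union)
    show "finite (frontier ` \<T>)" using finite_T by simp
    show "negligible t" if "t \<in> frontier ` \<T>" for t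
      using that negligible_convex_frontier full_simplex(1)[OF simplexT] by auto
  qed
  show "\<Omega> - (\<Union>T\<in>\<T>. interior T) \<subseteq> (\<Union>T\<in>\<T>. frontier T)"
  proof
    fix x assume x: "x \<in> \<Omega> - (\<Union>T\<in>\<T>. interior T)"
    then have "x \<in> \<Union>\<T>" using cover closure_subset[of \<Omega>] by auto
    then obtain T where "T \<in> \<T>" "x \<in> T" by blast
    then show "x \<in> (\<Union>T\<in>\<T>. frontier T)" using x closure_subset[of T] by (auto simp: frontier_def)
  qed
qed

lemma sum_indicator_eq:
  fixes f :: "real^'n \<Rightarrow> real"
  assumes "x \<in> (\<Union>T\<in>\<T>. interior T)"
  shows "(\<Sum>T\<in>\<T>. indicator (interior T) x * f x) = f x"
proof -
  obtain T where T: "T \<in> \<T>" "x \<in> interior T" using assms by blast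
  have "indicator (interior T') x * f x = (if T' = T then f x else 0)" if "T' \<in> \<T>" for T'
    using interior_point_unique[OF tri T(1) that T(2)] T interior_subset by (auto simp: indicator_def)
  then have "(\<Sum>T\<in>\<T>. indicator (interior T) x * f x) = (\<Sum>T'\<in>\<T>. if T' = T then f x else 0)"
    by (rule sum.cong[OF refl])
  then show ?thesis using T finite_T by simp
qed

lemma AE_sum_indicator:
  fixes f :: "real^'n \<Rightarrow> real"
  shows "AE x in lebesgue_on \<Omega>. f x = (\<Sum>T\<in>\<T>. indicator (interior T) x * f x)"
proof -
  have "AE x in lebesgue. x \<notin> \<Omega> - (\<Union>T\<in>\<T>. interior T)"
    using negligible_skeleton by (intro AE_not_in) (simp only: negligible_iff_null_sets)
  then have "AE x in lebesgue. x \<in> \<Omega> \<longrightarrow> f x = (\<Sum>T\<in>\<T>. indicator (interior T) x * f x)"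
    by eventually_elim (use sum_indicator_eq in auto)
  then show ?thesis using \<Omega> by (simp add: AE_restrict_space_iff)
qed

text \<open>Nothing is known of f on the skeleton, but every subset of a null set is Lebesgue
  measurable, so each sublevel set is measurable both off the skeleton and on it.\<close>

lemma borel_measurable_glue:
  fixes f :: "real^'n \<Rightarrow> real"
  assumes "\<And>T. T \<in> \<T> \<Longrightarrow> f \<in> borel_measurable (lebesgue_on (interior T))"
  shows "f \<in> borel_measurable (lebesgue_on \<Omega>)"
proof -
  define g where "g x = (\<Sum>T\<in>\<T>. indicator (interior T) x * f x)" for x
  have g: "g \<in> borel_measurable (lebesgue_on \<Omega>)"
    unfolding g_def[abs_def]
    by (intro borel_measurable_sum borel_measurable_indicator_extension assms interiorT)
  define N where "N = \<Omega> - (\<Union>T\<in>\<T>. interior T)"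
  have N: "negligible N" using negligible_skeleton by (simp add: N_def)
  have fg: "g x = f x" if "x \<in> \<Omega>" "x \<notin> N" for x
    unfolding g_def by (rule sum_indicator_eq) (use that in \<open>auto simp: N_def\<close>)
  have "{x \<in> \<Omega>. f x \<le> a} \<in> sets lebesgue" for a
  proof -
    have e: "{x \<in> \<Omega>. f x \<le> a} = ({x \<in> \<Omega>. g x \<le> a} - N) \<union> ({x \<in> \<Omega>. f x \<le> a} \<inter> N)"
      by (auto simp: fg)
    have "{x \<in> \<Omega>. g x \<le> a} \<in> sets lebesgue"
      using g \<Omega>(3) by (simp add: borel_measurable_iff_le sets_restrict_space_iff)
    moreover have "N \<in> sets lebesgue" "{x \<in> \<Omega>. f x \<le> a} \<inter> N \<in> sets lebesgue"
      using N negligible_subset[OF N, of "{x \<in> \<Omega>. f x \<le> a} \<inter> N"] negligible_imp_sets by auto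
    ultimately show ?thesis by (subst e) (intro sets.Un sets.Diff)
  qed
  then show ?thesis using \<Omega>(3) by (simp add: borel_measurable_iff_le sets_restrict_space_iff)
qed

lemma L2_glue:
  assumes "\<And>T. T \<in> \<T> \<Longrightarrow> L2 (interior T) f"
  shows "L2 \<Omega> f"
proof -
  have m: "f \<in> borel_measurable (lebesgue_on \<Omega>)" by (intro borel_measurable_glue L2D assms)
  have "integrable (lebesgue_on \<Omega>) (\<lambda>x. \<Sum>T\<in>\<T>. indicator (interior T) x * (f x)\<^sup>2)"
  proof (rule Bochner_Integration.integrable_sum)
    fix T assume T: "T \<in> \<T>"
    show "integrable (lebesgue_on \<Omega>) (\<lambda>x. indicator (interior T) x * (f x)\<^sup>2)"
      using integral_indicator_extension(2)[OF interiorT(4,3)[OF T] \<Omega>(3), of "\<lambda>x. (f x)\<^sup>2"] L2D(2)[OF assms[OF T]]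
      by blast
  qed
  then have "integrable (lebesgue_on \<Omega>) (\<lambda>x. (f x)\<^sup>2)"
    by (rule integrable_cong_AE_imp) (use m AE_sum_indicator[of "\<lambda>x. (f x)\<^sup>2"] in auto)
  then show ?thesis using m by (simp add: L2_def)
qed

lemma intg_glue:
  assumes "\<And>T. T \<in> \<T> \<Longrightarrow> integrable (lebesgue_on (interior T)) f"
  shows "intg \<Omega> f = (\<Sum>T\<in>\<T>. intg (interior T) f)"
proof -
  have i: "integrable (lebesgue_on \<Omega>) (\<lambda>x. indicator (interior T) x * f x)" if T: "T \<in> \<T>" for T
    using integral_indicator_extension(2)[OF interiorT(4,3)[OF T] \<Omega>(3), of f] assms[OF T] by blast
  have m: "f \<in> borel_measurable (lebesgue_on \<Omega>)"
    by (rule borel_measurable_glue) (use assms in auto)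
  have "intg \<Omega> f = intg \<Omega> (\<lambda>x. \<Sum>T\<in>\<T>. indicator (interior T) x * f x)"
    by (rule intg_cong_AE[OF AE_sum_indicator m]) (use i in \<open>intro borel_measurable_sum borel_measurable_integrable\<close>)
  also have "\<dots> = (\<Sum>T\<in>\<T>. intg \<Omega> (\<lambda>x. indicator (interior T) x * f x))"
    unfolding intg_def by (rule Bochner_Integration.integral_sum[OF i])
  also have "\<dots> = (\<Sum>T\<in>\<T>. intg (interior T) f)"
    by (intro sum.cong refl integral_indicator_extension(1) interiorT \<Omega>)
  finally show ?thesis .
qed

end

lemma flux_add:
  assumes "H1 U u" "open U" "bounded U" "smooth_fun \<eta>" "smooth_fun \<eta>'"
  shows "flux U j u (\<lambda>x. \<eta> x + \<eta>' x) = flux U j u \<eta> + flux U j u \<eta>'"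
proof -
  have "flux U j u (\<lambda>x. \<eta> x + \<eta>' x)
     = intg U (\<lambda>x. (u x * pd [j] \<eta> x + wd U u j x * \<eta> x) + (u x * pd [j] \<eta>' x + wd U u j x * \<eta>' x))"
    unfolding flux_def pd_add[OF assms(4,5)] by (simp add: algebra_simps)
  then show ?thesis
    unfolding flux_def intg_def using flux_integrable(2)[OF assms(1) _ assms(2,3)] assms(4,5)
    by (simp add: Bochner_Integration.integral_add)
qed

lemma flux_eq_0:
  assumes "tsupp \<eta> \<inter> U = {}"
  shows "flux U j u \<eta> = 0"
proof -
  have "u x * pd [j] \<eta> x + wd U u j x * \<eta> x = 0" if "x \<in> U" for x
  proof -
    have "x \<notin> tsupp \<eta>" using that assms by auto
    then show ?thesis by (simp add: not_tsupp pd_not_tsupp)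
  qed
  then have "intg U (\<lambda>x. u x * pd [j] \<eta> x + wd U u j x * \<eta> x) = intg U (\<lambda>x. 0)"
    unfolding intg_def by (intro Bochner_Integration.integral_cong) auto
  then show ?thesis by (simp add: flux_def intg_def)
qed

section \<open>The elementwise defect and its cancellation\<close>

locale nt_continuous_field = triangulated_domain \<Omega> \<T>
  for \<Omega> :: "(real^'n::finite) set" and \<T> +
  fixes \<sigma> :: "real^'n \<Rightarrow> real^'n^'n" and w :: "(real^'n) set \<Rightarrow> real^'n \<Rightarrow> real"
  assumes broken: "broken_H1 \<T> \<sigma>" and ext: "\<And>T. T \<in> \<T> \<Longrightarrow> nn_H12_ext T \<sigma> (w T)"
    and ntc: "nt_continuous \<T> \<sigma>"
begin

lemma \<sigma>_H1: "T \<in> \<T> \<Longrightarrow> H1 (interior T) (\<lambda>x. \<sigma> x $ i $ j)"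
  using broken by (simp add: broken_H1_def)

lemma w_H1: "T \<in> \<T> \<Longrightarrow> H1 (interior T) (w T)"
  using ext by (simp add: nn_H12_ext_def)

text \<open>Formally the boundary integral of \<eta> times the i-th component of \<sigma> n - w n,
  that is, of the i-th component of \<sigma>_nt on the boundary of T.\<close>

definition jump :: "'n \<Rightarrow> (real^'n) set \<Rightarrow> (real^'n \<Rightarrow> real) \<Rightarrow> real" where
  "jump i T \<eta> = (\<Sum>j\<in>UNIV. flux (interior T) j (\<lambda>x. \<sigma> x $ i $ j) \<eta>) - flux (interior T) i (w T) \<eta>"

lemma jump_interior:
  assumes "T \<in> \<T>" "test_fun (interior T) \<eta>"
  shows "jump i T \<eta> = 0"
  unfolding jump_def using assms \<sigma>_H1 w_H1 interiorT by (simp add: flux_test_fun)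

lemma jump_exterior: "tsupp \<eta> \<inter> interior T = {} \<Longrightarrow> jump i T \<eta> = 0"
  unfolding jump_def by (simp add: flux_eq_0)

lemma jump_local:
  assumes r: "(\<exists>T\<in>\<T>. ball x r \<subseteq> interior T) \<or> (\<exists>T1 T2. interface \<T> x r T1 T2)"
    and \<eta>: "smooth_fun \<eta>" "compact (tsupp \<eta>)" "tsupp \<eta> \<subseteq> ball x r"
  shows "(\<Sum>T\<in>\<T>. jump i T \<eta>) = 0"
  using r
proof
  assume "\<exists>T\<in>\<T>. ball x r \<subseteq> interior T"
  then obtain T where T: "T \<in> \<T>" "ball x r \<subseteq> interior T" by blast
  have "jump i T' \<eta> = 0" if T': "T' \<in> \<T>" for T'
  proof (cases "T' = T")
    case True
    have "test_fun (interior T) \<eta>" using \<eta> T(2) by (auto simp: test_fun_def)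
    then show ?thesis using jump_interior T' True by blast
  next
    case False
    have "interior T \<inter> interior T' = {}"
      using interior_point_unique[OF tri T(1) T'] False interior_subset by blast
    then have "tsupp \<eta> \<inter> interior T' = {}" using \<eta>(3) T(2) by auto
    then show ?thesis by (rule jump_exterior)
  qed
  then show ?thesis by simp
next
  assume "\<exists>T1 T2. interface \<T> x r T1 T2"
  then obtain T1 T2 where I: "interface \<T> x r T1 T2" by blast
  define F where "F = T1 \<inter> T2"
  define n where "n = outer_normal T1 F"
  have T: "T1 \<in> \<T>" "T2 \<in> \<T>" "T1 \<noteq> T2" and fb: "flat_boundary T1 F x r" "flat_boundary T2 F x r"
    and n: "outer_normal T2 F = - n" and rest: "\<And>T. T \<in> \<T> \<Longrightarrow> T \<noteq> T1 \<Longrightarrow> T \<noteq> T2 \<Longrightarrow> ball x r \<inter> interior T = {}"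
    using I by (auto simp: interface_def F_def n_def)
  have other: "jump i T \<eta> = 0" if "T \<in> \<T> - {T1, T2}" for T
  proof (rule jump_exterior)
    show "tsupp \<eta> \<inter> interior T = {}" using rest[of T] that \<eta>(3) by blast
  qed
  define v where "v = (\<lambda>x. snt n (\<sigma> x) $ i)"
  define \<psi> where "\<psi> = (\<lambda>x. \<eta> x *\<^sub>R n)"
  have 1: "jump i T1 \<eta> = intg (interior T1) (\<lambda>x. v x * cdiv \<psi> x + (\<Sum>k\<in>UNIV. wd (interior T1) v k x * \<psi> x $ k))"
    unfolding jump_def v_def \<psi>_def
    by (rule element_flux[OF simplexT[OF T(1)] fb(1) \<sigma>_H1[OF T(1)] ext[OF T(1)] \<eta>]) (simp add: n_def)
  \<comment> \<open>\<open>v\<close> and \<open>\<psi>\<close> keep the normal of T1, which is minus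
    the outer normal of T2; the two terms then add up to the sum in
    \<open>trace_eq_across\<close>.\<close>
  have 2: "jump i T2 \<eta> = intg (interior T2) (\<lambda>x. v x * cdiv \<psi> x + (\<Sum>k\<in>UNIV. wd (interior T2) v k x * \<psi> x $ k))"
    unfolding jump_def v_def \<psi>_def
    by (rule element_flux[OF simplexT[OF T(2)] fb(2) \<sigma>_H1[OF T(2)] ext[OF T(2)] \<eta>]) (simp add: n)
  have "trace_eq_across T1 T2 F v v"
    using ntc T fb unfolding nt_continuous_def flat_boundary_def F_def v_def n_def by blast
  moreover have "smooth_cfield \<psi>" unfolding \<psi>_def by (rule smooth_cfield_scaleR[OF \<eta>(1,2)])
  moreover have "tsupp \<psi> \<inter> (frontier T1 \<union> frontier T2) \<subseteq> rel_interior F"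
    using fb \<eta>(3) smooth_cfield_scaleR(2)[OF \<eta>(1,2), of n] unfolding \<psi>_def flat_boundary_def by blast
  ultimately have "jump i T1 \<eta> + jump i T2 \<eta> = 0"
    unfolding 1 2 trace_eq_across_def by blast
  moreover have "(\<Sum>T\<in>\<T>. jump i T \<eta>) = (\<Sum>T\<in>{T1, T2}. jump i T \<eta>)"
    by (rule sum.mono_neutral_right[OF finite_T]) (use T other in auto)
  ultimately show ?thesis using T by simp
qed

lemma jump_add:
  assumes "T \<in> \<T>" "smooth_fun \<eta>" "smooth_fun \<eta>'"
  shows "jump i T (\<lambda>x. \<eta> x + \<eta>' x) = jump i T \<eta> + jump i T \<eta>'"
  unfolding jump_def using flux_add[OF \<sigma>_H1[OF assms(1)] interiorT(1,2)[OF assms(1)] assms(2,3)]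
    flux_add[OF w_H1[OF assms(1)] interiorT(1,2)[OF assms(1)] assms(2,3)]
  by (simp add: sum.distrib)

text \<open>Row i of \<sigma> - w I and, in \<open>bcoef\<close>, its elementwise divergence: the
  coefficients that bring \<open>jump\<close> into the form of
  \<open>planes_removable\<close>.\<close>

definition Acoef :: "'n \<Rightarrow> 'n \<Rightarrow> (real^'n) set \<Rightarrow> real^'n \<Rightarrow> real" where
  "Acoef i j T x = \<sigma> x $ i $ j - (if j = i then 1 else 0) * w T x"

definition bcoef :: "'n \<Rightarrow> (real^'n) set \<Rightarrow> real^'n \<Rightarrow> real" where
  "bcoef i T x = (\<Sum>j\<in>UNIV. wd (interior T) (\<lambda>y. \<sigma> y $ i $ j) j x) - wd (interior T) (w T) i x"

lemma Acoef_L2: "T \<in> \<T> \<Longrightarrow> L2 (interior T) (Acoef i j T)"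
  unfolding Acoef_def[abs_def] using \<sigma>_H1 w_H1 by (intro L2_diff L2_cmult) (auto simp: H1_def)

lemma bcoef_L2: "T \<in> \<T> \<Longrightarrow> L2 (interior T) (bcoef i T)"
  unfolding bcoef_def[abs_def] using \<sigma>_H1 w_H1 by (intro L2_diff L2_sum wd_L2) auto

lemma jump_eq_intg:
  assumes T: "T \<in> \<T>" and \<eta>: "smooth_fun \<eta>"
  shows "jump i T \<eta> = intg (interior T) (\<lambda>x. (\<Sum>j\<in>UNIV. Acoef i j T x * pd [j] \<eta> x) + bcoef i T x * \<eta> x)"
proof -
  have eq: "(\<Sum>j\<in>UNIV. Acoef i j T x * pd [j] \<eta> x) + bcoef i T x * \<eta> x
    = (\<Sum>j\<in>UNIV. \<sigma> x $ i $ j * pd [j] \<eta> x + wd (interior T) (\<lambda>y. \<sigma> y $ i $ j) j x * \<eta> x)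
      - (w T x * pd [i] \<eta> x + wd (interior T) (w T) i x * \<eta> x)" for x
  proof -
    have "(\<Sum>j\<in>UNIV. (if j = i then 1 else 0) * w T x * pd [j] \<eta> x) = (\<Sum>j\<in>UNIV. if j = i then w T x * pd [i] \<eta> x else 0)"
      by (rule sum.cong) auto
    then show ?thesis
      by (simp add: Acoef_def bcoef_def left_diff_distrib sum_subtractf sum.distrib sum_distrib_right)
  qed
  show ?thesis
    unfolding jump_def flux_def eq intg_def
    using flux_integrable(2)[OF \<sigma>_H1[OF T] \<eta> interiorT(1,2)[OF T]] flux_integrable(2)[OF w_H1[OF T] \<eta> interiorT(1,2)[OF T]]
    by (simp add: Bochner_Integration.integral_sum)
qed

text \<open>Extending the elementwise coefficients by zero and adding them up gives square
  integrable coefficients on \<Omega>, so the planes can be removed for all elements at once. Off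
  the planes every point has a ball of the kind required by \<open>jump_local\<close>.\<close>

lemma sum_jump_eq_0:
  assumes \<eta>: "test_fun \<Omega> \<eta>"
  shows "(\<Sum>T\<in>\<T>. jump i T \<eta>) = 0"
proof -
  define A where "A j x = (\<Sum>T\<in>\<T>. indicator (interior T) x * Acoef i j T x)" for j x
  define b where "b x = (\<Sum>T\<in>\<T>. indicator (interior T) x * bcoef i T x)" for x
  have LA: "L2 \<Omega> (A j)" for j unfolding A_def[abs_def]
    by (intro L2_sum L2_indicator_extension Acoef_L2 interiorT \<Omega>)
  have Lb: "L2 \<Omega> b" unfolding b_def[abs_def]
    by (intro L2_sum L2_indicator_extension bcoef_L2 interiorT \<Omega>)
  have eq: "intg \<Omega> (\<lambda>x. (\<Sum>j\<in>UNIV. A j x * pd [j] g x) + b x * g x) = (\<Sum>T\<in>\<T>. jump i T g)" if g: "smooth_fun g" for g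
  proof -
    define h where "h T x = (\<Sum>j\<in>UNIV. Acoef i j T x * pd [j] g x) + bcoef i T x * g x" for T x
    have Lh: "L2 (interior T) (h T)" if "T \<in> \<T>" for T unfolding h_def[abs_def]
      by (intro L2_add L2_sum L2_mult_cont Acoef_L2 bcoef_L2 that interiorT smooth_fun_continuous smooth_fun_pd g)
    have i: "integrable (lebesgue_on \<Omega>) (\<lambda>x. indicator (interior T) x * h T x)" if T: "T \<in> \<T>" for T
      using integral_indicator_extension(2)[OF interiorT(4,3)[OF T] \<Omega>(3), of "h T"]
        L2_integrable[OF Lh[OF T] interiorT(2,3)[OF T]] by blast
    have "(\<Sum>j\<in>UNIV. A j x * pd [j] g x) + b x * g x = (\<Sum>T\<in>\<T>. indicator (interior T) x * h T x)" for x
    proof -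
      have "(\<Sum>j\<in>UNIV. A j x * pd [j] g x) = (\<Sum>T\<in>\<T>. \<Sum>j\<in>UNIV. indicator (interior T) x * (Acoef i j T x * pd [j] g x))"
        unfolding A_def sum_distrib_right by (subst sum.swap) (simp add: mult.assoc)
      then show ?thesis
        by (simp add: b_def h_def distrib_left sum.distrib sum_distrib_left sum_distrib_right mult.assoc)
    qed
    then have "intg \<Omega> (\<lambda>x. (\<Sum>j\<in>UNIV. A j x * pd [j] g x) + b x * g x)
      = (\<Sum>T\<in>\<T>. intg \<Omega> (\<lambda>x. indicator (interior T) x * h T x))"
      unfolding intg_def using i by (simp add: Bochner_Integration.integral_sum)
    also have "\<dots> = (\<Sum>T\<in>\<T>. intg (interior T) (h T))"
      by (intro sum.cong refl integral_indicator_extension(1) interiorT \<Omega>)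
    also have "\<dots> = (\<Sum>T\<in>\<T>. jump i T g)"
      by (intro sum.cong refl) (simp add: jump_eq_intg[OF _ g] h_def[abs_def])
    finally show ?thesis .
  qed
  obtain P where P0: "finite P \<and> (\<forall>a c \<alpha> \<beta>. (a, c, \<alpha>, \<beta>) \<in> P \<longrightarrow> norm a = 1 \<and> norm c = 1 \<and> a \<bullet> c = 0) \<and>
     (\<forall>T\<in>\<T>. \<forall>G. G face_of T \<and> aff_dim G \<le> int CARD('n) - 2 \<longrightarrow> G \<subseteq> (\<Union>p\<in>P. plane2_of p))"
    using exists_low_face_planes[OF tri] by (rule exE)
  have finP: "finite P" using P0 by (rule conjunct1)
  have P: "norm a = 1 \<and> norm c = 1 \<and> a \<bullet> c = 0" if "(a, c, \<alpha>, \<beta>) \<in> P" for a c \<alpha> \<beta>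
    by (rule conjunct1[OF conjunct2[OF P0], THEN spec, THEN spec, THEN spec, THEN spec, THEN mp, OF that])
  have cov: "G \<subseteq> (\<Union>p\<in>P. plane2_of p)" if "T \<in> \<T>" "G face_of T" "aff_dim G \<le> int CARD('n) - 2" for T G
    using P0 that by simp
  have "intg \<Omega> (\<lambda>x. (\<Sum>j\<in>UNIV. A j x * pd [j] \<eta> x) + b x * \<eta> x) = 0"
  proof (rule planes_removable[OF \<Omega>(1,2) LA Lb finP P _ \<eta>])
    fix g assume g: "test_fun (\<Omega> - (\<Union>p\<in>P. plane2_of p)) g"
    have "(\<Sum>T\<in>\<T>. jump i T g) = 0"
    proof (rule test_fun_vanish_local_to_global[where B="\<lambda>g. \<Sum>T\<in>\<T>. jump i T g", OF _ _ g])
      fix f g assume "test_fun (\<Omega> - (\<Union>p\<in>P. plane2_of p)) f" "test_fun (\<Omega> - (\<Union>p\<in>P. plane2_of p)) g"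
      then show "(\<Sum>T\<in>\<T>. jump i T (\<lambda>x. f x + g x)) = (\<Sum>T\<in>\<T>. jump i T f) + (\<Sum>T\<in>\<T>. jump i T g)"
        by (simp add: jump_add test_fun_smooth sum.distrib)
    next
      fix x assume x: "x \<in> \<Omega> - (\<Union>p\<in>P. plane2_of p)"
      have "\<exists>r>0. (\<exists>T\<in>\<T>. ball x r \<subseteq> interior T) \<or> (\<exists>T1 T2. interface \<T> x r T1 T2)"
      proof (rule local_structure[OF tri \<Omega>(1)])
        show "x \<in> \<Omega>" using x by simp
        show "x \<notin> G" if "T \<in> \<T>" "G face_of T" "aff_dim G \<le> int CARD('n) - 2" for T G
          using cov[OF that] x by auto
      qed
      then obtain r where r: "r > 0" "(\<exists>T\<in>\<T>. ball x r \<subseteq> interior T) \<or> (\<exists>T1 T2. interface \<T> x r T1 T2)" by blast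
      show "\<exists>r>0. \<forall>f. test_fun (\<Omega> - (\<Union>p\<in>P. plane2_of p)) f \<and> tsupp f \<subseteq> ball x r \<longrightarrow> (\<Sum>T\<in>\<T>. jump i T f) = 0"
        using r(1) jump_local[OF r(2)] by (intro exI[of _ r]) (auto simp: test_fun_def)
    qed
    then show "intg \<Omega> (\<lambda>x. (\<Sum>j\<in>UNIV. A j x * pd [j] g x) + b x * g x) = 0"
      using eq[OF test_fun_smooth[OF g]] by simp
  qed
  then show ?thesis using eq[OF test_fun_smooth[OF \<eta>]] by simp
qed

end

section \<open>The extension of the divergence\<close>

lemma weak_div_subset:
  assumes "weak_div U v g" "V \<subseteq> U" "V \<in> sets lebesgue" "U \<in> sets lebesgue"
  shows "weak_div V v g"
  unfolding weak_div_def
proof (intro allI impI)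
  fix \<phi> assume \<phi>: "test_fun V \<phi>"
  then have out: "x \<notin> tsupp \<phi>" if "x \<in> U - V" for x using that by (auto simp: test_fun_def)
  have "cgrad \<phi> x = 0" if "x \<notin> tsupp \<phi>" for x
    using pd_not_tsupp[OF that] by (simp add: cgrad_def vec_eq_iff)
  then have "intg U (\<lambda>x. v x \<bullet> cgrad \<phi> x) = intg V (\<lambda>x. v x \<bullet> cgrad \<phi> x)"
    using out by (intro intg_subset assms) simp
  moreover have "intg U (\<lambda>x. g x * \<phi> x) = intg V (\<lambda>x. g x * \<phi> x)"
    using out by (intro intg_subset assms) (simp add: not_tsupp)
  ultimately show "intg V (\<lambda>x. v x \<bullet> cgrad \<phi> x) = - intg V (\<lambda>x. g x * \<phi> x)"
    using assms(1) test_fun_mono[OF \<phi> assms(2)] by (simp add: weak_div_def)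
qed

lemma Hdiv_subset:
  assumes "Hdiv U v" "V \<subseteq> U" "V \<in> sets lebesgue" "U \<in> sets lebesgue"
  shows "Hdiv V v"
proof -
  obtain g where g: "L2 U g" "weak_div U v g" using assms(1) by (auto simp: Hdiv_def)
  have "L2 V (\<lambda>x. v x $ k)" for k using assms(1) by (intro L2_mono[OF _ assms(2-4)]) (simp add: Hdiv_def)
  then show ?thesis
    unfolding Hdiv_def using L2_mono[OF g(1) assms(2-4)] weak_div_subset[OF g(2) assms(2-4)] by auto
qed

text \<open>Restriction to a subset commutes with the choice in \<open>wdiv\<close> only up to null
  sets.\<close>

lemma wdiv_subset_AE:
  assumes "Hdiv U v" "V \<subseteq> U" "open V" "bounded V" "U \<in> sets lebesgue"
  shows "AE x in lebesgue_on V. wdiv V v x = wdiv U v x"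
proof -
  have Vl: "V \<in> sets lebesgue" using assms by simp
  show ?thesis
    using L2_mono[OF wdiv_L2[OF assms(1)] assms(2) Vl assms(5)]
      weak_div_subset[OF wdiv_weak_div[OF assms(1)] assms(2) Vl assms(5)]
    by (rule wdiv_AE_eq[OF assms(3,4)])
qed

lemma smooth_weak_div:
  assumes \<phi>: "\<And>k. smooth_fun (\<lambda>x. \<phi> x $ k)" and U: "bounded U" "U \<in> sets lebesgue"
  shows "weak_div U \<phi> (cdiv \<phi>)"
  unfolding weak_div_def
proof (intro allI impI)
  fix \<psi> assume \<psi>: "test_fun U \<psi>"
  have s: "smooth_fun \<psi>" by (rule test_fun_smooth[OF \<psi>])
  note c = smooth_fun_continuous
  have L: "L2 U (\<lambda>x. \<phi> x $ k)" "L2 U (pd [k] (\<lambda>x. \<phi> x $ k))" for k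
    using L2_cont[OF c U] smooth_fun_pd \<phi> by blast+
  have "intg U (\<lambda>x. \<phi> x \<bullet> cgrad \<psi> x) = (\<Sum>k\<in>UNIV. intg U (\<lambda>x. \<phi> x $ k * pd [k] \<psi> x))"
    unfolding intg_def inner_vec_def cgrad_def vec_lambda_beta inner_real_def
    by (intro Bochner_Integration.integral_sum L2_mult_cont_integrable L c smooth_fun_pd s U)
  also have "\<dots> = - (\<Sum>k\<in>UNIV. intg U (\<lambda>x. pd [k] (\<lambda>x. \<phi> x $ k) x * \<psi> x))"
    unfolding sum_negf[symmetric]
    using smooth_weak_deriv[OF \<phi> U] \<psi> by (intro sum.cong refl) (auto simp: weak_deriv_def)
  also have "(\<Sum>k\<in>UNIV. intg U (\<lambda>x. pd [k] (\<lambda>x. \<phi> x $ k) x * \<psi> x)) = intg U (\<lambda>x. cdiv \<phi> x * \<psi> x)"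
    unfolding intg_def cdiv_def sum_distrib_right
    by (intro Bochner_Integration.integral_sum[symmetric] L2_mult_cont_integrable L c s U)
  finally show "intg U (\<lambda>x. \<phi> x \<bullet> cgrad \<psi> x) = - intg U (\<lambda>x. cdiv \<phi> x * \<psi> x)" .
qed

lemma continuous_cdiv:
  assumes "\<And>k. smooth_fun (\<lambda>x. \<phi> x $ k)"
  shows "continuous_on UNIV (cdiv \<phi>)"
  unfolding cdiv_def[abs_def] using assms
  by (intro continuous_on_sum smooth_fun_continuous smooth_fun_pd)

lemma smooth_Hdiv:
  assumes "\<And>k. smooth_fun (\<lambda>x. \<phi> x $ k)" "open U" "bounded U"
  shows "Hdiv U \<phi>" "AE x in lebesgue_on U. wdiv U \<phi> x = cdiv \<phi> x"
proof -
  have Ul: "U \<in> sets lebesgue" using assms by simp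
  have L: "L2 U (cdiv \<phi>)" by (intro L2_cont continuous_cdiv assms Ul)
  have W: "weak_div U \<phi> (cdiv \<phi>)" by (intro smooth_weak_div assms Ul)
  show "AE x in lebesgue_on U. wdiv U \<phi> x = cdiv \<phi> x" by (rule wdiv_AE_eq[OF assms(2,3) L W])
  show "Hdiv U \<phi>" unfolding Hdiv_def using L W L2_cont[OF smooth_fun_continuous[OF assms(1)] assms(3) Ul] by blast
qed

lemma weak_div_lincomb:
  assumes "\<And>k. L2 U (\<lambda>x. v x $ k)" "\<And>k. L2 U (\<lambda>x. v' x $ k)" "L2 U g" "L2 U g'"
    "weak_div U v g" "weak_div U v' g'" "bounded U" "U \<in> sets lebesgue"
  shows "weak_div U (\<lambda>x. a *\<^sub>R v x + b *\<^sub>R v' x) (\<lambda>x. a * g x + b * g' x)"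
  unfolding weak_div_def
proof (intro allI impI)
  fix \<phi> assume \<phi>: "test_fun U \<phi>"
  have s: "smooth_fun \<phi>" by (rule test_fun_smooth[OF \<phi>])
  note c = smooth_fun_continuous
  have i: "integrable (lebesgue_on U) (\<lambda>x. u x \<bullet> cgrad \<phi> x)" if "\<And>k. L2 U (\<lambda>x. u x $ k)" for u
    unfolding inner_vec_def cgrad_def vec_lambda_beta inner_real_def
    by (intro Bochner_Integration.integrable_sum L2_mult_cont_integrable that c smooth_fun_pd s assms)
  have j: "integrable (lebesgue_on U) (\<lambda>x. h x * \<phi> x)" if "L2 U h" for h
    by (intro L2_mult_cont_integrable that c s assms)
  have "intg U (\<lambda>x. (a *\<^sub>R v x + b *\<^sub>R v' x) \<bullet> cgrad \<phi> x) = a * intg U (\<lambda>x. v x \<bullet> cgrad \<phi> x) + b * intg U (\<lambda>x. v' x \<bullet> cgrad \<phi> x)"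
    using i[of v] i[of v'] assms(1,2) by (simp add: intg_def inner_add_left)
  also have "\<dots> = - (a * intg U (\<lambda>x. g x * \<phi> x) + b * intg U (\<lambda>x. g' x * \<phi> x))"
    using assms(5,6) \<phi> by (simp add: weak_div_def)
  also have "a * intg U (\<lambda>x. g x * \<phi> x) + b * intg U (\<lambda>x. g' x * \<phi> x) = intg U (\<lambda>x. (a * g x + b * g' x) * \<phi> x)"
    using j[OF assms(3)] j[OF assms(4)] by (simp add: intg_def distrib_right mult.assoc)
  finally show "intg U (\<lambda>x. (a *\<^sub>R v x + b *\<^sub>R v' x) \<bullet> cgrad \<phi> x) = - intg U (\<lambda>x. (a * g x + b * g' x) * \<phi> x)" .
qed

lemma Hdiv_lincomb:
  assumes "Hdiv U v" "Hdiv U v'" "open U" "bounded U"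
  shows "Hdiv U (\<lambda>x. a *\<^sub>R v x + b *\<^sub>R v' x)"
    "AE x in lebesgue_on U. wdiv U (\<lambda>x. a *\<^sub>R v x + b *\<^sub>R v' x) x = a * wdiv U v x + b * wdiv U v' x"
proof -
  have Ul: "U \<in> sets lebesgue" using assms by simp
  have c: "\<And>k. L2 U (\<lambda>x. v x $ k)" "\<And>k. L2 U (\<lambda>x. v' x $ k)" using assms by (auto simp: Hdiv_def)
  have L: "L2 U (\<lambda>x. a * wdiv U v x + b * wdiv U v' x)" by (intro L2_add L2_cmult wdiv_L2 assms)
  have W: "weak_div U (\<lambda>x. a *\<^sub>R v x + b *\<^sub>R v' x) (\<lambda>x. a * wdiv U v x + b * wdiv U v' x)"
    by (rule weak_div_lincomb) (use c assms wdiv_L2 wdiv_weak_div Ul in auto)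
  show "AE x in lebesgue_on U. wdiv U (\<lambda>x. a *\<^sub>R v x + b *\<^sub>R v' x) x = a * wdiv U v x + b * wdiv U v' x"
    by (rule wdiv_AE_eq[OF assms(3,4) L W])
  have "L2 U (\<lambda>x. (a *\<^sub>R v x + b *\<^sub>R v' x) $ k)" for k
    using L2_add[OF L2_cmult[OF c(1)] L2_cmult[OF c(2)], of a k b k] by simp
  then show "Hdiv U (\<lambda>x. a *\<^sub>R v x + b *\<^sub>R v' x)" unfolding Hdiv_def using L W by blast
qed

lemma intg_sq_le_Hdiv_norm:
  assumes v: "Hdiv \<Omega> v" and U: "U \<subseteq> \<Omega>" "open U" "bounded U" "\<Omega> \<in> sets lebesgue"
  shows "sqrt (intg U (\<lambda>x. (v x $ k)\<^sup>2)) \<le> Hdiv_norm \<Omega> v"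
    "sqrt (intg U (\<lambda>x. (wdiv U v x)\<^sup>2)) \<le> Hdiv_norm \<Omega> v"
proof -
  have Ul: "U \<in> sets lebesgue" using U by simp
  have mono: "intg U (\<lambda>x. (f x)\<^sup>2) \<le> intg \<Omega> (\<lambda>x. (f x)\<^sup>2)" if "L2 \<Omega> f" for f
  proof -
    have "intg U (\<lambda>x. (f x)\<^sup>2) = intg \<Omega> (\<lambda>x. indicator U x * (f x)\<^sup>2)"
      using integral_indicator_extension(1)[OF U(1) Ul U(4)] by simp
    also have "\<dots> \<le> intg \<Omega> (\<lambda>x. (f x)\<^sup>2)"
      unfolding intg_def
    proof (rule integral_mono[OF _ L2D(2)[OF that]])
      show "integrable (lebesgue_on \<Omega>) (\<lambda>x. indicator U x * (f x)\<^sup>2)"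
        using integral_indicator_extension(2)[OF U(1) Ul U(4), of "\<lambda>x. (f x)\<^sup>2"]
          L2D(2)[OF L2_mono[OF that U(1) Ul U(4)]] by simp
    qed (auto simp: indicator_def)
    finally show ?thesis .
  qed
  have c: "L2 \<Omega> (\<lambda>x. v x $ k)" for k using v by (simp add: Hdiv_def)
  have n2: "(norm (v x))\<^sup>2 = (\<Sum>k\<in>UNIV. (v x $ k)\<^sup>2)" for x
    unfolding power2_norm_eq_inner inner_vec_def by (simp add: power2_eq_square)
  have "intg \<Omega> (\<lambda>x. (v x $ k)\<^sup>2) \<le> intg \<Omega> (\<lambda>x. (norm (v x))\<^sup>2)"
    unfolding intg_def n2
  proof (rule integral_mono[OF L2D(2)[OF c]])
    show "integrable (lebesgue_on \<Omega>) (\<lambda>x. \<Sum>k\<in>UNIV. (v x $ k)\<^sup>2)"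
      by (intro Bochner_Integration.integrable_sum L2D(2)[OF c])
    show "(v x $ k)\<^sup>2 \<le> (\<Sum>k\<in>UNIV. (v x $ k)\<^sup>2)" for x
      by (rule member_le_sum) auto
  qed
  moreover have "0 \<le> intg \<Omega> (\<lambda>x. (wdiv \<Omega> v x)\<^sup>2)" "0 \<le> intg \<Omega> (\<lambda>x. (norm (v x))\<^sup>2)" by (auto simp: intg_def)
  ultimately show "sqrt (intg U (\<lambda>x. (v x $ k)\<^sup>2)) \<le> Hdiv_norm \<Omega> v"
    using mono[OF c[of k]] by (simp add: Hdiv_norm_def)
  have "intg U (\<lambda>x. (wdiv U v x)\<^sup>2) = intg U (\<lambda>x. (wdiv \<Omega> v x)\<^sup>2)"
  proof (rule intg_cong_AE)
    show "AE x in lebesgue_on U. (wdiv U v x)\<^sup>2 = (wdiv \<Omega> v x)\<^sup>2"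
      using wdiv_subset_AE[OF v U] by eventually_elim simp
    show "(\<lambda>x. (wdiv U v x)\<^sup>2) \<in> borel_measurable (lebesgue_on U)"
      using L2D(2)[OF wdiv_L2[OF Hdiv_subset[OF v U(1) Ul U(4)]]] by (rule borel_measurable_integrable)
    show "(\<lambda>x. (wdiv \<Omega> v x)\<^sup>2) \<in> borel_measurable (lebesgue_on U)"
      using L2D(2)[OF L2_mono[OF wdiv_L2[OF v] U(1) Ul U(4)]] by (rule borel_measurable_integrable)
  qed
  then show "sqrt (intg U (\<lambda>x. (wdiv U v x)\<^sup>2)) \<le> Hdiv_norm \<Omega> v"
    using mono[OF wdiv_L2[OF v]] \<open>0 \<le> intg \<Omega> (\<lambda>x. (norm (v x))\<^sup>2)\<close> by (simp add: Hdiv_norm_def)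
qed

text \<open>The summand of the formula with the terms in v and in its divergence collected;
  \<open>b i\<close> will be the i-th component of div \<sigma> minus the i-th derivative of
  w.\<close>

definition pairing_form :: "(real^'n::finite) set \<Rightarrow> ('n \<Rightarrow> real^'n \<Rightarrow> real) \<Rightarrow> (real^'n \<Rightarrow> real) \<Rightarrow> (real^'n \<Rightarrow> real^'n) \<Rightarrow> real" where
  "pairing_form U b w v = intg U (\<lambda>x. (\<Sum>i\<in>UNIV. b i x * v x $ i) - w x * wdiv U v x)"

lemma pairing_form_integrable:
  assumes "Hdiv U v" "\<And>i. L2 U (b i)" "L2 U w"
  shows "integrable (lebesgue_on U) (\<lambda>x. b i x * v x $ i)" "integrable (lebesgue_on U) (\<lambda>x. w x * wdiv U v x)"
  using assms by (auto intro!: L2_mult_integrable wdiv_L2 simp: Hdiv_def)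

lemma pairing_form_eq:
  assumes "Hdiv U v" "\<And>i. L2 U (b i)" "L2 U w"
  shows "pairing_form U b w v = (\<Sum>i\<in>UNIV. intg U (\<lambda>x. b i x * v x $ i)) - intg U (\<lambda>x. w x * wdiv U v x)"
  unfolding pairing_form_def intg_def
  using pairing_form_integrable[where b=b, OF assms] by (simp add: Bochner_Integration.integral_sum)

lemma pairing_form_linear:
  assumes v: "Hdiv U v" "Hdiv U v'" and U: "open U" "bounded U" and b: "\<And>i. L2 U (b i)" and w: "L2 U w"
  shows "pairing_form U b w (\<lambda>x. \<alpha> *\<^sub>R v x + \<beta> *\<^sub>R v' x) = \<alpha> * pairing_form U b w v + \<beta> * pairing_form U b w v'"
proof -
  let ?u = "\<lambda>x. \<alpha> *\<^sub>R v x + \<beta> *\<^sub>R v' x"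
  note u = Hdiv_lincomb[OF v U, of \<alpha> \<beta>]
  note i = pairing_form_integrable[where b=b, OF v(1) b w] pairing_form_integrable[where b=b, OF v(2) b w] pairing_form_integrable[where b=b, OF u(1) b w]
  have "intg U (\<lambda>x. w x * wdiv U ?u x) = intg U (\<lambda>x. \<alpha> * (w x * wdiv U v x) + \<beta> * (w x * wdiv U v' x))"
  proof (rule intg_cong_AE)
    show "AE x in lebesgue_on U. w x * wdiv U ?u x = \<alpha> * (w x * wdiv U v x) + \<beta> * (w x * wdiv U v' x)"
      using u(2) by eventually_elim (simp add: algebra_simps)
  qed (use i in \<open>auto intro!: borel_measurable_integrable\<close>)
  also have "\<dots> = \<alpha> * intg U (\<lambda>x. w x * wdiv U v x) + \<beta> * intg U (\<lambda>x. w x * wdiv U v' x)"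
    using i by (simp add: intg_def)
  finally have 1: "intg U (\<lambda>x. w x * wdiv U ?u x) = \<alpha> * intg U (\<lambda>x. w x * wdiv U v x) + \<beta> * intg U (\<lambda>x. w x * wdiv U v' x)" .
  have "intg U (\<lambda>x. b k x * ?u x $ k) = \<alpha> * intg U (\<lambda>x. b k x * v x $ k) + \<beta> * intg U (\<lambda>x. b k x * v' x $ k)" for k
  proof -
    have "intg U (\<lambda>x. b k x * ?u x $ k) = intg U (\<lambda>x. \<alpha> * (b k x * v x $ k) + \<beta> * (b k x * v' x $ k))"
      by (simp add: algebra_simps)
    then show ?thesis using i by (simp add: intg_def)
  qed
  then show ?thesis
    unfolding pairing_form_eq[where b=b, OF v(1) b w] pairing_form_eq[where b=b, OF v(2) b w] pairing_form_eq[where b=b, OF u(1) b w] 1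
    by (simp add: sum.distrib sum_distrib_left algebra_simps)
qed

text \<open>Cauchy-Schwarz is applied termwise, and the norms of v over the subset are bounded by
  the one over \<Omega>; the constant is the sum of the L2 norms of the coefficients.\<close>

lemma pairing_form_bounded:
  assumes b: "\<And>i. L2 U (b i)" and w: "L2 U w" and U: "U \<subseteq> \<Omega>" "open U" "bounded U" "\<Omega> \<in> sets lebesgue"
  shows "\<exists>C\<ge>0. \<forall>v. Hdiv \<Omega> v \<longrightarrow> \<bar>pairing_form U b w v\<bar> \<le> C * Hdiv_norm \<Omega> v"
proof -
  have Ul: "U \<in> sets lebesgue" using U by simp
  define N where "N f = sqrt (intg U (\<lambda>x. (f x)\<^sup>2))" for f
  have N0: "N f \<ge> 0" for f by (simp add: N_def intg_def)
  have bound: "\<bar>pairing_form U b w v\<bar> \<le> ((\<Sum>i\<in>UNIV. N (b i)) + N w) * Hdiv_norm \<Omega> v" if v: "Hdiv \<Omega> v" for v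
  proof -
    have vU: "Hdiv U v" by (rule Hdiv_subset[OF v U(1) Ul U(4)])
    have L: "L2 U (\<lambda>x. v x $ i)" for i using vU by (simp add: Hdiv_def)
    note n = intg_sq_le_Hdiv_norm[OF v U]
    have "\<bar>pairing_form U b w v\<bar> \<le> (\<Sum>i\<in>UNIV. \<bar>intg U (\<lambda>x. b i x * v x $ i)\<bar>) + \<bar>intg U (\<lambda>x. w x * wdiv U v x)\<bar>"
      unfolding pairing_form_eq[where b=b, OF vU b w] using sum_abs[of "\<lambda>i. intg U (\<lambda>x. b i x * v x $ i)" UNIV] by linarith
    also have "\<dots> \<le> (\<Sum>i\<in>UNIV. N (b i) * Hdiv_norm \<Omega> v) + N w * Hdiv_norm \<Omega> v"
    proof (intro add_mono sum_mono)
      show "\<bar>intg U (\<lambda>x. b i x * v x $ i)\<bar> \<le> N (b i) * Hdiv_norm \<Omega> v" for i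
        using L2_Cauchy_Schwarz[OF b L, of i i] mult_left_mono[OF n(1) N0] unfolding N_def by (meson order_trans)
      show "\<bar>intg U (\<lambda>x. w x * wdiv U v x)\<bar> \<le> N w * Hdiv_norm \<Omega> v"
        using L2_Cauchy_Schwarz[OF w wdiv_L2[OF vU]] mult_left_mono[OF n(2) N0] unfolding N_def by (meson order_trans)
    qed
    finally show ?thesis by (simp add: sum_distrib_right distrib_right)
  qed
  have "(\<Sum>i\<in>UNIV. N (b i)) + N w \<ge> 0" using N0 by (intro add_nonneg_nonneg sum_nonneg)
  then show ?thesis using bound by blast
qed

text \<open>\<open>H1_norm\<close> uses the chosen weak derivatives, which for smooth functions
  equal the classical ones almost everywhere; one partial derivative then contributes a summand of
  the squared norm.\<close>

lemma H1_norm_ge_pd: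
  assumes U: "open U" "bounded U" and \<psi>: "smooth_fun \<psi>"
  shows "intg U (\<lambda>x. (pd [i] \<psi> x)\<^sup>2) \<le> (H1_norm U \<psi>)\<^sup>2"
proof -
  have Ul: "U \<in> sets lebesgue" using U by simp
  have L: "L2 U (pd [i] \<psi>)" for i by (intro L2_cont smooth_fun_continuous smooth_fun_pd \<psi> U Ul)
  have W: "weak_deriv U \<psi> i (pd [i] \<psi>)" for i by (rule smooth_weak_deriv[OF \<psi> U(2) Ul])
  have "H1 U \<psi>" unfolding H1_def using L W L2_cont[OF smooth_fun_continuous[OF \<psi>] U(2) Ul] by blast
  then have Lw: "L2 U (wd U \<psi> i)" by (rule wd_L2)
  have "intg U (\<lambda>x. (pd [i] \<psi> x)\<^sup>2) = intg U (\<lambda>x. (wd U \<psi> i x)\<^sup>2)"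
  proof (rule intg_cong_AE)
    show "AE x in lebesgue_on U. (pd [i] \<psi> x)\<^sup>2 = (wd U \<psi> i x)\<^sup>2"
      using wd_AE_eq[OF U L[of i] W[of i]] by eventually_elim simp
  qed (rule borel_measurable_integrable[OF L2D(2)[OF L]], rule borel_measurable_integrable[OF L2D(2)[OF Lw]])
  also have "\<dots> \<le> (\<Sum>i\<in>UNIV. intg U (\<lambda>x. (wd U \<psi> i x)\<^sup>2))"
    by (rule member_le_sum) (auto simp: intg_def)
  also have "\<dots> \<le> (H1_norm U \<psi>)\<^sup>2"
  proof -
    have "0 \<le> intg U (\<lambda>x. (\<psi> x)\<^sup>2)" "0 \<le> (\<Sum>i\<in>UNIV. intg U (\<lambda>x. (wd U \<psi> i x)\<^sup>2))"
      by (auto simp: intg_def intro!: sum_nonneg)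
    then show ?thesis by (simp add: H1_norm_def)
  qed
  finally show ?thesis .
qed

section \<open>The functional on H(div), its bound and its values on test fields\<close>

context nt_continuous_field
begin

text \<open>The hypothesis on \<open>w T\<close> repeats the choice made inside
  \<open>normal_pairing\<close>, so both sides contain the same extension and the integrands can be
  merged.\<close>

lemma elem_pairing_eq:
  assumes T: "T \<in> \<T>" and v: "Hdiv (interior T) v" and w: "w T = (SOME w. nn_H12_ext T \<sigma> w)"
  shows "elem_div_pairing T \<sigma> v - normal_pairing T v \<sigma> = pairing_form (interior T) (\<lambda>i. bcoef i T) (w T) v"
proof -
  let ?U = "interior T"
  have L: "L2 ?U (\<lambda>x. v x $ i)" for i using v by (simp add: Hdiv_def)
  have Lw: "L2 ?U (w T)" using w_H1[OF T] by (simp add: H1_def)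
  have 1: "integrable (lebesgue_on ?U) (\<lambda>x. \<Sum>i\<in>UNIV. (\<Sum>j\<in>UNIV. wd ?U (\<lambda>y. \<sigma> y $ i $ j) j x) * v x $ i)"
    by (intro Bochner_Integration.integrable_sum L2_mult_integrable L2_sum wd_L2 \<sigma>_H1 T L)
  have 2: "integrable (lebesgue_on ?U) (\<lambda>x. wdiv ?U v x * w T x + (\<Sum>k\<in>UNIV. v x $ k * wd ?U (w T) k x))"
    by (intro Bochner_Integration.integrable_add Bochner_Integration.integrable_sum L2_mult_integrable wd_L2 wdiv_L2 w_H1 T L Lw v)
  show ?thesis
    unfolding elem_div_pairing_def normal_pairing_def pairing_form_def Let_def w[symmetric] intg_def
      Bochner_Integration.integral_diff[OF 1 2, symmetric]
    by (intro Bochner_Integration.integral_cong refl)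
       (simp add: bcoef_def left_diff_distrib sum_subtractf algebra_simps)
qed

text \<open>Row i of \<sigma> - w I applied to the gradient of \<phi>_i, summed over i, is \<sigma>
  : grad \<phi> - w div \<phi>. The term w div \<phi> is thus absorbed by the jumps, and what
  remains is the distributional pairing.\<close>

lemma pairing_form_smooth:
  assumes T: "T \<in> \<T>" and \<phi>: "\<And>k. smooth_fun (\<lambda>x. \<phi> x $ k)"
  shows "pairing_form (interior T) (\<lambda>i. bcoef i T) (w T) \<phi>
    = (\<Sum>i\<in>UNIV. jump i T (\<lambda>x. \<phi> x $ i))
      - intg (interior T) (\<lambda>x. \<Sum>i\<in>UNIV. \<Sum>j\<in>UNIV. \<sigma> x $ i $ j * pd [j] (\<lambda>y. \<phi> y $ i) x)"
    "integrable (lebesgue_on (interior T)) (\<lambda>x. \<Sum>i\<in>UNIV. \<Sum>j\<in>UNIV. \<sigma> x $ i $ j * pd [j] (\<lambda>y. \<phi> y $ i) x)"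
proof -
  let ?U = "interior T"
  note U = interiorT(1-3)[OF T]
  note c = smooth_fun_continuous
  have c\<phi>: "continuous_on UNIV (\<lambda>x. \<phi> x $ k)" "continuous_on UNIV (pd [j] (\<lambda>x. \<phi> x $ k))" for j k
    by (intro c smooth_fun_pd \<phi>)+
  have Lw: "L2 ?U (w T)" using w_H1[OF T] by (simp add: H1_def)
  have L\<sigma>: "L2 ?U (\<lambda>x. \<sigma> x $ i $ j)" for i j using \<sigma>_H1[OF T] by (simp add: H1_def)
  show i1: "integrable (lebesgue_on ?U) (\<lambda>x. \<Sum>i\<in>UNIV. \<Sum>j\<in>UNIV. \<sigma> x $ i $ j * pd [j] (\<lambda>y. \<phi> y $ i) x)"
    by (intro Bochner_Integration.integrable_sum L2_mult_cont_integrable L\<sigma> c\<phi> U)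
  let ?J = "\<lambda>i x. (\<Sum>j\<in>UNIV. Acoef i j T x * pd [j] (\<lambda>y. \<phi> y $ i) x) + bcoef i T x * \<phi> x $ i"
  have i2: "integrable (lebesgue_on ?U) (?J i)" for i
    by (intro Bochner_Integration.integrable_add Bochner_Integration.integrable_sum L2_mult_cont_integrable
        Acoef_L2 bcoef_L2 T c\<phi> U)
  note H = smooth_Hdiv[OF \<phi> U(1,2)]
  have i3: "integrable (lebesgue_on ?U) (\<lambda>x. (\<Sum>i\<in>UNIV. bcoef i T x * \<phi> x $ i) - w T x * cdiv \<phi> x)"
    by (intro Bochner_Integration.integrable_diff Bochner_Integration.integrable_sum L2_mult_cont_integrable
        bcoef_L2 T c\<phi> U Lw continuous_cdiv \<phi>)
  have "pairing_form ?U (\<lambda>i. bcoef i T) (w T) \<phi> = intg ?U (\<lambda>x. (\<Sum>i\<in>UNIV. bcoef i T x * \<phi> x $ i) - w T x * cdiv \<phi> x)"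
    unfolding pairing_form_def
  proof (rule intg_cong_AE)
    show "AE x in lebesgue_on ?U. (\<Sum>i\<in>UNIV. bcoef i T x * \<phi> x $ i) - w T x * wdiv ?U \<phi> x
        = (\<Sum>i\<in>UNIV. bcoef i T x * \<phi> x $ i) - w T x * cdiv \<phi> x"
      using H(2) by eventually_elim simp
    have "integrable (lebesgue_on ?U) (\<lambda>x. (\<Sum>i\<in>UNIV. bcoef i T x * \<phi> x $ i) - w T x * wdiv ?U \<phi> x)"
      by (intro Bochner_Integration.integrable_diff Bochner_Integration.integrable_sum
          pairing_form_integrable[where b="\<lambda>i. bcoef i T", OF H(1) bcoef_L2[OF T] Lw])
    then show "(\<lambda>x. (\<Sum>i\<in>UNIV. bcoef i T x * \<phi> x $ i) - w T x * wdiv ?U \<phi> x) \<in> borel_measurable (lebesgue_on ?U)"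
      by (rule borel_measurable_integrable)
  qed (rule borel_measurable_integrable[OF i3])
  also have "(\<lambda>x. (\<Sum>i\<in>UNIV. bcoef i T x * \<phi> x $ i) - w T x * cdiv \<phi> x)
      = (\<lambda>x. (\<Sum>i\<in>UNIV. ?J i x) - (\<Sum>i\<in>UNIV. \<Sum>j\<in>UNIV. \<sigma> x $ i $ j * pd [j] (\<lambda>y. \<phi> y $ i) x))"
  proof
    fix x
    have "(\<Sum>j\<in>UNIV. (if j = i then 1 else 0) * w T x * pd [j] (\<lambda>y. \<phi> y $ i) x) = w T x * pd [i] (\<lambda>y. \<phi> y $ i) x" for i
    proof -
      have "(\<Sum>j\<in>UNIV. (if j = i then 1 else 0) * w T x * pd [j] (\<lambda>y. \<phi> y $ i) x)
        = (\<Sum>j\<in>UNIV. if j = i then w T x * pd [i] (\<lambda>y. \<phi> y $ i) x else 0)"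
        by (rule sum.cong) auto
      then show ?thesis by simp
    qed
    then show "(\<Sum>i\<in>UNIV. bcoef i T x * \<phi> x $ i) - w T x * cdiv \<phi> x
      = (\<Sum>i\<in>UNIV. ?J i x) - (\<Sum>i\<in>UNIV. \<Sum>j\<in>UNIV. \<sigma> x $ i $ j * pd [j] (\<lambda>y. \<phi> y $ i) x)"
      by (simp add: Acoef_def left_diff_distrib sum_subtractf sum.distrib cdiv_def sum_distrib_left)
  qed
  also have "intg ?U \<dots> = (\<Sum>i\<in>UNIV. intg ?U (?J i))
      - intg ?U (\<lambda>x. \<Sum>i\<in>UNIV. \<Sum>j\<in>UNIV. \<sigma> x $ i $ j * pd [j] (\<lambda>y. \<phi> y $ i) x)"
    unfolding intg_def using i1 i2
    by (simp add: Bochner_Integration.integral_diff Bochner_Integration.integral_sum Bochner_Integration.integrable_sum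
        del: Bochner_Integration.integral_add)
  also have "(\<Sum>i\<in>UNIV. intg ?U (?J i)) = (\<Sum>i\<in>UNIV. jump i T (\<lambda>x. \<phi> x $ i))"
    by (intro sum.cong refl jump_eq_intg[symmetric] T \<phi>)
  finally show "pairing_form ?U (\<lambda>i. bcoef i T) (w T) \<phi>
    = (\<Sum>i\<in>UNIV. jump i T (\<lambda>x. \<phi> x $ i))
      - intg ?U (\<lambda>x. \<Sum>i\<in>UNIV. \<Sum>j\<in>UNIV. \<sigma> x $ i $ j * pd [j] (\<lambda>y. \<phi> y $ i) x)" .
qed

definition total_form :: "(real^'n \<Rightarrow> real^'n) \<Rightarrow> real" where
  "total_form v = (\<Sum>T\<in>\<T>. pairing_form (interior T) (\<lambda>i. bcoef i T) (w T) v)"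

lemma w_L2: "T \<in> \<T> \<Longrightarrow> L2 (interior T) (w T)"
  using w_H1 by (simp add: H1_def)

lemma total_form_linear:
  assumes "Hdiv \<Omega> v" "Hdiv \<Omega> v'"
  shows "total_form (\<lambda>x. \<alpha> *\<^sub>R v x + \<beta> *\<^sub>R v' x) = \<alpha> * total_form v + \<beta> * total_form v'"
  unfolding total_form_def sum_distrib_left sum.distrib[symmetric]
  by (intro sum.cong refl pairing_form_linear Hdiv_subset[OF assms(1)] Hdiv_subset[OF assms(2)] interiorT \<Omega> bcoef_L2 w_L2)

text \<open>Stated on all of H(div), so it also applies to rotated gradients without a check of the
  boundary condition.\<close>

lemma total_form_bounded: "\<exists>C\<ge>0. \<forall>v. Hdiv \<Omega> v \<longrightarrow> \<bar>total_form v\<bar> \<le> C * Hdiv_norm \<Omega> v"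
proof -
  have "\<forall>T\<in>\<T>. \<exists>C\<ge>0. \<forall>v. Hdiv \<Omega> v \<longrightarrow> \<bar>pairing_form (interior T) (\<lambda>i. bcoef i T) (w T) v\<bar> \<le> C * Hdiv_norm \<Omega> v"
    by (intro ballI pairing_form_bounded bcoef_L2 w_L2 interiorT \<Omega>)
  then obtain C where C: "\<And>T. T \<in> \<T> \<Longrightarrow> C T \<ge> 0"
    "\<And>T v. T \<in> \<T> \<Longrightarrow> Hdiv \<Omega> v \<Longrightarrow> \<bar>pairing_form (interior T) (\<lambda>i. bcoef i T) (w T) v\<bar> \<le> C T * Hdiv_norm \<Omega> v"
    by metis
  have "\<bar>total_form v\<bar> \<le> (\<Sum>T\<in>\<T>. C T) * Hdiv_norm \<Omega> v" if "Hdiv \<Omega> v" for v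
    unfolding total_form_def sum_distrib_right using C(2)[OF _ that]
    by (intro order_trans[OF sum_abs] sum_mono)
  moreover have "(\<Sum>T\<in>\<T>. C T) \<ge> 0" using C(1) by (rule sum_nonneg)
  ultimately show ?thesis by blast
qed

text \<open>The jumps cancel separately for each component of \<phi>, because
  \<open>sum_jump_eq_0\<close> treats each row i with its own scalar test function.\<close>

lemma total_form_test:
  assumes \<phi>: "\<And>i. test_fun \<Omega> (\<lambda>x. \<phi> x $ i)"
  shows "total_form \<phi> = - intg \<Omega> (\<lambda>x. \<Sum>i\<in>UNIV. \<Sum>j\<in>UNIV. \<sigma> x $ i $ j * pd [j] (\<lambda>y. \<phi> y $ i) x)"
proof -
  have s: "smooth_fun (\<lambda>x. \<phi> x $ i)" for i by (rule test_fun_smooth[OF \<phi>])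
  let ?f = "\<lambda>x. \<Sum>i\<in>UNIV. \<Sum>j\<in>UNIV. \<sigma> x $ i $ j * pd [j] (\<lambda>y. \<phi> y $ i) x"
  have "total_form \<phi> = (\<Sum>T\<in>\<T>. (\<Sum>i\<in>UNIV. jump i T (\<lambda>x. \<phi> x $ i)) - intg (interior T) ?f)"
    unfolding total_form_def using pairing_form_smooth(1)[OF _ s] by (intro sum.cong) auto
  also have "\<dots> = (\<Sum>i\<in>UNIV. \<Sum>T\<in>\<T>. jump i T (\<lambda>x. \<phi> x $ i)) - (\<Sum>T\<in>\<T>. intg (interior T) ?f)"
    unfolding sum_subtractf by (subst sum.swap) simp
  also have "\<dots> = - intg \<Omega> ?f"
    using sum_jump_eq_0[OF \<phi>] intg_glue[OF pairing_form_smooth(2)[OF _ s]] by simp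
  finally show ?thesis .
qed

lemma div_extension_total_form: "div_extension \<Omega> \<sigma> total_form"
  unfolding div_extension_def
proof (intro conjI)
  show "\<forall>v w a b. H0div \<Omega> v \<and> H0div \<Omega> w \<longrightarrow> total_form (\<lambda>x. a *\<^sub>R v x + b *\<^sub>R w x) = a * total_form v + b * total_form w"
    using total_form_linear by (simp add: H0div_def)
  show "\<exists>C. \<forall>v. H0div \<Omega> v \<longrightarrow> \<bar>total_form v\<bar> \<le> C * Hdiv_norm \<Omega> v"
    using total_form_bounded by (auto simp: H0div_def)
  show "\<forall>\<phi>. (\<forall>i. test_fun \<Omega> (\<lambda>x. \<phi> x $ i)) \<longrightarrow>
      total_form \<phi> = - intg \<Omega> (\<lambda>x. \<Sum>i\<in>UNIV. \<Sum>j\<in>UNIV. \<sigma> x $ i $ j * pd [j] (\<lambda>y. \<phi> y $ i) x)"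
    using total_form_test by blast
qed

text \<open>The distribution \<open>curl (div \<sigma>)\<close> is \<open>div \<sigma>\<close> tested with a rotated gradient, which is
  divergence free, so that its H(div) norm is controlled by the \<open>H\<^sup>1\<close> norm of the potential.\<close>
lemma Hcurldiv_field: "Hcurldiv \<Omega> \<sigma>"
  unfolding Hcurldiv_def
proof (intro conjI allI)
  show "L2 \<Omega> (\<lambda>x. \<sigma> x $ i $ j)" for i j
    using \<sigma>_H1 by (intro L2_glue) (simp add: H1_def)
  fix i j :: 'n
  obtain C where C: "C \<ge> 0" "\<And>v. Hdiv \<Omega> v \<Longrightarrow> \<bar>total_form v\<bar> \<le> C * Hdiv_norm \<Omega> v"
    using total_form_bounded by blast
  have "\<bar>intg \<Omega> (\<lambda>x. \<Sum>k\<in>UNIV. \<sigma> x $ j $ k * pd [k, i] \<psi> x - \<sigma> x $ i $ k * pd [k, j] \<psi> x)\<bar> \<le> (C * 2) * H1_norm \<Omega> \<psi>"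
    if \<psi>: "test_fun \<Omega> \<psi>" for \<psi>
  proof -
    have s: "smooth_fun \<psi>" by (rule test_fun_smooth[OF \<psi>])
    \<comment> \<open>\<open>a\<close> and \<open>b\<close> are the components of e_j and - e_i. As
      constants they let the closure rules for test functions and derivatives apply componentwise,
      and the case i = j is covered without a case split.\<close>
    define a where "a k = (if k = j then 1 else 0 :: real)" for k
    define b where "b k = (if k = i then - 1 else 0 :: real)" for k
    define \<phi> where "\<phi> = (\<lambda>x. pd [i] \<psi> x *\<^sub>R axis j 1 - pd [j] \<psi> x *\<^sub>R axis i (1::real))"
    have comp: "(\<lambda>x. \<phi> x $ k) = (\<lambda>x. pd [i] \<psi> x * a k + pd [j] \<psi> x * b k)" for k
      by (auto simp: \<phi>_def axis_def a_def b_def)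
    have t: "test_fun \<Omega> (\<lambda>x. \<phi> x $ k)" for k
      unfolding comp by (intro test_fun_add test_fun_mult test_fun_pd \<psi> smooth_fun_const)
    have sc: "smooth_fun (\<lambda>x. \<phi> x $ k)" for k by (rule test_fun_smooth[OF t])
    have pdc: "pd [l] (\<lambda>x. \<phi> x $ k) = (\<lambda>x. pd [l, i] \<psi> x * a k + pd [l, j] \<psi> x * b k)" for k l
    proof -
      have "has_pd (\<lambda>x. pd [i] \<psi> x * a k + pd [j] \<psi> x * b k) l
        (\<lambda>x. (pd [l] (pd [i] \<psi>) x * a k + pd [i] \<psi> x * 0) + (pd [l] (pd [j] \<psi>) x * b k + pd [j] \<psi> x * 0))"
        by (intro has_pd_add has_pd_mult has_pd_const smooth_fun_has_pd smooth_fun_pd s)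
      then show ?thesis unfolding comp using has_pd_imp_pd by (simp add: pd_Cons[of l "[i]"] pd_Cons[of l "[j]"])
    qed
    have "(\<Sum>k\<in>UNIV. \<Sum>l\<in>UNIV. \<sigma> x $ k $ l * pd [l] (\<lambda>y. \<phi> y $ k) x)
      = (\<Sum>l\<in>UNIV. \<sigma> x $ j $ l * pd [l, i] \<psi> x - \<sigma> x $ i $ l * pd [l, j] \<psi> x)" for x
    proof -
      have "(\<Sum>k\<in>UNIV. \<sigma> x $ k $ l * (pd [l, i] \<psi> x * a k + pd [l, j] \<psi> x * b k))
        = \<sigma> x $ j $ l * pd [l, i] \<psi> x - \<sigma> x $ i $ l * pd [l, j] \<psi> x" for l
      proof -
        have "(\<Sum>k\<in>UNIV. \<sigma> x $ k $ l * (pd [l, i] \<psi> x * a k + pd [l, j] \<psi> x * b k))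
          = (\<Sum>k\<in>UNIV. if k = j then \<sigma> x $ j $ l * pd [l, i] \<psi> x else 0)
            + (\<Sum>k\<in>UNIV. if k = i then - (\<sigma> x $ i $ l * pd [l, j] \<psi> x) else 0)"
          unfolding sum.distrib[symmetric] by (rule sum.cong) (auto simp: a_def b_def)
        then show ?thesis by simp
      qed
      then show ?thesis unfolding pdc by (subst sum.swap) simp
    qed
    then have eq: "intg \<Omega> (\<lambda>x. \<Sum>k\<in>UNIV. \<sigma> x $ j $ k * pd [k, i] \<psi> x - \<sigma> x $ i $ k * pd [k, j] \<psi> x) = - total_form \<phi>"
      using total_form_test[OF t] by simp
    note H = smooth_Hdiv[OF sc \<Omega>(1,2)]
    have "cdiv \<phi> x = 0" for x
    proof -
      have "cdiv \<phi> x = (\<Sum>k\<in>UNIV. if k = j then pd [j, i] \<psi> x else 0) + (\<Sum>k\<in>UNIV. if k = i then - pd [i, j] \<psi> x else 0)"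
        unfolding cdiv_def pdc sum.distrib[symmetric] by (rule sum.cong) (auto simp: a_def b_def)
      then show ?thesis using mixed_partials_commute[OF s, of i j] by simp
    qed
    then have "intg \<Omega> (\<lambda>x. (wdiv \<Omega> \<phi> x)\<^sup>2) = intg \<Omega> (\<lambda>x. 0)"
      using H(2) L2D(2)[OF wdiv_L2[OF H(1)]] by (intro intg_cong_AE) auto
    then have div0: "intg \<Omega> (\<lambda>x. (wdiv \<Omega> \<phi> x)\<^sup>2) = 0" by (simp add: intg_def)
    have ip: "integrable (lebesgue_on \<Omega>) (\<lambda>x. (pd [k] \<psi> x)\<^sup>2)" for k
      by (rule L2D(2)) (intro L2_cont smooth_fun_continuous smooth_fun_pd s \<Omega>)
    \<comment> \<open>Each square on the right has integral at most the squared H1 norm, so the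
      integral of |\<phi>|^2 is at most 4 times it; this is the factor 2 in
      \<open>C * 2\<close>.\<close>
    have pw: "(norm (\<phi> x))\<^sup>2 \<le> 2 * (pd [i] \<psi> x)\<^sup>2 + 2 * (pd [j] \<psi> x)\<^sup>2" for x
    proof -
      have "norm (\<phi> x) \<le> \<bar>pd [i] \<psi> x\<bar> + \<bar>pd [j] \<psi> x\<bar>"
        using norm_triangle_ineq4[of "pd [i] \<psi> x *\<^sub>R axis j (1::real)" "pd [j] \<psi> x *\<^sub>R axis i 1"] by (simp add: \<phi>_def)
      then have "(norm (\<phi> x))\<^sup>2 \<le> (\<bar>pd [i] \<psi> x\<bar> + \<bar>pd [j] \<psi> x\<bar>)\<^sup>2" by (intro power_mono) auto
      also have "\<dots> \<le> 2 * (pd [i] \<psi> x)\<^sup>2 + 2 * (pd [j] \<psi> x)\<^sup>2"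
        using zero_le_power2[of "\<bar>pd [i] \<psi> x\<bar> - \<bar>pd [j] \<psi> x\<bar>"] by (simp add: power2_sum power2_diff)
      finally show ?thesis .
    qed
    have "intg \<Omega> (\<lambda>x. (norm (\<phi> x))\<^sup>2) \<le> intg \<Omega> (\<lambda>x. 2 * (pd [i] \<psi> x)\<^sup>2 + 2 * (pd [j] \<psi> x)\<^sup>2)"
      unfolding intg_def
    proof (rule integral_mono_AE')
      show "integrable (lebesgue_on \<Omega>) (\<lambda>x. 2 * (pd [i] \<psi> x)\<^sup>2 + 2 * (pd [j] \<psi> x)\<^sup>2)"
        using ip by (intro Bochner_Integration.integrable_add integrable_mult_right)
    qed (use pw in auto)
    also have "\<dots> = 2 * intg \<Omega> (\<lambda>x. (pd [i] \<psi> x)\<^sup>2) + 2 * intg \<Omega> (\<lambda>x. (pd [j] \<psi> x)\<^sup>2)"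
      using ip by (simp add: intg_def)
    also have "\<dots> \<le> (2 * H1_norm \<Omega> \<psi>)\<^sup>2"
      using H1_norm_ge_pd[OF \<Omega>(1,2) s, of i] H1_norm_ge_pd[OF \<Omega>(1,2) s, of j] by (simp add: power_mult_distrib)
    finally have "Hdiv_norm \<Omega> \<phi> \<le> sqrt ((2 * H1_norm \<Omega> \<psi>)\<^sup>2)"
      unfolding Hdiv_norm_def div0 by simp
    moreover have "H1_norm \<Omega> \<psi> \<ge> 0" by (simp add: H1_norm_def intg_def sum_nonneg)
    ultimately have "Hdiv_norm \<Omega> \<phi> \<le> 2 * H1_norm \<Omega> \<psi>" unfolding real_sqrt_abs by linarith
    then have "C * Hdiv_norm \<Omega> \<phi> \<le> C * (2 * H1_norm \<Omega> \<psi>)" using C(1) by (rule mult_left_mono)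
    then show ?thesis unfolding eq using C(2)[OF H(1)] by (simp add: mult.assoc)
  qed
  then show "\<exists>C. \<forall>\<psi>. test_fun \<Omega> \<psi> \<longrightarrow>
      \<bar>intg \<Omega> (\<lambda>x. \<Sum>k\<in>UNIV. \<sigma> x $ j $ k * pd [k, i] \<psi> x - \<sigma> x $ i $ k * pd [k, j] \<psi> x)\<bar> \<le> C * H1_norm \<Omega> \<psi>"
    by blast
qed

end

theorem theorem4p1:
  fixes \<Omega> :: "(real^'n::finite) set"
    and \<T> :: "(real^'n) set set"
    and \<sigma> :: "real^'n \<Rightarrow> real^'n^'n"
  assumes "CARD('n) = 2 \<or> CARD('n) = 3"
    and "lipschitz_domain \<Omega>"
    and "simplicial_triangulation \<T> \<Omega>"
    and "broken_H1 \<T> \<sigma>"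
    and "\<forall>T\<in>\<T>. nn_in_H12 T \<sigma>"
    and "nt_continuous \<T> \<sigma>"
  shows "Hcurldiv \<Omega> \<sigma> \<and>
         (\<exists>L. div_extension \<Omega> \<sigma> L \<and>
              (\<forall>v. H0div \<Omega> v \<longrightarrow>
                 L v = (\<Sum>T\<in>\<T>. elem_div_pairing T \<sigma> v - normal_pairing T v \<sigma>)))"
proof -
  \<comment> \<open>The choice made in \<open>normal_pairing\<close>, so that both extensions are
    equal by definition.\<close>
  define w where "w T = (SOME w. nn_H12_ext T \<sigma> w)" for T
  have w: "nn_H12_ext T \<sigma> (w T)" if "T \<in> \<T>" for T
  proof -
    have "\<exists>w. nn_H12_ext T \<sigma> w" using assms(5) that by (simp add: nn_in_H12_def)
    then show ?thesis unfolding w_def by (rule someI_ex)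
  qed
  interpret nt_continuous_field \<Omega> \<T> \<sigma> w
    by unfold_locales (use assms w in auto)
  have "total_form v = (\<Sum>T\<in>\<T>. elem_div_pairing T \<sigma> v - normal_pairing T v \<sigma>)" if "H0div \<Omega> v" for v
    unfolding total_form_def
  proof (intro sum.cong refl)
    fix T assume T: "T \<in> \<T>"
    have "Hdiv (interior T) v"
      using that Hdiv_subset[OF _ interiorT(4,3)[OF T] \<Omega>(3)] by (simp add: H0div_def)
    then show "pairing_form (interior T) (\<lambda>i. bcoef i T) (w T) v = elem_div_pairing T \<sigma> v - normal_pairing T v \<sigma>"
      using elem_pairing_eq[OF T] by (simp add: w_def)
  qed
  then show ?thesis using Hcurldiv_field div_extension_total_form by blast
qed

end
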